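(* Let $f=\frac1n\sum_{i=1}^n f_i$ on $\mathbb{R}^d$, let $\mathbf{A}\in\mathbb{R}^{n\times n}$ be a row-stochastic mixing matrix of a directed strongly connected network as in the context, let each $f_i$ be $L$-smooth with $L>0$, let $f^*=\inf_{\mathbf{x}\in\mathbb{R}^d} f(\mathbf{x})>-\infty$, and let the local stochastic gradient oracles satisfy the $p$-th bounded central moment condition with $p\in(1,2]$ and $\sigma>0$. Let $\bar{\mathbf{x}}_0$ be the common starting point, $\Delta:=f(\bar{\mathbf{x}}_0)-f^*$, and let $\epsilon>0$ be the target accuracy. Then Algorithm DNSGD-PD (described in the context), run with suitable parameter settings $$T=\Theta\!\left(L\Delta\epsilon^{-2}\right),\quad \eta=\Theta(\epsilon/L),\quad b=\Theta\!\left(n^{-1}\sigma^{\frac{p}{p-1}}\epsilon^{-\frac{p}{p-1}}\right),\quad \hat K=K=\tilde\Theta\!\left(\frac{1}{1-\beta}\right),$$ guarantees $$\mathbb{E}\left[\|\nabla f(\hat{\mathbf{x}}_i)\|\right]\le \epsilon\qquad\text{for all } i\in[n].$$ Moreover, it uses an overall sample complexity of $\mathcal{O}\!\left(L\,\sigma^{\frac{p}{p-1}}\epsilon^{-\frac{3p-2}{p-1}}\Delta\right)$ and a communication complexity of $\tilde{\mathcal{O}}\!\left(L(1-\beta)^{-1}\epsilon^{-2}\Delta\right)$.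
   Context: **Network.** $\mathcal{G}=(\mathcal{V},\mathcal{E})$ is a directed, strongly connected graph with node set $\mathcal{V}=[n]=\{1,\dots,n\}$ (the agents) and directed edge set $\mathcal{E}$. The mixing matrix $\mathbf{A}=[a_{ij}]\in\mathbb{R}^{n\times n}$ satisfies $\mathbf{A}\mathbf{1}=\mathbf{1}$ ($\mathbf 1$ is the all-ones vector), $a_{ij}\in(0,1]$ if $(i\to j)\in\mathcal{E}$ or $i=j$, and $a_{ij}=0$ otherwise. There is a unique vector $\boldsymbol\pi=[\pi_1,\dots,\pi_n]^\top$ with positive entries, $\boldsymbol\pi^\top\mathbf{A}=\boldsymbol\pi^\top$, $\boldsymbol\pi^\top\mathbf{1}=1$, and $\lim_k\mathbf{A}^k=\mathbf{1}\boldsymbol\pi^\top$. With $\boldsymbol\Pi=\operatorname{diag}(\boldsymbol\pi)$ and $\|\mathbf{M}\|_{\boldsymbol\pi}:=\|\boldsymbol\Pi^{1/2}\mathbf{M}\boldsymbol\Pi^{-1/2}\|_2$ (spectral norm), put $\beta:=\|\mathbf{A}-\mathbf{1}\boldsymbol\pi^\top\|_{\boldsymbol\pi}$ and $\kappa:=\max_i\pi_i/\min_i\pi_i$. **Problem.** $f_i(\mathbf{x})=\mathbb{E}_{\boldsymbol\xi_i\sim\mathcal{D}_i}[F_i(\mathbf{x};\boldsymbol\xi_i)]$, where the distributions $\mathcal{D}_i$ may differ across agents. $L$-smooth means $\|\nabla f_i(\mathbf{x})-\nabla f_i(\mathbf{y})\|\le L\|\mathbf{x}-\mathbf{y}\|$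 for all $\mathbf{x},\mathbf{y}\in\mathbb{R}^d$. Oracle condition: for all $i\in[n]$ and $\mathbf{x}\in\mathbb{R}^d$, with $\boldsymbol\xi_i\sim\mathcal{D}_i$, $\mathbb{E}[\nabla F_i(\mathbf{x};\boldsymbol\xi_i)]=\nabla f_i(\mathbf{x})$ and $\mathbb{E}[\|\nabla F_i(\mathbf{x};\boldsymbol\xi_i)-\nabla f_i(\mathbf{x})\|^p]\le\sigma^p$. **Algorithm DNSGD-PD.** Inputs: $\bar{\mathbf{x}}_0\in\mathbb{R}^{1\times d}$, $\mathbf{A}$, step size $\eta>0$, positive integers $\hat K,K,T,b$. Row $i$ of the $n\times d$ matrices $\mathbf{X}_t,\mathbf{V}_t,\mathbf{G}_t$ is held by agent $i$; the rows of $\mathbf{X}_t$ and $\mathbf{V}_t$ are $\mathbf{x}_{t,i}$ and $\mathbf{v}_{t,i}$. Let $\mathbf{D}_t:=\operatorname{Diag}(\mathbf{A}^{(t+1)K})$ be the diagonal matrix having the same diagonal as $\mathbf{A}^{(t+1)K}$. At each iteration $t$ every agent $i$ independently draws $b$ fresh samples $\boldsymbol\xi_{t,i,1},\dots,\boldsymbol\xi_{t,i,b}\sim\mathcal{D}_i$ (all samples are independent), and row $i$ of $\mathbf{G}_t$ is $\frac1b\sum_{k=1}^b\nabla F_i(\mathbf{x}_{t,i};\boldsymbol\xi_{t,i,k})$. Initialize $\mathbf{X}_0=\mathbf{1}\bar{\mathbf{x}}_0$, $\mathbf{V}_0=\mathbf{A}^{\hat K}\mathbf{D}_0^{-1}\mathbf{G}_0$.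 For $t=0,\dots,T-1$: let $\mathbf{U}_t$ have rows $\mathbf{v}_{t,i}/\|\mathbf{v}_{t,i}\|$ (read as $\mathbf 0$ if $\mathbf{v}_{t,i}=\mathbf 0$), and set $$\mathbf{X}_{t+1}=\mathbf{A}^K(\mathbf{X}_t-\eta\mathbf{U}_t),\qquad \mathbf{V}_{t+1}=\mathbf{A}^K(\mathbf{V}_t+\mathbf{D}_{t+1}^{-1}\mathbf{G}_{t+1}-\mathbf{D}_t^{-1}\mathbf{G}_t).$$ Output: for each agent $i$, $\hat{\mathbf{x}}_i$ drawn uniformly from $\{\mathbf{x}_{0,i},\dots,\mathbf{x}_{T-1,i}\}$. **Complexity measures and asymptotic notation.** Overall sample complexity is the total number of stochastic gradient evaluations over all $n$ agents; communication complexity is the number of communication rounds, one multiplication by $\mathbf{A}$ being one round. Constants hidden in $\Theta,\mathcal{O}$ are universal, except that those involving $b$ may depend on $p$. $\tilde\Theta,\tilde{\mathcal{O}}$ additionally hide factors logarithmic in the problem quantities ($n,\kappa,L,\Delta,\sigma,1/\epsilon$ and the initial local gradient norms $\|\nabla f_i(\bar{\mathbf{x}}_0)\|$). $T,b,K,\hat K$ are rounded up to positive integers, and the complexity bounds are understood in the usual regime of small $\epsilon$ where this rounding changes $T$ and $b$ by at most a constant factor. *)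

theory Defs
  imports "HOL-Probability.Probability"
begin

section \<open>Network\<close>

primrec mat_pow :: "real^'n^'n \<Rightarrow> nat \<Rightarrow> real^'n^'n" where
  "mat_pow A 0 = mat 1"
| "mat_pow A (Suc k) = A ** mat_pow A k"

definition diag_mat :: "real^'n \<Rightarrow> real^'n^'n" where
  "diag_mat v = (\<chi> i j. if i = j then v $ i else 0)"

definition diag_part :: "real^'n^'n \<Rightarrow> real^'n^'n" where
  "diag_part M = diag_mat (\<chi> i. M $ i $ i)"

definition strongly_connected_graph :: "('n \<times> 'n) set \<Rightarrow> bool" where
  "strongly_connected_graph E \<longleftrightarrow> (\<forall>i j. (i, j) \<in> E\<^sup>*)"

(* "1 :: real^'n" is the all-ones vector. *)
definition mixing_matrix :: "('n::finite \<times> 'n) set \<Rightarrow> real^'n^'n \<Rightarrow> bool" where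
  "mixing_matrix E A \<longleftrightarrow> A *v 1 = 1 \<and>
     (\<forall>i j. if (i, j) \<in> E \<or> i = j then 0 < A $ i $ j \<and> A $ i $ j \<le> 1 else A $ i $ j = 0)"

(* For a mixing matrix of a strongly connected graph these conditions have exactly one solution. *)
definition perron_vector :: "real^'n^'n \<Rightarrow> real^'n \<Rightarrow> bool" where
  "perron_vector A \<pi> \<longleftrightarrow> (\<forall>i. 0 < \<pi> $ i) \<and> \<pi> v* A = \<pi> \<and> (\<Sum>i\<in>UNIV. \<pi> $ i) = 1"

definition spectral_norm :: "real^'n^'n \<Rightarrow> real" where
  "spectral_norm M = onorm (\<lambda>v. M *v v)"

definition pi_norm :: "real^'n \<Rightarrow> real^'n^'n \<Rightarrow> real" where
  "pi_norm \<pi> M =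
     spectral_norm (diag_mat (\<chi> i. sqrt (\<pi> $ i)) ** M ** diag_mat (\<chi> i. 1 / sqrt (\<pi> $ i)))"

(* The subtracted matrix is the outer product of the all-ones column and the row vector pi. *)
definition net_beta :: "real^'n^'n \<Rightarrow> real^'n \<Rightarrow> real" where
  "net_beta A \<pi> = pi_norm \<pi> (A - (\<chi> i j. \<pi> $ j))"

definition net_kappa :: "real^'n \<Rightarrow> real" where
  "net_kappa \<pi> = Max (range (\<lambda>i. \<pi> $ i)) / Min (range (\<lambda>i. \<pi> $ i))"


section \<open>Stochastic optimization problem\<close>

definition grad :: "('a::real_inner \<Rightarrow> real) \<Rightarrow> 'a \<Rightarrow> 'a" where
  "grad g x = (THE v. GDERIV g x :> v)"

definition L_smooth :: "real \<Rightarrow> ('a::euclidean_space \<Rightarrow> real) \<Rightarrow> bool" where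
  "L_smooth L g \<longleftrightarrow> (\<forall>x. g differentiable (at x)) \<and>
     (\<forall>x y. norm (grad g x - grad g y) \<le> L * norm (x - y))"

definition local_obj ::
    "('n \<Rightarrow> 's measure) \<Rightarrow> ('n \<Rightarrow> real^'d \<Rightarrow> 's \<Rightarrow> real) \<Rightarrow> 'n \<Rightarrow> real^'d \<Rightarrow> real" where
  "local_obj \<D> F i x = (\<integral>\<xi>. F i x \<xi> \<partial>\<D> i)"

definition global_obj ::
    "('n::finite \<Rightarrow> 's measure) \<Rightarrow> ('n \<Rightarrow> real^'d \<Rightarrow> 's \<Rightarrow> real) \<Rightarrow> real^'d \<Rightarrow> real" where
  "global_obj \<D> F x = 1 / real CARD('n) * (\<Sum>i\<in>UNIV. local_obj \<D> F i x)"

definition stoch_grad :: "('n \<Rightarrow> real^'d \<Rightarrow> 's \<Rightarrow> real) \<Rightarrow> 'n \<Rightarrow> real^'d \<Rightarrow> 's \<Rightarrow> real^'d" where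
  "stoch_grad F i x \<xi> = grad (\<lambda>y. F i y \<xi>) x"

(* The integrability clause makes the expectations in local_obj meaningful (a Bochner integral
   defaults to 0 otherwise); differentiability does the same for the gradients in stoch_grad. *)
definition stochastic_problem ::
    "('n \<Rightarrow> 's measure) \<Rightarrow> ('n \<Rightarrow> real^'d \<Rightarrow> 's \<Rightarrow> real) \<Rightarrow> bool" where
  "stochastic_problem \<D> F \<longleftrightarrow>
     (\<forall>i. prob_space (\<D> i)) \<and>
     (\<forall>i x. integrable (\<D> i) (F i x)) \<and>
     (\<forall>i. \<forall>\<xi>\<in>space (\<D> i). \<forall>x. (\<lambda>y. F i y \<xi>) differentiable (at x))"

(* The nonnegative integral forces the p-th central moment to be finite. *)
definition oracle_condition ::
    "('n \<Rightarrow> 's measure) \<Rightarrow> ('n \<Rightarrow> real^'d \<Rightarrow> 's \<Rightarrow> real) \<Rightarrow> real \<Rightarrow> real \<Rightarrow> bool" where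
  "oracle_condition \<D> F p \<sigma> \<longleftrightarrow>
     (\<forall>i x. has_bochner_integral (\<D> i) (stoch_grad F i x) (grad (local_obj \<D> F i) x) \<and>
            (\<integral>\<^sup>+\<xi>. ennreal (norm (stoch_grad F i x \<xi> - grad (local_obj \<D> F i) x) powr p) \<partial>\<D> i)
              \<le> ennreal (\<sigma> powr p))"


section \<open>Algorithm DNSGD-PD\<close>

(* A sample path w assigns to (t, i, k) the k-th sample drawn by agent i at iteration t. *)
definition minibatch ::
    "('n \<Rightarrow> real^'d \<Rightarrow> 's \<Rightarrow> real) \<Rightarrow> nat \<Rightarrow> (nat \<times> 'n \<times> nat \<Rightarrow> 's) \<Rightarrow> nat \<Rightarrow>
     real^'d^'n \<Rightarrow> real^'d^'n" where
  "minibatch F b w t X = (\<chi> i. (1 / real b) *\<^sub>R (\<Sum>k<b. stoch_grad F i (X $ i) (w (t, i, k))))"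

definition pull_diag :: "real^'n^'n \<Rightarrow> nat \<Rightarrow> nat \<Rightarrow> real^'n^'n" where
  "pull_diag A K t = diag_part (mat_pow A ((t + 1) * K))"

(* sgn v is v / norm v, and 0 for v = 0. *)
definition normalize_rows :: "real^'d^'n \<Rightarrow> real^'d^'n" where
  "normalize_rows V = (\<chi> i. sgn (V $ i))"

primrec dnsgd_pd ::
    "real^'n^'n \<Rightarrow> ('n \<Rightarrow> real^'d \<Rightarrow> 's \<Rightarrow> real) \<Rightarrow> real^'d \<Rightarrow> real \<Rightarrow> nat \<Rightarrow> nat \<Rightarrow> nat \<Rightarrow>
     (nat \<times> 'n \<times> nat \<Rightarrow> 's) \<Rightarrow> nat \<Rightarrow> (real^'d^'n) \<times> (real^'d^'n)" where
  "dnsgd_pd A F x0 \<eta> Khat K b w 0 =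
     (let X = (\<chi> i. x0)
      in (X, mat_pow A Khat ** (matrix_inv (pull_diag A K 0) ** minibatch F b w 0 X)))"
| "dnsgd_pd A F x0 \<eta> Khat K b w (Suc t) =
     (let (X, V) = dnsgd_pd A F x0 \<eta> Khat K b w t;
          X' = mat_pow A K ** (X - \<eta> *\<^sub>R normalize_rows V)
      in (X', mat_pow A K ** (V + matrix_inv (pull_diag A K (Suc t)) ** minibatch F b w (Suc t) X'
                                - matrix_inv (pull_diag A K t) ** minibatch F b w t X)))"

definition sample_paths :: "('n \<Rightarrow> 's measure) \<Rightarrow> (nat \<times> 'n \<times> nat \<Rightarrow> 's) measure" where
  "sample_paths \<D> = (\<Pi>\<^sub>M (t, i, k) \<in> UNIV. \<D> i)"

(* Joint law of the samples and the independent uniform output index. *)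
definition dnsgd_pd_space ::
    "('n \<Rightarrow> 's measure) \<Rightarrow> nat \<Rightarrow> ((nat \<times> 'n \<times> nat \<Rightarrow> 's) \<times> nat) measure" where
  "dnsgd_pd_space \<D> T = sample_paths \<D> \<Otimes>\<^sub>M measure_pmf (pmf_of_set {..<T})"

definition dnsgd_pd_output ::
    "real^'n^'n \<Rightarrow> ('n \<Rightarrow> real^'d \<Rightarrow> 's \<Rightarrow> real) \<Rightarrow> real^'d \<Rightarrow> real \<Rightarrow> nat \<Rightarrow> nat \<Rightarrow> nat \<Rightarrow>
     'n \<Rightarrow> (nat \<times> 'n \<times> nat \<Rightarrow> 's) \<times> nat \<Rightarrow> real^'d" where
  "dnsgd_pd_output A F x0 \<eta> Khat K b i = (\<lambda>(w, t). fst (dnsgd_pd A F x0 \<eta> Khat K b w t) $ i)"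

(* Stochastic gradient evaluations of a run with n agents and T iterations: the initialization
   forms the minibatch of iteration 0, and iteration t forms that of iteration t + 1. *)
primrec sample_cost :: "nat \<Rightarrow> nat \<Rightarrow> nat \<Rightarrow> nat" where
  "sample_cost n b 0 = n * b"
| "sample_cost n b (Suc T) = sample_cost n b T + n * b"

(* Multiplications by A. The initialization uses Khat for V and K for the power defining the first
   diagonal matrix; each iteration uses K for X, K for V and K to advance that power. *)
primrec comm_cost :: "nat \<Rightarrow> nat \<Rightarrow> nat \<Rightarrow> nat" where
  "comm_cost Khat K 0 = Khat + K"
| "comm_cost Khat K (Suc T) = comm_cost Khat K T + K + K + K"


section \<open>Asymptotic notation\<close>

definition round_up_pos :: "real \<Rightarrow> nat" where
  "round_up_pos x = max 1 (nat \<lceil>x\<rceil>)"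

(* The dimensions n and d and the sample space are types here, so constants that are merely
   existentially quantified could depend on them. Confining all hidden constants to the fixed
   ranges below makes them universal. *)
definition hidden_bound :: real where
  "hidden_bound = 10 ^ 9"

definition universal_const :: "real \<Rightarrow> bool" where
  "universal_const c \<longleftrightarrow> 1 / hidden_bound \<le> c \<and> c \<le> hidden_bound"

(* Constants involving b depend on p; inverting the noise level
   sigma * (n * b) powr (-(p - 1) / p) raises constants to the power p / (p - 1). *)
definition hidden_bound_p :: "real \<Rightarrow> real" where
  "hidden_bound_p p = hidden_bound powr (p / (p - 1))"

definition universal_const_p :: "(real \<Rightarrow> real) \<Rightarrow> bool" where
  "universal_const_p c \<longleftrightarrow>
     (\<forall>p. 1 < p \<and> p \<le> 2 \<longrightarrow> 1 / hidden_bound_p p \<le> c p \<and> c p \<le> hidden_bound_p p)"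

(* The factor hidden by the tilde; the argument of ln exceeds exp 1, and g ranges over the
   initial local gradient norms. *)
definition log_factor ::
    "real \<Rightarrow> real \<Rightarrow> real \<Rightarrow> real \<Rightarrow> real \<Rightarrow> ('n::finite \<Rightarrow> real) \<Rightarrow> real" where
  "log_factor \<kappa> L \<Delta> \<sigma> \<epsilon> g =
     ln (3 + real CARD('n) + \<kappa> + L + \<Delta> + \<sigma> + 1 / \<epsilon> + (\<Sum>i\<in>UNIV. g i))"

end

theory Submission
  imports Defs
begin

text \<open>
  The descent argument runs along the Perron average \<open>xbar t = \<Sum>i \<pi> i * x t i\<close>. A row-stochastic mixing
  matrix preserves averages weighted by \<open>\<pi>\<close> only, so this average moves by exactly
  \<open>- \<eta> * \<Sum>i \<pi> i * sgn (v t i)\<close>, a step of length at most \<open>\<eta>\<close>. The \<open>\<pi>\<close>-average of the trackers is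
  \<open>\<Sum>i (\<pi> i / D i) * g i\<close>, where \<open>D\<close> is the diagonal of \<open>A\<^sup>(\<^sup>t\<^sup>+\<^sup>1\<^sup>)\<^sup>K\<close>. Since that diagonal is close to \<open>\<pi>\<close>,
  dividing by it removes the Perron weights, and the average is close to \<open>\<Sum>i g i\<close>, that is to \<open>n\<close> times the
  gradient of the global objective. Normalization makes the factor \<open>n\<close> irrelevant: if \<open>v / n\<close> is within
  \<open>\<delta>\<close> of \<open>\<nabla>f\<close>, then \<open>sgn v\<close> has inner product at least \<open>norm (\<nabla>f) - 2 * \<delta>\<close> with \<open>\<nabla>f\<close>
  (\<open>sgn_alignment\<close>). Smoothness turns this into
  \<open>\<eta> * norm (\<nabla>f (xbar t)) \<le> f (xbar t) - f (xbar (t + 1)) + 2 * \<eta> * \<delta> + L * \<eta>\<^sup>2\<close>, which telescopes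
  (\<open>descent_step\<close>, \<open>gradient_sum_bound\<close>). The error \<open>\<delta>\<close> enters linearly, so only first moments of
  the noise are ever needed.

  The error \<open>\<delta>\<close> has two sources. The first is imperfect mixing. The entries of \<open>A\<^sup>m\<close> approach the Perron vector
  like \<open>\<beta>\<^sup>m\<close> with \<open>\<beta> < 1\<close> (\<open>net_beta_less_1\<close>, \<open>mat_pow_entry_bound\<close>). Let \<open>S\<close> be the argument of
  the logarithm hidden in \<open>K\<close>; it dominates \<open>n\<close>, \<open>\<kappa>\<close>, \<open>L\<close>, \<open>\<Delta>\<close>, \<open>\<sigma>\<close>, \<open>1 / \<epsilon>\<close> and the initial
  gradients. With \<open>K \<ge> 30 * ln S / (1 - \<beta>)\<close> mixing is accurate to order \<open>S\<^sup>-\<^sup>2\<^sup>6\<close>. All quantities of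
  a run that mixing has to suppress are at most \<open>\<epsilon>\<close> times a power of \<open>S\<close> of lower degree: the iterates stay within
  \<open>\<eta> * T\<close> of the start, so no gradient grows by more than \<open>L * \<eta> * T\<close>. Hence consensus errors
  of the iterates and trackers and the bias of the diagonal correction can be estimated crudely, in terms of
  the total gradient and noise of the run (\<open>tracking_error\<close>, \<open>error_budget\<close>).

  The second source is the gradient noise averaged over all \<open>n * b\<close> fresh samples. The iterates at time \<open>t\<close> depend
  on earlier samples only, so by Fubini they may be held fixed while the fresh samples are integrated out
  (\<open>fresh_samples_fubini\<close>). What remains is a sum of \<open>N = n * b\<close> independent centred vectors with \<open>p\<close>-th moment
  at most \<open>\<sigma>\<^sup>p\<close>, whose expected norm is at most \<open>3 * \<sigma> * N\<^sup>1\<^sup>/\<^sup>p\<close>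
  (\<open>heavy_tailed_sum_first_moment\<close>). Divided by \<open>N\<close> this is a small multiple of \<open>\<epsilon>\<close> for the chosen batch size.
\<close>

section \<open>Gradients of smooth functions\<close>

lemma GDERIV_ex:
  fixes g :: "'a::euclidean_space \<Rightarrow> real"
  assumes "g differentiable (at x)"
  shows "\<exists>v. GDERIV g x :> v"
proof -
  obtain g' where g': "(g has_derivative g') (at x)"
    using assms by (auto simp: differentiable_def)
  interpret linear g' using g' by (rule has_derivative_linear)
  have "g' h = h \<bullet> (\<Sum>e\<in>Basis. g' e *\<^sub>R e)" for h
  proof -
    have "g' h = g' (\<Sum>e\<in>Basis. (h \<bullet> e) *\<^sub>R e)" by (simp add: euclidean_representation)
    also have "\<dots> = (\<Sum>e\<in>Basis. (h \<bullet> e) *\<^sub>R g' e)" by (simp only: sum scale)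
    also have "\<dots> = h \<bullet> (\<Sum>e\<in>Basis. g' e *\<^sub>R e)"
      unfolding inner_sum_right inner_scaleR_right by (rule sum.cong) simp_all
    finally show ?thesis .
  qed
  then have "g' = (\<lambda>h. h \<bullet> (\<Sum>e\<in>Basis. g' e *\<^sub>R e))" by (rule ext)
  with g' have "GDERIV g x :> (\<Sum>e\<in>Basis. g' e *\<^sub>R e)" unfolding gderiv_def by simp
  then show ?thesis ..
qed

lemma GDERIV_unique:
  fixes g :: "'a::euclidean_space \<Rightarrow> real"
  assumes "GDERIV g x :> v" "GDERIV g x :> w"
  shows "v = w"
proof -
  have *: "(\<lambda>h. h \<bullet> v) = (\<lambda>h. h \<bullet> w)"
    using assms unfolding gderiv_def by (rule has_derivative_unique)
  have "\<forall>h. h \<bullet> v = h \<bullet> w" by (rule allI) (rule fun_cong[OF *])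
  then show ?thesis unfolding vector_eq_ldot .
qed

lemma grad_eqI:
  fixes g :: "'a::euclidean_space \<Rightarrow> real"
  shows "GDERIV g x :> v \<Longrightarrow> grad g x = v"
  unfolding grad_def using GDERIV_unique by blast

lemma GDERIV_grad:
  fixes g :: "'a::euclidean_space \<Rightarrow> real"
  assumes "g differentiable (at x)"
  shows "GDERIV g x :> grad g x"
  using GDERIV_ex[OF assms] grad_eqI by metis

lemma GDERIV_line:
  fixes g :: "'a::euclidean_space \<Rightarrow> real"
  assumes "GDERIV g (x + s *\<^sub>R h) :> v"
  shows "((\<lambda>s. g (x + s *\<^sub>R h)) has_real_derivative h \<bullet> v) (at s)"
proof -
  have line: "((\<lambda>s. x + s *\<^sub>R h) has_derivative (\<lambda>t. t *\<^sub>R h)) (at s)"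
    by (auto intro!: derivative_eq_intros)
  have "((\<lambda>s. g (x + s *\<^sub>R h)) has_derivative (\<lambda>t. (t *\<^sub>R h) \<bullet> v)) (at s)"
    by (rule has_derivative_compose[OF line assms[unfolded gderiv_def]])
  moreover have "(\<lambda>t. (t *\<^sub>R h) \<bullet> v) = (*) (h \<bullet> v)" by (rule ext) simp
  ultimately show ?thesis by (simp only: has_field_derivative_def)
qed

lemma L_smoothD:
  assumes "L_smooth L g"
  shows "GDERIV g x :> grad g x" "norm (grad g x - grad g y) \<le> L * norm (x - y)"
  by (rule GDERIV_grad) (use assms in \<open>simp_all add: L_smooth_def\<close>)

text \<open>The mean value theorem replaces the usual integral along the segment. It yields the constant \<open>L\<close> where the
  integral gives \<open>L / 2\<close>; the loss only affects universal constants.\<close>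
lemma L_smooth_descent:
  assumes "L_smooth L g"
  shows "g y \<le> g x + (y - x) \<bullet> grad g x + L * (norm (y - x))\<^sup>2"
proof -
  let ?h = "y - x"
  have der: "((\<lambda>s. g (x + s *\<^sub>R ?h)) has_real_derivative ?h \<bullet> grad g (x + s *\<^sub>R ?h)) (at s)" for s
    by (rule GDERIV_line) (rule L_smoothD(1)[OF assms])
  obtain s where s: "0 < s" "s < 1"
    "g (x + 1 *\<^sub>R ?h) - g (x + 0 *\<^sub>R ?h) = (1 - 0) * (?h \<bullet> grad g (x + s *\<^sub>R ?h))"
    using MVT2[of 0 1 "\<lambda>s. g (x + s *\<^sub>R ?h)", OF _ der] by auto
  have L: "0 \<le> L * norm ?h"
    using order_trans[OF norm_ge_zero L_smoothD(2)[OF assms]] .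
  have "?h \<bullet> grad g (x + s *\<^sub>R ?h) - ?h \<bullet> grad g x = ?h \<bullet> (grad g (x + s *\<^sub>R ?h) - grad g x)"
    by (simp add: inner_diff_right)
  also have "\<dots> \<le> norm ?h * norm (grad g (x + s *\<^sub>R ?h) - grad g x)"
    by (rule norm_cauchy_schwarz)
  also have "\<dots> \<le> norm ?h * (L * norm (x + s *\<^sub>R ?h - x))"
    by (intro mult_left_mono L_smoothD(2)[OF assms]) auto
  also have "\<dots> = s * (norm ?h * (L * norm ?h))" using s by simp
  also have "\<dots> \<le> 1 * (norm ?h * (L * norm ?h))"
    using s L by (intro mult_right_mono) auto
  finally have "?h \<bullet> grad g (x + s *\<^sub>R ?h) - ?h \<bullet> grad g x \<le> L * (norm ?h)\<^sup>2"
    by (simp add: power2_eq_square mult_ac)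
  moreover have "g y - g x = ?h \<bullet> grad g (x + s *\<^sub>R ?h)" using s(3) by simp
  ultimately show ?thesis by linarith
qed

lemma grad_global_obj:
  fixes F :: "'n::finite \<Rightarrow> real^'d::finite \<Rightarrow> 's \<Rightarrow> real"
  assumes "\<And>i. L_smooth L (local_obj \<D> F i)"
  shows "grad (global_obj \<D> F) x = (1 / real CARD('n)) *\<^sub>R (\<Sum>i\<in>UNIV. grad (local_obj \<D> F i) x)"
    and "L_smooth L (global_obj \<D> F)"
proof -
  let ?n = "real CARD('n)"
  have "GDERIV (global_obj \<D> F) x :> (1 / ?n) *\<^sub>R (\<Sum>i\<in>UNIV. grad (local_obj \<D> F i) x)" for x
  proof -
    have "((\<lambda>x. (1 / ?n) * (\<Sum>i\<in>UNIV. local_obj \<D> F i x)) has_derivative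
       (\<lambda>h. (1 / ?n) * (\<Sum>i\<in>UNIV. h \<bullet> grad (local_obj \<D> F i) x))) (at x)"
      by (intro has_derivative_mult_right has_derivative_sum)
         (use L_smoothD(1)[OF assms] in \<open>auto simp: gderiv_def\<close>)
    then show ?thesis
      by (simp add: gderiv_def global_obj_def[abs_def] inner_sum_right)
  qed
  note D = this
  note G = grad_eqI[OF D]
  show "grad (global_obj \<D> F) x = (1 / ?n) *\<^sub>R (\<Sum>i\<in>UNIV. grad (local_obj \<D> F i) x)"
    by (rule G)
  show "L_smooth L (global_obj \<D> F)"
    unfolding L_smooth_def
  proof (intro conjI allI)
    show "global_obj \<D> F differentiable at x" for x
      using D unfolding gderiv_def differentiable_def by blast
    show "norm (grad (global_obj \<D> F) x - grad (global_obj \<D> F) y) \<le> L * norm (x - y)" for x y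
    proof -
      have "norm (\<Sum>i\<in>UNIV. grad (local_obj \<D> F i) x - grad (local_obj \<D> F i) y)
            \<le> (\<Sum>i\<in>(UNIV::'n set). L * norm (x - y))"
        by (intro order_trans[OF norm_sum] sum_mono L_smoothD(2)[OF assms])
      then have "(1 / ?n) * norm (\<Sum>i\<in>UNIV. grad (local_obj \<D> F i) x - grad (local_obj \<D> F i) y)
            \<le> L * norm (x - y)"
        by (simp add: field_simps)
      then show ?thesis
        by (simp add: G sum_subtractf flip: scaleR_diff_right)
    qed
  qed
qed

text \<open>Normalization needs no lower bound on \<open>v\<close>: the component of \<open>v\<close> along \<open>sgn v\<close> is \<open>norm v\<close>, and replacing
  \<open>v\<close> by \<open>g\<close> costs \<open>norm (v - g)\<close> twice, once in the inner product and once in the norm. The bound includes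
  \<open>v = 0\<close>, where \<open>sgn v = 0\<close>.\<close>
lemma sgn_alignment:
  fixes g v :: "'a::real_inner"
  shows "sgn v \<bullet> g \<ge> norm g - 2 * norm (v - g)"
proof -
  have 1: "sgn v \<bullet> v = norm v"
    by (cases "v = 0") (simp_all add: sgn_div_norm dot_square_norm power2_eq_square)
  have "sgn v \<bullet> (v - g) \<le> norm (sgn v) * norm (v - g)" by (rule norm_cauchy_schwarz)
  also have "\<dots> \<le> 1 * norm (v - g)" by (intro mult_right_mono) (auto simp: norm_sgn)
  finally have "sgn v \<bullet> g \<ge> norm v - norm (v - g)" using 1 by (simp add: inner_diff_right)
  moreover have "norm g \<le> norm v + norm (v - g)"
    using norm_triangle_sub[of g v] by (simp add: norm_minus_commute)
  ultimately show ?thesis by simp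
qed

section \<open>Mixing rate of the network\<close>

text \<open>The squared norm on column vectors whose operator norm is \<open>pi_norm\<close>.\<close>
definition wnorm2 :: "real^'n \<Rightarrow> real^'n \<Rightarrow> real" where
  "wnorm2 \<pi> y = (\<Sum>i\<in>UNIV. \<pi> $ i * (y $ i)\<^sup>2)"

abbreviation avg :: "real^'n \<Rightarrow> real^'n \<Rightarrow> real" where
  "avg \<pi> y \<equiv> (\<Sum>j\<in>UNIV. \<pi> $ j * y $ j)"

text \<open>The rank-one limit \<open>1 \<pi>\<^sup>T\<close> of the powers of the mixing matrix.\<close>
definition consensus_mat :: "real^'n \<Rightarrow> real^'n^'n" where
  "consensus_mat \<pi> = (\<chi> i j. \<pi> $ j)"

lemma consensus_mat_mult: "(consensus_mat \<pi> *v v) $ i = avg \<pi> v"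
  by (simp add: consensus_mat_def matrix_vector_mult_def)

lemma net_beta_eq_onorm:
  "net_beta A \<pi> = onorm (\<lambda>v. (diag_mat (\<chi> i. sqrt (\<pi> $ i)) ** (A - consensus_mat \<pi>) **
     diag_mat (\<chi> i. 1 / sqrt (\<pi> $ i))) *v v)"
  unfolding net_beta_def pi_norm_def spectral_norm_def consensus_mat_def ..

context
  fixes E :: "('n::finite \<times> 'n) set" and A :: "real^'n^'n" and \<pi> :: "real^'n"
  assumes sc: "strongly_connected_graph E" and mm: "mixing_matrix E A" and pv: "perron_vector A \<pi>"
begin

lemma perron_pos: "0 < \<pi> $ i"
  and perron_sum: "(\<Sum>i\<in>UNIV. \<pi> $ i) = 1"
  and perron_left: "(\<Sum>i\<in>UNIV. \<pi> $ i * A $ i $ j) = \<pi> $ j"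
proof -
  show "0 < \<pi> $ i" "(\<Sum>i\<in>UNIV. \<pi> $ i) = 1" using pv by (auto simp: perron_vector_def)
  have "\<pi> v* A = \<pi>" using pv by (auto simp: perron_vector_def)
  then have "(\<pi> v* A) $ j = \<pi> $ j" by simp
  then show "(\<Sum>i\<in>UNIV. \<pi> $ i * A $ i $ j) = \<pi> $ j"
    by (simp add: vector_matrix_mult_def mult.commute)
qed

lemma mixing_nonneg: "0 \<le> A $ i $ j"
  and mixing_pos: "(i, j) \<in> E \<or> i = j \<Longrightarrow> 0 < A $ i $ j"
  and mixing_row_sum: "(\<Sum>j\<in>UNIV. A $ i $ j) = 1"
proof -
  have "if (i, j) \<in> E \<or> i = j then 0 < A $ i $ j \<and> A $ i $ j \<le> 1 else A $ i $ j = 0"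
    using mm unfolding mixing_matrix_def by blast
  then show "0 \<le> A $ i $ j" "(i, j) \<in> E \<or> i = j \<Longrightarrow> 0 < A $ i $ j" 
    by (auto split: if_splits)
  have "(A *v 1) $ i = 1" using mm by (simp add: mixing_matrix_def)
  then show "(\<Sum>j\<in>UNIV. A $ i $ j) = 1" by (simp add: matrix_vector_mult_def)
qed

text \<open>A variance decomposition: \<open>A\<close> replaces \<open>y\<close> by its averages over the rows, and since \<open>\<pi>\<close> is stationary the
  \<open>\<pi>\<close>-weighted second moment drops exactly by the expected variance within a row. The drop measures how far \<open>y\<close>
  is from being constant along the edges, which makes contraction strict on a connected graph.\<close>
lemma perron_deviation_identity:
  "wnorm2 \<pi> ((A - consensus_mat \<pi>) *v y) = wnorm2 \<pi> y - (avg \<pi> y)\<^sup>2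
     - (\<Sum>i\<in>UNIV. \<Sum>j\<in>UNIV. \<pi> $ i * (A $ i $ j * (y $ j - (A *v y) $ i)\<^sup>2))"
proof -
  define m where "m i = (A *v y) $ i" for i
  have m: "m i = (\<Sum>j\<in>UNIV. A $ i $ j * y $ j)" for i
    by (simp add: m_def matrix_vector_mult_def)
  have var: "(\<Sum>j\<in>UNIV. A $ i $ j * (y $ j - m i)\<^sup>2) = (\<Sum>j\<in>UNIV. A $ i $ j * (y $ j)\<^sup>2) - (m i)\<^sup>2" for i
  proof -
    have "(\<Sum>j\<in>UNIV. A $ i $ j * (y $ j - m i)\<^sup>2)
       = (\<Sum>j\<in>UNIV. A $ i $ j * (y $ j)\<^sup>2 - 2 * m i * (A $ i $ j * y $ j) + (m i)\<^sup>2 * A $ i $ j)"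
      by (intro sum.cong) (auto simp: power2_eq_square algebra_simps)
    also have "\<dots> = (\<Sum>j\<in>UNIV. A $ i $ j * (y $ j)\<^sup>2) - 2 * m i * m i + (m i)\<^sup>2 * 1"
      unfolding m mixing_row_sum[of i, symmetric]
      by (simp add: sum.distrib sum_subtractf sum_distrib_left)
    finally show ?thesis by (simp add: power2_eq_square)
  qed
  have stat: "(\<Sum>i\<in>UNIV. \<pi> $ i * (\<Sum>j\<in>UNIV. A $ i $ j * g j)) = (\<Sum>j\<in>UNIV. \<pi> $ j * g j)" for g :: "'n \<Rightarrow> real"
  proof -
    have "(\<Sum>i\<in>UNIV. \<pi> $ i * (\<Sum>j\<in>UNIV. A $ i $ j * g j)) = (\<Sum>j\<in>UNIV. (\<Sum>i\<in>UNIV. \<pi> $ i * A $ i $ j) * g j)"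
      unfolding sum_distrib_left sum_distrib_right by (subst sum.swap) (simp add: mult.assoc)
    then show ?thesis by (simp add: perron_left)
  qed
  have "(\<Sum>i\<in>UNIV. \<Sum>j\<in>UNIV. \<pi> $ i * (A $ i $ j * (y $ j - m i)\<^sup>2)) = wnorm2 \<pi> y - (\<Sum>i\<in>UNIV. \<pi> $ i * (m i)\<^sup>2)"
    by (simp add: var stat right_diff_distrib sum_subtractf wnorm2_def flip: sum_distrib_left)
  moreover have "wnorm2 \<pi> ((A - consensus_mat \<pi>) *v y) = (\<Sum>i\<in>UNIV. \<pi> $ i * (m i)\<^sup>2) - (avg \<pi> y)\<^sup>2"
  proof -
    have "((A - consensus_mat \<pi>) *v y) $ i = m i - avg \<pi> y" for i
      by (simp add: m_def matrix_vector_mult_diff_rdistrib consensus_mat_mult)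
    then have "wnorm2 \<pi> ((A - consensus_mat \<pi>) *v y)
      = (\<Sum>i\<in>UNIV. \<pi> $ i * (m i)\<^sup>2 - 2 * avg \<pi> y * (\<pi> $ i * m i) + (avg \<pi> y)\<^sup>2 * \<pi> $ i)"
      unfolding wnorm2_def by (simp only:) (simp add: power2_eq_square algebra_simps)
    also have "\<dots> = (\<Sum>i\<in>UNIV. \<pi> $ i * (m i)\<^sup>2) - 2 * avg \<pi> y * (\<Sum>i\<in>UNIV. \<pi> $ i * m i) + (avg \<pi> y)\<^sup>2 * (\<Sum>i\<in>UNIV. \<pi> $ i)"
      by (simp add: sum.distrib sum_subtractf sum_distrib_left)
    also have "(\<Sum>i\<in>UNIV. \<pi> $ i * m i) = avg \<pi> y" unfolding m by (rule stat)
    finally show ?thesis unfolding perron_sum by (simp add: power2_eq_square)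
  qed
  ultimately show ?thesis unfolding m_def by simp
qed

lemma scaled_deviation_norm:
  defines "M \<equiv> diag_mat (\<chi> i. sqrt (\<pi> $ i)) ** (A - consensus_mat \<pi>) ** diag_mat (\<chi> i. 1 / sqrt (\<pi> $ i))"
  shows "(norm (M *v x))\<^sup>2 = wnorm2 \<pi> ((A - consensus_mat \<pi>) *v (\<chi> i. x $ i / sqrt (\<pi> $ i)))"
proof -
  have d: "(diag_mat v *v z) $ i = v $ i * z $ i" for v z :: "real^'n" and i
    by (simp add: diag_mat_def matrix_vector_mult_def if_distrib[of "\<lambda>x. x * _"] cong: if_cong)
  have "diag_mat (\<chi> i. 1 / sqrt (\<pi> $ i)) *v x = (\<chi> i. x $ i / sqrt (\<pi> $ i))"
    by (simp add: vec_eq_iff d)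
  then have "M *v x = diag_mat (\<chi> i. sqrt (\<pi> $ i)) *v ((A - consensus_mat \<pi>) *v (\<chi> i. x $ i / sqrt (\<pi> $ i)))"
    unfolding M_def by (simp flip: matrix_vector_mul_assoc)
  then show ?thesis
    using perron_pos
    by (simp add: norm_vec_def L2_set_def wnorm2_def d power_mult_distrib less_imp_le sum_nonneg)
qed

lemma net_beta_nonneg: "0 \<le> net_beta A \<pi>"
  unfolding net_beta_eq_onorm
  by (rule onorm_pos_le[OF matrix_vector_mul_bounded_linear])

text \<open>The operator norm is attained on the compact unit sphere, so it suffices that no unit vector keeps its length.
  By \<open>perron_deviation_identity\<close> such a vector would have \<open>\<pi>\<close>-mean 0 and no variance within any row.
  As every agent has a positive self-weight, the latter forces equal values along each edge, hence everywhere by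
  strong connectivity, and a constant vector of mean 0 vanishes.\<close>
lemma net_beta_less_1: "net_beta A \<pi> < 1"
proof -
  let ?J = "consensus_mat \<pi>"
  define M where "M = diag_mat (\<chi> i. sqrt (\<pi> $ i)) ** (A - ?J) ** diag_mat (\<chi> i. 1 / sqrt (\<pi> $ i))"
  have strict: "norm (M *v x) < 1" if x: "norm x = 1" for x
  proof (rule ccontr)
    assume "\<not> norm (M *v x) < 1"
    then have ge: "1 \<le> (norm (M *v x))\<^sup>2" by simp
    define y :: "real^'n" where "y = (\<chi> i. x $ i / sqrt (\<pi> $ i))"
    have "wnorm2 \<pi> y = (norm x)\<^sup>2"
      using perron_pos by (simp add: wnorm2_def y_def power_divide less_imp_le norm_vec_def L2_set_def sum_nonneg
         less_imp_neq[symmetric])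
    then have "wnorm2 \<pi> y = 1" using x by simp
    define Q where "Q i j = \<pi> $ i * (A $ i $ j * (y $ j - (A *v y) $ i)\<^sup>2)" for i j
    have Q0: "0 \<le> Q i j" for i j
      unfolding Q_def using perron_pos mixing_nonneg by (simp add: less_imp_le)
    \<comment> \<open>\<open>Q\<close> collects the variances within rows; nothing is left for them if the length is kept.\<close>
    have "1 \<le> 1 - (avg \<pi> y)\<^sup>2 - (\<Sum>i\<in>UNIV. \<Sum>j\<in>UNIV. Q i j)"
      using ge[unfolded M_def scaled_deviation_norm, folded y_def] perron_deviation_identity[of y] \<open>wnorm2 \<pi> y = 1\<close>
      by (simp add: Q_def)
    moreover have "0 \<le> (\<Sum>i\<in>UNIV. \<Sum>j\<in>UNIV. Q i j)" by (intro sum_nonneg Q0)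
    ultimately have a0: "(avg \<pi> y)\<^sup>2 = 0" and s0: "(\<Sum>i\<in>UNIV. \<Sum>j\<in>UNIV. Q i j) = 0"
      using zero_le_power2[of "avg \<pi> y"] by linarith+
    from s0 have "Q i j = 0" for i j
      by (simp add: sum_nonneg_eq_0_iff Q0 sum_nonneg)
    then have eq: "y $ j = (A *v y) $ i" if "(i, j) \<in> E \<or> i = j" for i j
      using mixing_pos[OF that] perron_pos[of i] unfolding Q_def by (metis less_irrefl mult_eq_0_iff power_eq_0_iff right_minus_eq)
    have edge: "y $ j = y $ i" if "(i, j) \<in> E" for i j using eq[of i j] eq[of i i] that by simp
    have const: "y $ j = y $ i" for i j
    proof -
      have "(i, j) \<in> E\<^sup>*" using sc by (simp add: strongly_connected_graph_def)
      then show ?thesis by induction (auto dest: edge)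
    qed
    have "y $ i = 0" for i
    proof -
      have "avg \<pi> y = (\<Sum>j\<in>UNIV. \<pi> $ j) * y $ i"
        unfolding sum_distrib_right by (intro sum.cong refl arg_cong2[where f="(*)"] const)
      then have "avg \<pi> y = y $ i" by (simp only: perron_sum mult_1)
      with a0 show ?thesis by (simp only: power_eq_0_iff)
    qed
    then have "wnorm2 \<pi> y = 0" by (simp add: wnorm2_def)
    with \<open>wnorm2 \<pi> y = 1\<close> show False by simp
  qed
  have "compact (sphere 0 1 :: (real^'n) set)" by simp
  moreover have "(axis undefined 1 :: real^'n) \<in> sphere 0 1" by simp
  moreover have "continuous_on (sphere 0 1) (\<lambda>x. norm (M *v x))"
    by (intro continuous_intros linear_continuous_on matrix_vector_mul_bounded_linear)
  ultimately obtain x0 :: "real^'n" where x0: "x0 \<in> sphere 0 1" "\<And>x. x \<in> sphere 0 1 \<Longrightarrow> norm (M *v x) \<le> norm (M *v x0)"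
    using continuous_attains_sup[of "sphere 0 1 :: (real^'n) set" "\<lambda>x. norm (M *v x)"] by blast
  have "onorm (\<lambda>v. M *v v) \<le> norm (M *v x0)"
  proof (rule onorm_bound)
    fix x :: "real^'n"
    show "norm (M *v x) \<le> norm (M *v x0) * norm x"
    proof (cases "x = 0")
      case False
      have "norm (M *v (inverse (norm x) *\<^sub>R x)) \<le> norm (M *v x0)"
        using False by (intro x0) simp
      then show ?thesis using False by (simp add: matrix_vector_mult_scaleR field_simps)
    qed simp
  qed simp
  also have "\<dots> < 1" using strict[of x0] x0(1) by simp
  finally show ?thesis unfolding net_beta_eq_onorm M_def .
qed

lemma deviation_contracts:
  "wnorm2 \<pi> ((A - consensus_mat \<pi>) *v y) \<le> (net_beta A \<pi>)\<^sup>2 * wnorm2 \<pi> y"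
proof -
  let ?J = "consensus_mat \<pi>"
  define M where "M = diag_mat (\<chi> i. sqrt (\<pi> $ i)) ** (A - ?J) ** diag_mat (\<chi> i. 1 / sqrt (\<pi> $ i))"
  define x :: "real^'n" where "x = (\<chi> i. sqrt (\<pi> $ i) * y $ i)"
  have y: "(\<chi> i. x $ i / sqrt (\<pi> $ i)) = y"
    using perron_pos by (simp add: vec_eq_iff x_def) (metis less_irrefl)
  have nx: "(norm x)\<^sup>2 = wnorm2 \<pi> y"
    using perron_pos by (simp add: norm_vec_def L2_set_def wnorm2_def x_def power_mult_distrib less_imp_le sum_nonneg)
  have "norm (M *v x) \<le> net_beta A \<pi> * norm x"
    unfolding net_beta_eq_onorm M_def
    by (rule onorm[OF matrix_vector_mul_bounded_linear])
  then have "(norm (M *v x))\<^sup>2 \<le> (net_beta A \<pi> * norm x)\<^sup>2"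
    by (rule power_mono) simp
  then show ?thesis
    unfolding M_def scaled_deviation_norm y power_mult_distrib nx .
qed

text \<open>Column \<open>j\<close> of \<open>A\<^sup>m - 1 \<pi>\<^sup>T\<close> is the \<open>m\<close>-fold image of the unit vector \<open>e\<close> under \<open>A - 1 \<pi>\<^sup>T\<close>, because \<open>A\<close> fixes
  \<open>1 \<pi>\<^sup>T\<close> from both sides. Its weighted norm is therefore at most \<open>\<beta>\<^sup>m\<close> times that of \<open>e\<close>, and the square root is the
  price of reading a single entry off the weighted norm.\<close>
lemma mat_pow_entry_bound:
  assumes "1 \<le> m"
  shows "\<bar>mat_pow A m $ i $ j - \<pi> $ j\<bar> \<le> sqrt (\<pi> $ j / \<pi> $ i) * net_beta A \<pi> ^ m"
proof -
  let ?J = "consensus_mat \<pi>" and ?\<beta> = "net_beta A \<pi>"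
  define e :: "real^'n" where "e = axis j 1"
  define z where "z m = mat_pow A m *v e - ?J *v e" for m
  have Je: "(?J *v v) $ i = avg \<pi> v" for v i
    by (rule consensus_mat_mult)
  have avg_step: "avg \<pi> (A *v v) = avg \<pi> v" for v
  proof -
    have "avg \<pi> (A *v v) = (\<Sum>j\<in>UNIV. (\<Sum>i\<in>UNIV. \<pi> $ i * A $ i $ j) * v $ j)"
      unfolding sum_distrib_left sum_distrib_right matrix_vector_mult_def
      by (subst sum.swap) (simp add: mult.assoc sum_distrib_left)
    then show ?thesis by (simp add: perron_left)
  qed
  have avg_pow: "avg \<pi> (mat_pow A m *v v) = avg \<pi> v" for v m
    by (induction m) (simp_all add: avg_step flip: matrix_vector_mul_assoc)
  have AJ: "A *v (?J *v v) = ?J *v v" for v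
  proof -
    have "(A *v (?J *v v)) $ i = (\<Sum>k\<in>UNIV. A $ i $ k) * avg \<pi> v" for i
      unfolding sum_distrib_right
      by (simp add: matrix_vector_mult_def[of A] Je)
    then show ?thesis by (simp add: vec_eq_iff Je mixing_row_sum)
  qed
  have JJ: "?J *v (?J *v v) = ?J *v v" for v
  proof -
    have "(\<Sum>k\<in>UNIV. \<pi> $ k * avg \<pi> v) = (\<Sum>k\<in>UNIV. \<pi> $ k) * avg \<pi> v" by (simp add: sum_distrib_right)
    then show ?thesis by (simp add: vec_eq_iff Je perron_sum)
  qed
  have Jpow: "?J *v (mat_pow A m *v v) = ?J *v v" for v m
    by (simp add: vec_eq_iff Je avg_pow)
  have step: "z (Suc m) = (A - ?J) *v z m" for m
    by (simp add: z_def matrix_vector_mult_diff_distrib matrix_vector_mult_diff_rdistrib AJ JJ Jpow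
        flip: matrix_vector_mul_assoc)
  have z1: "z (Suc 0) = (A - ?J) *v e"
    by (simp add: z_def matrix_vector_mult_diff_rdistrib)
  have "wnorm2 \<pi> (z (Suc m)) \<le> (?\<beta>^Suc m)\<^sup>2 * wnorm2 \<pi> e" for m
  proof (induction m)
    case 0
    show ?case using deviation_contracts[of e] by (simp add: z1)
  next
    case (Suc m)
    have "wnorm2 \<pi> (z (Suc (Suc m))) \<le> ?\<beta>\<^sup>2 * wnorm2 \<pi> (z (Suc m))"
      unfolding step[of "Suc m"] by (rule deviation_contracts)
    also have "\<dots> \<le> ?\<beta>\<^sup>2 * ((?\<beta>^Suc m)\<^sup>2 * wnorm2 \<pi> e)"
      by (intro mult_left_mono Suc) simp
    finally show ?case by (simp add: power_mult_distrib mult_ac)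
  qed
  from this[of "m - 1"] assms have "wnorm2 \<pi> (z m) \<le> (?\<beta>^m)\<^sup>2 * wnorm2 \<pi> e" by simp
  also have "wnorm2 \<pi> e = \<pi> $ j"
    by (simp add: wnorm2_def e_def axis_def if_distrib[of "\<lambda>x. x\<^sup>2"] if_distrib[of "\<lambda>x. _ * x"] cong: if_cong)
  finally have 1: "wnorm2 \<pi> (z m) \<le> (?\<beta>^m)\<^sup>2 * \<pi> $ j" .
  have "\<pi> $ i * (z m $ i)\<^sup>2 \<le> wnorm2 \<pi> (z m)"
    unfolding wnorm2_def using perron_pos
    by (intro member_le_sum) (auto simp: less_imp_le)
  with 1 have "\<pi> $ i * (z m $ i)\<^sup>2 \<le> (?\<beta>^m)\<^sup>2 * \<pi> $ j" by simp
  then have "(z m $ i)\<^sup>2 \<le> (\<pi> $ j / \<pi> $ i) * (?\<beta>^m)\<^sup>2"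
    using perron_pos[of i] by (simp add: field_simps)
  then have "sqrt ((z m $ i)\<^sup>2) \<le> sqrt ((\<pi> $ j / \<pi> $ i) * (?\<beta>^m)\<^sup>2)" by (rule real_sqrt_le_mono)
  then have "\<bar>z m $ i\<bar> \<le> sqrt (\<pi> $ j / \<pi> $ i) * ?\<beta>^m"
    unfolding real_sqrt_abs real_sqrt_mult using net_beta_nonneg by simp
  moreover have "z m $ i = mat_pow A m $ i $ j - \<pi> $ j"
    by (simp add: z_def consensus_mat_def e_def matrix_vector_mult_def axis_def if_distrib[of "\<lambda>x. _ * x"] cong: if_cong)
  ultimately show ?thesis by simp
qed

lemma mat_pow_avg: "(\<Sum>i\<in>UNIV. \<pi> $ i * mat_pow A m $ i $ j) = \<pi> $ j"
proof (induction m arbitrary: j)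
  case 0
  show ?case by (simp add: mat_def if_distrib[of "\<lambda>x. _ * x"] cong: if_cong)
next
  case (Suc m)
  have "(\<Sum>i\<in>UNIV. \<pi> $ i * mat_pow A (Suc m) $ i $ j)
      = (\<Sum>k\<in>UNIV. (\<Sum>i\<in>UNIV. \<pi> $ i * A $ i $ k) * mat_pow A m $ k $ j)"
    unfolding sum_distrib_right mat_pow.simps matrix_matrix_mult_def vec_lambda_beta sum_distrib_left
    by (subst sum.swap) (simp add: mult.assoc)
  then show ?case by (simp add: perron_left Suc)
qed

lemma mat_pow_row_sum: "(\<Sum>j\<in>UNIV. mat_pow A m $ i $ j) = 1"
proof (induction m arbitrary: i)
  case 0
  show ?case by (simp add: mat_def)
next
  case (Suc m)
  have "(\<Sum>j\<in>UNIV. mat_pow A (Suc m) $ i $ j)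
      = (\<Sum>k\<in>UNIV. A $ i $ k * (\<Sum>j\<in>UNIV. mat_pow A m $ k $ j))"
    unfolding mat_pow.simps matrix_matrix_mult_def vec_lambda_beta sum_distrib_left
    by (rule sum.swap)
  then show ?case by (simp add: Suc mixing_row_sum)
qed

text \<open>The largest Perron weight is at least \<open>1 / n\<close>, so \<open>\<kappa>\<close> controls the smallest one. This keeps the logarithm of
  \<open>1 / min \<pi>\<close> within the hidden logarithmic factor.\<close>
lemma perron_lower: "1 / \<pi> $ i \<le> real CARD('n) * net_kappa \<pi>"
  and perron_ratio: "\<pi> $ j / \<pi> $ i \<le> net_kappa \<pi>"
  and net_kappa_ge_1: "1 \<le> net_kappa \<pi>"
proof -
  let ?mx = "Max (range (\<lambda>i. \<pi> $ i))" and ?mn = "Min (range (\<lambda>i. \<pi> $ i))"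
  have mx: "\<pi> $ k \<le> ?mx" for k by (rule Max_ge) auto
  have mn: "?mn \<le> \<pi> $ k" for k by (rule Min_le) auto
  have mn0: "0 < ?mn" using perron_pos by (subst Min_gr_iff) auto
  have ratio: "\<pi> $ j / \<pi> $ i \<le> net_kappa \<pi>" for i j
    unfolding net_kappa_def 
    by (rule frac_le) (use mx mn mn0 perron_pos[of j] order_trans[OF _ mx[of j]] in \<open>auto simp: less_imp_le\<close>)
  then show "\<pi> $ j / \<pi> $ i \<le> net_kappa \<pi>" .
  show "1 \<le> net_kappa \<pi>" using ratio[of i i] perron_pos[of i] by simp
  have "1 / \<pi> $ i = (\<Sum>k\<in>UNIV. \<pi> $ k / \<pi> $ i)" by (simp add: perron_sum flip: sum_divide_distrib)
  also have "\<dots> \<le> (\<Sum>k\<in>(UNIV::'n set). net_kappa \<pi>)" by (intro sum_mono ratio)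
  finally show "1 / \<pi> $ i \<le> real CARD('n) * net_kappa \<pi>" by simp
qed

end

section \<open>Sums of independent heavy-tailed vectors\<close>

text \<open>A \<open>p\<close>-th moment controls the second moment below a truncation level and the first moment above it.\<close>
lemma truncation_bounds:
  fixes x \<tau> p :: real
  assumes "0 \<le> x" "0 < \<tau>" "1 < p" "p \<le> 2"
  shows "x \<le> \<tau> \<Longrightarrow> x\<^sup>2 \<le> \<tau> powr (2 - p) * x powr p"
    and "\<tau> < x \<Longrightarrow> x \<le> \<tau> powr (1 - p) * x powr p"
proof -
  assume "x \<le> \<tau>"
  show "x\<^sup>2 \<le> \<tau> powr (2 - p) * x powr p"
  proof (cases "x = 0")
    case False
    then have "x\<^sup>2 = x powr (2 - p) * x powr p"
      using assms by (simp add: powr_realpow flip: powr_add)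
    also have "\<dots> \<le> \<tau> powr (2 - p) * x powr p"
      using assms \<open>x \<le> \<tau>\<close> by (intro mult_right_mono powr_mono2) auto
    finally show ?thesis .
  qed (use assms in simp)
next
  assume "\<tau> < x"
  have "x = x powr (1 - p) * x powr p"
    using assms \<open>\<tau> < x\<close> by (simp flip: powr_add)
  also have "\<dots> \<le> \<tau> powr (1 - p) * x powr p"
    using assms \<open>\<tau> < x\<close> by (intro mult_right_mono powr_mono2') auto
  finally show "x \<le> \<tau> powr (1 - p) * x powr p" .
qed

lemma (in prob_space) first_moment_le:
  fixes Y :: "'a \<Rightarrow> 'b::euclidean_space"
  assumes [measurable]: "Y \<in> borel_measurable M" and p: "1 < p" "p \<le> 2" and "0 < \<sigma>"
    and mom: "(\<integral>\<^sup>+\<omega>. ennreal (norm (Y \<omega>) powr p) \<partial>M) \<le> ennreal (\<sigma> powr p)"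
  shows "(\<integral>\<^sup>+\<omega>. ennreal (norm (Y \<omega>)) \<partial>M) \<le> ennreal (2 * \<sigma>)"
proof -
  have "norm (Y \<omega>) \<le> \<sigma> + \<sigma> powr (1 - p) * norm (Y \<omega>) powr p" for \<omega>
    using truncation_bounds(2)[of "norm (Y \<omega>)" \<sigma> p] p \<open>0 < \<sigma>\<close>
    by (cases "norm (Y \<omega>) \<le> \<sigma>") (auto intro: order_trans)
  then have "(\<integral>\<^sup>+\<omega>. ennreal (norm (Y \<omega>)) \<partial>M)
      \<le> (\<integral>\<^sup>+\<omega>. ennreal \<sigma> + ennreal (\<sigma> powr (1 - p)) * ennreal (norm (Y \<omega>) powr p) \<partial>M)"
    using \<open>0 < \<sigma>\<close> by (intro nn_integral_mono) (simp add: ennreal_leI flip: ennreal_mult' ennreal_plus)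
  also have "\<dots> = ennreal \<sigma> + ennreal (\<sigma> powr (1 - p)) * (\<integral>\<^sup>+\<omega>. ennreal (norm (Y \<omega>) powr p) \<partial>M)"
    by (simp add: nn_integral_add nn_integral_cmult emeasure_space_1)
  also have "\<dots> \<le> ennreal \<sigma> + ennreal (\<sigma> powr (1 - p)) * ennreal (\<sigma> powr p)"
    by (intro add_left_mono mult_left_mono mom) simp
  also have "\<dots> = ennreal (\<sigma> + \<sigma> powr (1 - p) * \<sigma> powr p)"
    using \<open>0 < \<sigma>\<close> by (simp flip: ennreal_mult' ennreal_plus)
  also have "\<sigma> powr (1 - p) * \<sigma> powr p = \<sigma>"
    using \<open>0 < \<sigma>\<close> by (simp flip: powr_add)
  finally show ?thesis by simp
qed

lemma (in prob_space) indep_inner_expectation_0: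
  fixes X Y :: "'a \<Rightarrow> 'b::euclidean_space"
  assumes ind: "indep_var borel X borel Y"
    and X: "integrable M X" "expectation X = 0" and Y: "integrable M Y"
  shows "integrable M (\<lambda>\<omega>. X \<omega> \<bullet> Y \<omega>)" "expectation (\<lambda>\<omega>. X \<omega> \<bullet> Y \<omega>) = 0"
proof -
  have i: "indep_var borel (\<lambda>\<omega>. X \<omega> \<bullet> e) borel (\<lambda>\<omega>. Y \<omega> \<bullet> e)" for e
    using indep_var_compose[OF ind, of "\<lambda>x. x \<bullet> e" borel "\<lambda>x. x \<bullet> e" borel] by (simp add: comp_def)
  have iX: "integrable M (\<lambda>\<omega>. X \<omega> \<bullet> e)" and iY: "integrable M (\<lambda>\<omega>. Y \<omega> \<bullet> e)" for e
    using X Y by auto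
  have int: "integrable M (\<lambda>\<omega>. (X \<omega> \<bullet> e) * (Y \<omega> \<bullet> e))" for e
    by (rule indep_var_integrable[OF i iX iY])
  have eq: "(\<lambda>\<omega>. X \<omega> \<bullet> Y \<omega>) = (\<lambda>\<omega>. \<Sum>e\<in>Basis. (X \<omega> \<bullet> e) * (Y \<omega> \<bullet> e))"
    by (rule ext) (rule euclidean_inner)
  show "integrable M (\<lambda>\<omega>. X \<omega> \<bullet> Y \<omega>)" unfolding eq by (intro Bochner_Integration.integrable_sum int)
  have "expectation (\<lambda>\<omega>. X \<omega> \<bullet> e) = 0" for e
    using X by simp
  then show "expectation (\<lambda>\<omega>. X \<omega> \<bullet> Y \<omega>) = 0"
    unfolding eq by (subst Bochner_Integration.integral_sum)
      (simp_all add: int indep_var_lebesgue_integral[OF i iX iY])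
qed

text \<open>The mixed terms vanish by independence and centring does not increase the second moment.\<close>
lemma (in prob_space) indep_sum_second_moment:
  fixes Z :: "'i \<Rightarrow> 'a \<Rightarrow> 'b::euclidean_space"
  assumes "finite I" and ind: "indep_vars (\<lambda>_. borel) Z I"
    and int: "\<And>i. i \<in> I \<Longrightarrow> integrable M (Z i)" and int2: "\<And>i. i \<in> I \<Longrightarrow> integrable M (\<lambda>\<omega>. (norm (Z i \<omega>))\<^sup>2)"
  defines "C \<equiv> (\<lambda>\<omega>. \<Sum>i\<in>I. Z i \<omega> - expectation (Z i))"
  shows "integrable M (\<lambda>\<omega>. (norm (C \<omega>))\<^sup>2)"
    and "expectation (\<lambda>\<omega>. (norm (C \<omega>))\<^sup>2) \<le> (\<Sum>i\<in>I. expectation (\<lambda>\<omega>. (norm (Z i \<omega>))\<^sup>2))"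
proof -
  define W where "W i \<omega> = Z i \<omega> - expectation (Z i)" for i \<omega>
  have iW: "integrable M (W i)" "expectation (W i) = 0" if "i \<in> I" for i
    using int[OF that] by (auto simp: W_def[abs_def] prob_space)
  have sq: "(norm (W i \<omega>))\<^sup>2 = (norm (Z i \<omega>))\<^sup>2 - 2 * (Z i \<omega> \<bullet> expectation (Z i)) + (norm (expectation (Z i)))\<^sup>2" for i \<omega>
    by (simp add: W_def power2_norm_eq_inner inner_diff_left inner_diff_right inner_commute)
  have diag: "integrable M (\<lambda>\<omega>. W i \<omega> \<bullet> W i \<omega>)"
    "expectation (\<lambda>\<omega>. W i \<omega> \<bullet> W i \<omega>) \<le> expectation (\<lambda>\<omega>. (norm (Z i \<omega>))\<^sup>2)" if "i \<in> I" for i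
  proof -
    have iZ: "integrable M (\<lambda>\<omega>. Z i \<omega> \<bullet> expectation (Z i))" using int[OF that] by simp
    show "integrable M (\<lambda>\<omega>. W i \<omega> \<bullet> W i \<omega>)"
      unfolding dot_square_norm sq using iZ int2[OF that] by simp
    have "expectation (\<lambda>\<omega>. W i \<omega> \<bullet> W i \<omega>) = expectation (\<lambda>\<omega>. (norm (Z i \<omega>))\<^sup>2)
        - 2 * (expectation (Z i) \<bullet> expectation (Z i)) + (norm (expectation (Z i)))\<^sup>2"
      unfolding dot_square_norm[of "W i _"] sq using iZ int2[OF that] int[OF that] by (simp add: prob_space)
    then show "expectation (\<lambda>\<omega>. W i \<omega> \<bullet> W i \<omega>) \<le> expectation (\<lambda>\<omega>. (norm (Z i \<omega>))\<^sup>2)"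
      by (simp add: dot_square_norm)
  qed
  have off: "integrable M (\<lambda>\<omega>. W i \<omega> \<bullet> W j \<omega>)" "expectation (\<lambda>\<omega>. W i \<omega> \<bullet> W j \<omega>) = 0"
    if "i \<in> I" "j \<in> I" "i \<noteq> j" for i j
  proof -
    have "indep_var borel (W i) borel (W j)"
    proof -
      have "indep_vars (\<lambda>_. borel) (\<lambda>i. (\<lambda>z. z - expectation (Z i)) \<circ> Z i) I"
        by (rule indep_vars_compose[OF ind]) simp
      then have "indep_vars (\<lambda>_. borel) W I" by (simp add: W_def[abs_def] comp_def)
      from indep_var_compose[OF indep_var_restrict[OF this, of "{i}" "{j}"],
          of "\<lambda>f. f i" borel "\<lambda>f. f j" borel]
      show ?thesis using that by (simp add: comp_def)
    qed
    from indep_inner_expectation_0[OF this] iW that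
    show "integrable M (\<lambda>\<omega>. W i \<omega> \<bullet> W j \<omega>)" "expectation (\<lambda>\<omega>. W i \<omega> \<bullet> W j \<omega>) = 0" by auto
  qed
  have iall: "integrable M (\<lambda>\<omega>. W i \<omega> \<bullet> W j \<omega>)" if "i \<in> I" "j \<in> I" for i j
    using diag off that by (cases "i = j") auto
  have C: "(norm (C \<omega>))\<^sup>2 = (\<Sum>i\<in>I. \<Sum>j\<in>I. W i \<omega> \<bullet> W j \<omega>)" for \<omega>
    unfolding power2_norm_eq_inner C_def W_def by (simp only: inner_sum_left inner_sum_right) (rule sum.swap)
  show "integrable M (\<lambda>\<omega>. (norm (C \<omega>))\<^sup>2)"
    unfolding C by (intro Bochner_Integration.integrable_sum iall)
  have "expectation (\<lambda>\<omega>. (norm (C \<omega>))\<^sup>2) = (\<Sum>i\<in>I. \<Sum>j\<in>I. expectation (\<lambda>\<omega>. W i \<omega> \<bullet> W j \<omega>))"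
    unfolding C by (simp add: iall)
  also have "\<dots> = (\<Sum>i\<in>I. \<Sum>j\<in>I. if j = i then expectation (\<lambda>\<omega>. W i \<omega> \<bullet> W i \<omega>) else 0)"
    by (intro sum.cong) (auto simp: off)
  also have "\<dots> = (\<Sum>i\<in>I. expectation (\<lambda>\<omega>. W i \<omega> \<bullet> W i \<omega>))"
    using \<open>finite I\<close> by simp
  also have "\<dots> \<le> (\<Sum>i\<in>I. expectation (\<lambda>\<omega>. (norm (Z i \<omega>))\<^sup>2))"
    by (intro sum_mono diag)
  finally show "expectation (\<lambda>\<omega>. (norm (C \<omega>))\<^sup>2) \<le> (\<Sum>i\<in>I. expectation (\<lambda>\<omega>. (norm (Z i \<omega>))\<^sup>2))" .
qed

text \<open>With only \<open>p\<close> moments the variance may be infinite. Truncation at level \<open>\<tau> = \<sigma> * N\<^sup>1\<^sup>/\<^sup>p\<close> splits each summand: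
  the small parts have finite variance and, being independent, sum up to order \<open>\<tau>\<close> in \<open>L\<^sup>2\<close>; the large
  parts are so rare that their first moments sum up to at most \<open>\<tau>\<close>. The level is the one that balances both.
  The variance is computed through inner products, so the constant does not depend on the dimension.\<close>
lemma (in prob_space) heavy_tailed_sum_first_moment:
  fixes Y :: "'i \<Rightarrow> 'a \<Rightarrow> 'b::euclidean_space"
  assumes "finite I" "I \<noteq> {}" and ind: "indep_vars (\<lambda>_. borel) Y I"
    and mean0: "\<And>i. i \<in> I \<Longrightarrow> has_bochner_integral M (Y i) 0"
    and mom: "\<And>i. i \<in> I \<Longrightarrow> (\<integral>\<^sup>+\<omega>. ennreal (norm (Y i \<omega>) powr p) \<partial>M) \<le> ennreal (\<sigma> powr p)"
    and p: "1 < p" "p \<le> 2" and "0 < \<sigma>"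
  shows "(\<integral>\<^sup>+\<omega>. ennreal (norm (\<Sum>i\<in>I. Y i \<omega>)) \<partial>M) \<le> ennreal (3 * \<sigma> * real (card I) powr (1 / p))"
proof -
  define N where "N = real (card I)"
  have N: "0 < N" using assms(1,2) by (simp add: N_def card_gt_0_iff)
  define \<tau> where "\<tau> = \<sigma> * N powr (1 / p)"
  have \<tau>: "0 < \<tau>" using N \<open>0 < \<sigma>\<close> by (simp add: \<tau>_def)
  have \<tau>p: "\<tau> powr p = \<sigma> powr p * N"
    using N p \<open>0 < \<sigma>\<close> by (simp add: \<tau>_def powr_mult powr_powr)
  have t2: "N * (\<tau> powr (2 - p) * \<sigma> powr p) = \<tau>\<^sup>2"
  proof -
    have "N * (\<tau> powr (2 - p) * \<sigma> powr p) = \<tau> powr (2 - p) * \<tau> powr p" by (simp add: \<tau>p)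
    also have "\<dots> = \<tau>\<^sup>2" using \<tau> by (simp add: powr_realpow flip: powr_add)
    finally show ?thesis .
  qed
  have t1: "N * (\<tau> powr (1 - p) * \<sigma> powr p) = \<tau>"
  proof -
    have "N * (\<tau> powr (1 - p) * \<sigma> powr p) = \<tau> powr (1 - p) * \<tau> powr p" by (simp add: \<tau>p)
    also have "\<dots> = \<tau>" using \<tau> by (simp flip: powr_add)
    finally show ?thesis .
  qed
  \<comment> \<open>Independence survives because each truncated variable is a function of a single summand.\<close>
  define trunc where "trunc z = (if norm z \<le> \<tau> then z else 0)" for z :: 'b
  have trunc_meas: "trunc \<in> borel_measurable borel" unfolding trunc_def[abs_def] by measurable
  define Z where "Z i \<omega> = trunc (Y i \<omega>)" for i \<omega>
  define W where "W i \<omega> = Y i \<omega> - Z i \<omega>" for i \<omega>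
  have Y_int: "integrable M (Y i)" "expectation (Y i) = 0" if "i \<in> I" for i
    using mean0[OF that] by (auto simp: has_bochner_integral_iff)
  have meas[measurable]: "Y i \<in> borel_measurable M" "Z i \<in> borel_measurable M" "W i \<in> borel_measurable M" if "i \<in> I" for i
  proof -
    show Y: "Y i \<in> borel_measurable M" using Y_int[OF that] by simp
    show Z: "Z i \<in> borel_measurable M" unfolding Z_def[abs_def] by (rule measurable_compose[OF Y trunc_meas])
    show "W i \<in> borel_measurable M" unfolding W_def[abs_def] using Y Z by simp
  qed
  have Z_bd: "norm (Z i \<omega>) \<le> \<tau>" for i \<omega> using \<tau> by (simp add: Z_def trunc_def)
  have Z_int: "integrable M (Z i)" "integrable M (\<lambda>\<omega>. (norm (Z i \<omega>))\<^sup>2)" if "i \<in> I" for i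
  proof -
    show "integrable M (Z i)"
      using meas[OF that] Z_bd by (intro integrable_const_bound[where B=\<tau>]) auto
    show "integrable M (\<lambda>\<omega>. (norm (Z i \<omega>))\<^sup>2)"
      using meas[OF that] Z_bd by (intro integrable_const_bound[where B="\<tau>\<^sup>2"]) (auto intro!: power_mono)
  qed
  have W_int: "integrable M (W i)" if "i \<in> I" for i
    unfolding W_def[abs_def] using Y_int Z_int that by simp
  have mom_int: "integrable M (\<lambda>\<omega>. norm (Y i \<omega>) powr p)"
    and mom_le: "expectation (\<lambda>\<omega>. norm (Y i \<omega>) powr p) \<le> \<sigma> powr p" if "i \<in> I" for i
  proof -
    show I: "integrable M (\<lambda>\<omega>. norm (Y i \<omega>) powr p)"
      using mom[OF that] meas[OF that]
      by (intro integrableI_bounded) (auto intro: le_less_trans)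
    have "ennreal (expectation (\<lambda>\<omega>. norm (Y i \<omega>) powr p)) \<le> ennreal (\<sigma> powr p)"
      using mom[OF that] by (subst nn_integral_eq_integral[symmetric]) (auto simp: I)
    then show "expectation (\<lambda>\<omega>. norm (Y i \<omega>) powr p) \<le> \<sigma> powr p" by simp
  qed
  have Z2: "expectation (\<lambda>\<omega>. (norm (Z i \<omega>))\<^sup>2) \<le> \<tau> powr (2 - p) * \<sigma> powr p" if "i \<in> I" for i
  proof -
    have "expectation (\<lambda>\<omega>. (norm (Z i \<omega>))\<^sup>2) \<le> expectation (\<lambda>\<omega>. \<tau> powr (2 - p) * norm (Y i \<omega>) powr p)"
      using truncation_bounds(1)[OF norm_ge_zero \<tau> p] that
      by (intro integral_mono Z_int integrable_mult_right mom_int) (auto simp: Z_def trunc_def)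
    also have "\<dots> \<le> \<tau> powr (2 - p) * \<sigma> powr p"
      using mom_le[OF that] by (simp add: mult_left_mono)
    finally show ?thesis .
  qed
  have W1: "expectation (\<lambda>\<omega>. norm (W i \<omega>)) \<le> \<tau> powr (1 - p) * \<sigma> powr p" if "i \<in> I" for i
  proof -
    have "expectation (\<lambda>\<omega>. norm (W i \<omega>)) \<le> expectation (\<lambda>\<omega>. \<tau> powr (1 - p) * norm (Y i \<omega>) powr p)"
      using truncation_bounds(2)[OF norm_ge_zero \<tau> p] that
      by (intro integral_mono integrable_norm W_int integrable_mult_right mom_int) (auto simp: W_def Z_def trunc_def not_le)
    also have "\<dots> \<le> \<tau> powr (1 - p) * \<sigma> powr p"
      using mom_le[OF that] by (simp add: mult_left_mono)
    finally show ?thesis .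
  qed
  define S where "S \<omega> = (\<Sum>i\<in>I. Z i \<omega> - expectation (Z i))" for \<omega>
  have indZ: "indep_vars (\<lambda>_. borel) Z I"
    using indep_vars_compose[OF ind, of "\<lambda>_. trunc" "\<lambda>_. borel"] trunc_meas
    by (simp add: Z_def[abs_def] comp_def)
  note S2 = indep_sum_second_moment[OF \<open>finite I\<close> indZ Z_int, folded S_def]
  have "expectation (\<lambda>\<omega>. (norm (S \<omega>))\<^sup>2) \<le> (\<Sum>i\<in>I. \<tau> powr (2 - p) * \<sigma> powr p)"
    by (rule order_trans[OF S2(2)]) (auto simp del: sum_constant intro!: sum_mono Z2)
  then have S2le: "expectation (\<lambda>\<omega>. (norm (S \<omega>))\<^sup>2) \<le> \<tau>\<^sup>2" using t2 by (simp add: N_def)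
  have pt: "norm (\<Sum>i\<in>I. Y i \<omega>) \<le> (norm (S \<omega>))\<^sup>2 / (2 * \<tau>) + \<tau> / 2
      + (\<Sum>i\<in>I. norm (W i \<omega>) + norm (expectation (W i)))" for \<omega>
  proof -
    have "expectation (W i) = - expectation (Z i)" if "i \<in> I" for i
      unfolding W_def[abs_def] using Y_int Z_int that by simp
    then have "(\<Sum>i\<in>I. Y i \<omega>) = S \<omega> + (\<Sum>i\<in>I. W i \<omega> - expectation (W i))"
      by (simp add: S_def W_def flip: sum.distrib)
    moreover have "norm (\<Sum>i\<in>I. W i \<omega> - expectation (W i)) \<le> (\<Sum>i\<in>I. norm (W i \<omega>) + norm (expectation (W i)))"
      by (rule order_trans[OF norm_sum sum_mono]) (rule norm_triangle_ineq4)
    \<comment> \<open>Comparison with the square by the arithmetic-geometric mean inequality, in place of Cauchy-Schwarz for expectations.\<close>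
    moreover have "norm (S \<omega>) \<le> (norm (S \<omega>))\<^sup>2 / (2 * \<tau>) + \<tau> / 2"
    proof -
      have "0 \<le> (norm (S \<omega>) - \<tau>)\<^sup>2 / (2 * \<tau>)" using \<tau> by simp
      also have "\<dots> = (norm (S \<omega>))\<^sup>2 / (2 * \<tau>) + \<tau> / 2 - norm (S \<omega>)"
        using \<tau> by (simp add: power2_diff power2_eq_square field_simps)
      finally show ?thesis by simp
    qed
    ultimately show ?thesis using norm_triangle_ineq[of "S \<omega>" "\<Sum>i\<in>I. W i \<omega> - expectation (W i)"] by simp
  qed
  let ?R = "\<lambda>\<omega>. (norm (S \<omega>))\<^sup>2 / (2 * \<tau>) + \<tau> / 2 + (\<Sum>i\<in>I. norm (W i \<omega>) + norm (expectation (W i)))"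
  have iR: "integrable M ?R"
    using S2(1) W_int by auto
  have R0: "0 \<le> ?R \<omega>" for \<omega> by (rule order_trans[OF norm_ge_zero pt])
  have "expectation ?R = expectation (\<lambda>\<omega>. (norm (S \<omega>))\<^sup>2) / (2 * \<tau>) + \<tau> / 2
      + (\<Sum>i\<in>I. expectation (\<lambda>\<omega>. norm (W i \<omega>)) + norm (expectation (W i)))"
    using S2(1) W_int by (simp add: prob_space)
  also have "\<dots> \<le> \<tau>\<^sup>2 / (2 * \<tau>) + \<tau> / 2 + (\<Sum>i\<in>I. 2 * (\<tau> powr (1 - p) * \<sigma> powr p))"
  proof (intro add_mono divide_right_mono S2le order_refl sum_mono)
    fix i assume "i \<in> I"
    have "norm (expectation (W i)) \<le> expectation (\<lambda>\<omega>. norm (W i \<omega>))" by (rule integral_norm_bound)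
    with W1[OF \<open>i \<in> I\<close>]
    show "expectation (\<lambda>\<omega>. norm (W i \<omega>)) + norm (expectation (W i)) \<le> 2 * (\<tau> powr (1 - p) * \<sigma> powr p)" by linarith
  qed (use \<tau> in simp_all)
  also have "\<dots> = 3 * \<tau>" using t1 \<tau> by (simp add: N_def power2_eq_square mult_ac)
  finally have le: "expectation ?R \<le> 3 * \<tau>" .
  have "(\<integral>\<^sup>+\<omega>. ennreal (norm (\<Sum>i\<in>I. Y i \<omega>)) \<partial>M) \<le> (\<integral>\<^sup>+\<omega>. ennreal (?R \<omega>) \<partial>M)"
    by (intro nn_integral_mono ennreal_leI pt)
  also have "\<dots> = ennreal (expectation ?R)" by (intro nn_integral_eq_integral iR) (simp add: R0)
  also have "\<dots> \<le> ennreal (3 * \<tau>)" by (rule ennreal_leI[OF le])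
  finally show ?thesis by (simp add: \<tau>_def N_def mult_ac)
qed

text \<open>Fubini for the joint law of independent variables.\<close>
lemma (in prob_space) nn_integral_indep_var:
  assumes ind: "indep_var S X T Y"
    and \<phi>: "\<phi> \<in> borel_measurable (S \<Otimes>\<^sub>M T)"
  shows "(\<integral>\<^sup>+\<omega>. \<phi> (X \<omega>, Y \<omega>) \<partial>M) = (\<integral>\<^sup>+\<omega>. (\<integral>\<^sup>+\<omega>'. \<phi> (X \<omega>, Y \<omega>') \<partial>M) \<partial>M)"
proof -
  have rv: "X \<in> measurable M S" "Y \<in> measurable M T"
    and eq: "distr M S X \<Otimes>\<^sub>M distr M T Y = distr M (S \<Otimes>\<^sub>M T) (\<lambda>x. (X x, Y x))"
    using ind by (auto simp: indep_var_distribution_eq)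
  interpret T: prob_space "distr M T Y" by (rule prob_space_distr[OF rv(2)])
  have "(\<integral>\<^sup>+\<omega>. \<phi> (X \<omega>, Y \<omega>) \<partial>M) = (\<integral>\<^sup>+z. \<phi> z \<partial>distr M (S \<Otimes>\<^sub>M T) (\<lambda>x. (X x, Y x)))"
    using rv \<phi> by (subst nn_integral_distr) auto
  also have "\<dots> = (\<integral>\<^sup>+x. \<integral>\<^sup>+y. \<phi> (x, y) \<partial>distr M T Y \<partial>distr M S X)"
    unfolding eq[symmetric] using \<phi> by (subst T.nn_integral_fst[symmetric]) (auto cong: measurable_cong_sets)
  also have "\<dots> = (\<integral>\<^sup>+\<omega>. \<integral>\<^sup>+y. \<phi> (X \<omega>, y) \<partial>distr M T Y \<partial>M)"
    using \<phi> by (subst nn_integral_distr[OF rv(1)]) (auto intro!: T.borel_measurable_nn_integral cong: measurable_cong_sets)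
  also have "\<dots> = (\<integral>\<^sup>+\<omega>. (\<integral>\<^sup>+\<omega>'. \<phi> (X \<omega>, Y \<omega>') \<partial>M) \<partial>M)"
    using measurable_space[OF rv(1)] \<phi> by (intro nn_integral_cong nn_integral_distr[OF rv(2)]) auto
  finally show ?thesis .
qed

section \<open>Measurability of the iterates and moments of the gradient noise\<close>

lemma borel_measurable_vecI:
  fixes f :: "'a \<Rightarrow> 'b::euclidean_space^'n"
  assumes "\<And>i. (\<lambda>x. f x $ i) \<in> borel_measurable M"
  shows "f \<in> borel_measurable M"
proof (subst borel_measurable_euclidean_space, rule ballI)
  fix e :: "'b^'n" assume "e \<in> Basis"
  then obtain i b where e: "e = axis i b" by (auto simp: Basis_vec_def)
  show "(\<lambda>x. f x \<bullet> e) \<in> borel_measurable M"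
    unfolding e inner_axis using assms[of i] by measurable
qed

lemma borel_measurable_vec_nth':
  fixes f :: "'a \<Rightarrow> 'b::euclidean_space^'n"
  assumes "f \<in> borel_measurable M"
  shows "(\<lambda>x. f x $ i) \<in> borel_measurable M"
proof -
  have "(\<lambda>v::'b^'n. v $ i) \<in> borel_measurable borel"
    by (intro borel_measurable_continuous_onI continuous_intros)
  from measurable_compose[OF assms this] show ?thesis .
qed

text \<open>Approximating \<open>X\<close> by simple functions leaves finitely many sections \<open>F x\<close> at a time, each measurable;
  continuity in the first argument passes to the limit.\<close>
lemma caratheodory_measurable:
  fixes F :: "'b::{metric_space, second_countable_topology} \<Rightarrow> 's \<Rightarrow> real"
  assumes X: "X \<in> borel_measurable M" and Y: "Y \<in> measurable M N"
    and meas: "\<And>x. F x \<in> borel_measurable N"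
    and cont: "\<And>\<xi>. \<xi> \<in> space N \<Longrightarrow> continuous_on UNIV (\<lambda>x. F x \<xi>)"
  shows "(\<lambda>\<omega>. F (X \<omega>) (Y \<omega>)) \<in> borel_measurable M"
proof -
  obtain s where s: "\<And>i. simple_function M (s i)"
    "\<And>\<omega>. \<omega> \<in> space M \<Longrightarrow> (\<lambda>i. s i \<omega>) \<longlonglongrightarrow> X \<omega>"
    using borel_measurable_implies_sequence_metric[OF X] by blast
  have "(\<lambda>\<omega>. F (s i \<omega>) (Y \<omega>)) \<in> borel_measurable M" for i
  proof (rule measurable_compose_countable'[where f = "\<lambda>x \<omega>. F x (Y \<omega>)" and g = "s i" and I = "s i ` space M"])
    show "(\<lambda>\<omega>. F x (Y \<omega>)) \<in> borel_measurable M" for x by (rule measurable_compose[OF Y meas])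
    show "countable (s i ` space M)" using s(1)[of i] by (auto simp: simple_function_def intro: countable_finite)
    show "s i \<in> M \<rightarrow>\<^sub>M count_space (s i ` space M)"
      using s(1)[of i] by (subst measurable_count_space_eq2) (auto simp: simple_function_def)
  qed
  moreover have "(\<lambda>i. F (s i \<omega>) (Y \<omega>)) \<longlonglongrightarrow> F (X \<omega>) (Y \<omega>)" if "\<omega> \<in> space M" for \<omega>
    by (rule continuous_on_tendsto_compose[OF cont s(2)[OF that]])
       (use measurable_space[OF Y that] in auto)
  ultimately show ?thesis
    by (rule borel_measurable_LIMSEQ_real[rotated])
qed

text \<open>This presents gradients as limits of sequences, hence makes them measurable in the sample.\<close>
lemma grad_difference_quotient:
  fixes g :: "'a::euclidean_space \<Rightarrow> real"
  assumes "g differentiable (at x)"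
  shows "(\<lambda>n. (g (x + inverse (real (Suc n)) *\<^sub>R e) - g x) * real (Suc n)) \<longlonglongrightarrow> grad g x \<bullet> e"
proof -
  have "((\<lambda>s. g (x + s *\<^sub>R e)) has_real_derivative e \<bullet> grad g x) (at 0)"
    by (rule GDERIV_line) (use GDERIV_grad[OF assms] in simp)
  then have "((\<lambda>h. (g (x + h *\<^sub>R e) - g x) / h) \<longlongrightarrow> e \<bullet> grad g x) (at 0)"
    by (simp add: DERIV_def)
  moreover have "filterlim (\<lambda>n. inverse (real (Suc n))) (at 0) sequentially"
    unfolding filterlim_at using LIMSEQ_inverse_real_of_nat by simp
  ultimately have "((\<lambda>n. (g (x + inverse (real (Suc n)) *\<^sub>R e) - g x) / inverse (real (Suc n)))
      \<longlongrightarrow> e \<bullet> grad g x) sequentially"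
    by (rule filterlim_compose)
  then show ?thesis by (simp add: field_simps inner_commute)
qed

text \<open>The problem assumptions give measurability of \<open>F i x\<close> for fixed \<open>x\<close> only, whereas the algorithm evaluates
  gradients at random points. Differentiability makes \<open>F i\<close> continuous in \<open>x\<close>, and the gradient is a limit
  of difference quotients.\<close>
lemma borel_measurable_stoch_grad:
  fixes F :: "'n::finite \<Rightarrow> real^'d::finite \<Rightarrow> 's \<Rightarrow> real"
  assumes sp: "stochastic_problem \<D> F"
    and X: "X \<in> borel_measurable M" and Y: "Y \<in> measurable M (\<D> i)"
  shows "(\<lambda>\<omega>. stoch_grad F i (X \<omega>) (Y \<omega>)) \<in> borel_measurable M"
proof (subst borel_measurable_euclidean_space, rule ballI)
  fix e :: "real^'d" assume "e \<in> Basis"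
  have diff: "(\<lambda>y. F i y \<xi>) differentiable (at x)" if "\<xi> \<in> space (\<D> i)" for \<xi> x
    using sp that by (auto simp: stochastic_problem_def)
  have F_meas: "(\<lambda>\<omega>. F i (Z \<omega>) (Y \<omega>)) \<in> borel_measurable M" if "Z \<in> borel_measurable M" for Z
  proof (rule caratheodory_measurable[OF that Y])
    show "F i x \<in> borel_measurable (\<D> i)" for x
      using sp by (auto simp: stochastic_problem_def)
    show "continuous_on UNIV (\<lambda>x. F i x \<xi>)" if "\<xi> \<in> space (\<D> i)" for \<xi>
      using diff[OF that] differentiable_imp_continuous_within
      by (auto simp: continuous_on_eq_continuous_within)
  qed
  show "(\<lambda>\<omega>. stoch_grad F i (X \<omega>) (Y \<omega>) \<bullet> e) \<in> borel_measurable M"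
  proof (rule borel_measurable_LIMSEQ_real)
    show "(\<lambda>n. (F i (X \<omega> + inverse (real (Suc n)) *\<^sub>R e) (Y \<omega>) - F i (X \<omega>) (Y \<omega>)) * real (Suc n))
        \<longlonglongrightarrow> stoch_grad F i (X \<omega>) (Y \<omega>) \<bullet> e" if "\<omega> \<in> space M" for \<omega>
      unfolding stoch_grad_def
      by (rule grad_difference_quotient[OF diff[OF measurable_space[OF Y that]]])
    show "(\<lambda>\<omega>. (F i (X \<omega> + inverse (real (Suc n)) *\<^sub>R e) (Y \<omega>) - F i (X \<omega>) (Y \<omega>)) * real (Suc n))
        \<in> borel_measurable M" for n
      using X by (intro borel_measurable_times borel_measurable_diff F_meas) auto
  qed
qed

lemma matrix_mult_row:
  fixes M :: "real^'m^'n" and Z :: "real^'d^'m"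
  shows "(M ** Z) $ i = (\<Sum>j\<in>UNIV. M $ i $ j *\<^sub>R Z $ j)"
  by (simp add: vec_eq_iff matrix_matrix_mult_def)

lemma dnsgd_pd_Suc_fst:
  "fst (dnsgd_pd A F x0 \<eta> Kh K b w (Suc t)) =
     mat_pow A K ** (fst (dnsgd_pd A F x0 \<eta> Kh K b w t)
        - \<eta> *\<^sub>R normalize_rows (snd (dnsgd_pd A F x0 \<eta> Kh K b w t)))"
  by (simp add: case_prod_beta Let_def)

lemma dnsgd_pd_Suc_snd:
  "snd (dnsgd_pd A F x0 \<eta> Kh K b w (Suc t)) =
     mat_pow A K ** (snd (dnsgd_pd A F x0 \<eta> Kh K b w t)
        + matrix_inv (pull_diag A K (Suc t)) ** minibatch F b w (Suc t) (fst (dnsgd_pd A F x0 \<eta> Kh K b w (Suc t)))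
        - matrix_inv (pull_diag A K t) ** minibatch F b w t (fst (dnsgd_pd A F x0 \<eta> Kh K b w t)))"
  by (simp add: case_prod_beta Let_def)

lemma dnsgd_pd_cong:
  assumes "\<And>s i k. s \<le> t \<Longrightarrow> w (s, i, k) = w' (s, i, k)"
  shows "dnsgd_pd A F x0 \<eta> Kh K b w t = dnsgd_pd A F x0 \<eta> Kh K b w' t"
  using assms
proof (induction t)
  case (Suc t)
  then have "dnsgd_pd A F x0 \<eta> Kh K b w t = dnsgd_pd A F x0 \<eta> Kh K b w' t" by simp
  moreover have "minibatch F b w t X = minibatch F b w' t X" "minibatch F b w (Suc t) X = minibatch F b w' (Suc t) X" for X
    using Suc.prems by (simp_all add: minibatch_def)
  ultimately show ?case by (simp add: case_prod_beta Let_def)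
qed (simp add: minibatch_def)

text \<open>The iterates are predictable: the samples of round \<open>t\<close> enter the tracker of round \<open>t\<close> but only the iterate of
  round \<open>t + 1\<close>.\<close>
lemma dnsgd_pd_fst_cong:
  assumes "\<And>s i k. s < t \<Longrightarrow> w (s, i, k) = w' (s, i, k)"
  shows "fst (dnsgd_pd A F x0 \<eta> Kh K b w t) = fst (dnsgd_pd A F x0 \<eta> Kh K b w' t)"
proof (cases t)
  case (Suc u)
  have "dnsgd_pd A F x0 \<eta> Kh K b w u = dnsgd_pd A F x0 \<eta> Kh K b w' u"
    by (rule dnsgd_pd_cong) (use assms Suc in simp)
  then show ?thesis unfolding Suc dnsgd_pd_Suc_fst by simp
qed (simp add: Let_def)

lemma sample_paths_eq: "sample_paths \<D> = PiM UNIV (\<lambda>s. \<D> (fst (snd s)))"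
proof -
  have "(\<lambda>(t, i, k). \<D> i) = (\<lambda>s :: nat \<times> _ \<times> nat. \<D> (fst (snd s)))" by (auto simp: fun_eq_iff)
  then show ?thesis by (simp only: sample_paths_def)
qed

definition stoch_grad_error ::
    "('n \<Rightarrow> 's measure) \<Rightarrow> ('n \<Rightarrow> real^'d \<Rightarrow> 's \<Rightarrow> real) \<Rightarrow> 'n \<Rightarrow> real^'d \<Rightarrow> 's \<Rightarrow> real^'d" where
  "stoch_grad_error \<D> F i x \<xi> = stoch_grad F i x \<xi> - grad (local_obj \<D> F i) x"

text \<open>The gradient noise of an agent at an iteration, along the trajectory of the algorithm.\<close>
definition minibatch_error ::
    "('n \<Rightarrow> 's measure) \<Rightarrow> ('n \<Rightarrow> real^'d \<Rightarrow> 's \<Rightarrow> real) \<Rightarrow> real^'n^'n \<Rightarrow> real^'d \<Rightarrow> real \<Rightarrow> nat \<Rightarrow> nat \<Rightarrow> nat \<Rightarrow>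
     nat \<Rightarrow> 'n \<Rightarrow> (nat \<times> 'n \<times> nat \<Rightarrow> 's) \<Rightarrow> real^'d" where
  "minibatch_error \<D> F A x0 \<eta> Kh K b t i w =
     (let X = fst (dnsgd_pd A F x0 \<eta> Kh K b w t)
      in minibatch F b w t X $ i - grad (local_obj \<D> F i) (X $ i))"

context
  fixes \<D> :: "'n::finite \<Rightarrow> 's measure" and F :: "'n \<Rightarrow> real^'d::finite \<Rightarrow> 's \<Rightarrow> real"
    and L p \<sigma> :: real and A :: "real^'n^'n" and x0 :: "real^'d" and \<eta> :: real and Kh K b :: nat
  assumes sp: "stochastic_problem \<D> F"
    and smooth: "\<And>i. L_smooth L (local_obj \<D> F i)"
    and p: "1 < p" "p \<le> 2" and \<sigma>: "0 < \<sigma>" and orc: "oracle_condition \<D> F p \<sigma>"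
    and b: "0 < b"
begin

private abbreviation "DD \<equiv> (\<lambda>s::nat \<times> 'n \<times> nat. \<D> (fst (snd s)))"
private abbreviation "MM \<equiv> sample_paths \<D>"
private abbreviation "X t w \<equiv> fst (dnsgd_pd A F x0 \<eta> Kh K b w t)"
private abbreviation "oracle_error \<equiv> stoch_grad_error \<D> F"
private abbreviation "noise \<equiv> minibatch_error \<D> F A x0 \<eta> Kh K b"
private abbreviation "V t w \<equiv> snd (dnsgd_pd A F x0 \<eta> Kh K b w t)"

private lemma prob_D: "prob_space (\<D> i)"
  using sp by (auto simp: stochastic_problem_def)

lemma prob_space_sample_paths: "prob_space MM"
  unfolding sample_paths_eq by (rule prob_space_PiM) (rule prob_D)

interpretation MM: prob_space MM by (rule prob_space_sample_paths)

private lemma coord_meas: "(\<lambda>w. w (t, i, k)) \<in> measurable MM (\<D> i)"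
  unfolding sample_paths_eq
  using measurable_component_singleton[of "(t, i, k)" UNIV DD] by simp

private lemma coord_distr: "distr MM (DD s) (\<lambda>w. w s) = DD s"
  unfolding sample_paths_eq by (rule distr_PiM_component) (auto intro: prob_D)

private lemma coord_indep: "MM.indep_vars DD (\<lambda>s w. w s) UNIV"
proof (subst MM.indep_vars_iff_distr_eq_PiM)
  show "(\<lambda>w. w s) \<in> measurable MM (DD s)" for s
    using coord_meas[of "fst s" "fst (snd s)" "snd (snd s)"] by simp
  have "distr MM (Pi\<^sub>M UNIV DD) (\<lambda>w. \<lambda>s\<in>UNIV. w s) = distr MM MM (\<lambda>w. w)"
    by (rule distr_cong) (simp_all add: sample_paths_eq restrict_def)
  also have "\<dots> = MM" by (rule distr_id)
  finally show "distr MM (Pi\<^sub>M UNIV DD) (\<lambda>w. \<lambda>s\<in>UNIV. w s) = (\<Pi>\<^sub>M s\<in>UNIV. distr MM (DD s) (\<lambda>w. w s))"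
    unfolding coord_distr by (simp add: sample_paths_eq)
qed simp

lemma borel_measurable_minibatch:
  assumes "Z \<in> borel_measurable MM"
  shows "(\<lambda>w. minibatch F b w t (Z w) $ i) \<in> borel_measurable MM"
  unfolding minibatch_def vec_lambda_beta
  by (intro borel_measurable_scaleR borel_measurable_sum borel_measurable_const
      borel_measurable_stoch_grad[OF sp] borel_measurable_vec_nth' assms coord_meas)

lemma borel_measurable_dnsgd_pd:
  "(\<lambda>w. X t w) \<in> borel_measurable MM" "(\<lambda>w. V t w) \<in> borel_measurable MM"
proof (induction t)
  case 0
  show "(\<lambda>w. X 0 w) \<in> borel_measurable MM" by (simp add: Let_def)
  show "(\<lambda>w. V 0 w) \<in> borel_measurable MM"
    by (rule borel_measurable_vecI)
      (auto simp: matrix_mult_row Let_def intro!: borel_measurable_sum borel_measurable_scaleR borel_measurable_minibatch)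
next
  case (Suc t)
  note nth = borel_measurable_vec_nth'[OF Suc(1)] borel_measurable_vec_nth'[OF Suc(2)]
  have "(\<lambda>w. sgn (V t w $ i)) \<in> borel_measurable MM" for i
    using nth(2)[of i] unfolding sgn_div_norm by (intro borel_measurable_scaleR borel_measurable_inverse) auto
  then have "(\<lambda>w. X (Suc t) w $ i) \<in> borel_measurable MM" for i
    by (simp only: dnsgd_pd_Suc_fst matrix_mult_row normalize_rows_def vector_minus_component vector_scaleR_component vec_lambda_beta)
      (intro borel_measurable_sum borel_measurable_scaleR borel_measurable_diff nth borel_measurable_const)
  then show X': "(\<lambda>w. X (Suc t) w) \<in> borel_measurable MM" by (rule borel_measurable_vecI)
  have "(\<lambda>w. V (Suc t) w $ i) \<in> borel_measurable MM" for i
    by (simp only: dnsgd_pd_Suc_snd matrix_mult_row vector_minus_component vector_add_component)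
      (intro borel_measurable_sum borel_measurable_scaleR borel_measurable_diff borel_measurable_add nth
         borel_measurable_const borel_measurable_minibatch Suc(1) X')
  then show "(\<lambda>w. V (Suc t) w) \<in> borel_measurable MM" by (rule borel_measurable_vecI)
qed

text \<open>Predictability and independence combined: the current iterate is a function of the samples of earlier rounds, so it
  can be frozen while the samples of the current round are integrated out.\<close>
private lemma fresh_samples_fubini:
  assumes \<phi>: "\<phi> \<in> borel_measurable (borel \<Otimes>\<^sub>M PiM {s. fst s = t} DD)"
  shows "(\<lambda>w. \<phi> (X t w, restrict w {s. fst s = t})) \<in> borel_measurable MM"
    and "(\<integral>\<^sup>+w. \<phi> (X t w, restrict w {s. fst s = t}) \<partial>MM)
       = (\<integral>\<^sup>+w. (\<integral>\<^sup>+w'. \<phi> (X t w, restrict w' {s. fst s = t}) \<partial>MM) \<partial>MM)"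
proof -
  let ?A = "{s :: nat \<times> 'n \<times> nat. fst s < t}" and ?B = "{s :: nat \<times> 'n \<times> nat. fst s = t}"
  have ind: "MM.indep_var (PiM ?A DD) (\<lambda>w. restrict w ?A) (PiM ?B DD) (\<lambda>w. restrict w ?B)"
    using MM.indep_var_restrict[OF coord_indep, of ?A ?B] by auto
  \<comment> \<open>Samples of the past are completed to a full sample path by arbitrary values \<open>c\<close>, on which the iterate does not depend.\<close>
  define c where "c s = (SOME x. x \<in> space (DD s))" for s
  have c: "c s \<in> space (DD s)" for s
    unfolding c_def using prob_space.not_empty[OF prob_D] by (metis some_in_eq)
  define ext where "ext v s = (if s \<in> ?A then v s else c s)" for v :: "nat \<times> 'n \<times> nat \<Rightarrow> 's" and s
  have ext_meas: "ext \<in> measurable (PiM ?A DD) MM"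
    unfolding sample_paths_eq
  proof (rule measurable_PiM_single')
    fix s :: "nat \<times> 'n \<times> nat"
    show "(\<lambda>v. ext v s) \<in> measurable (PiM ?A DD) (DD s)"
    proof (cases "s \<in> ?A")
      case True
      then show ?thesis using measurable_component_singleton[OF True, of DD] by (simp add: ext_def)
    qed (use c in \<open>simp add: ext_def\<close>)
  qed (use c[of "(_, _, _)"] in \<open>auto simp: ext_def PiE_def space_PiM Pi_def\<close>)
  have X_ext: "X t (ext (restrict w ?A)) = X t w" for w
    by (rule dnsgd_pd_fst_cong) (simp add: ext_def)
  let ?\<psi> = "\<lambda>z. \<phi> (X t (ext (fst z)), snd z)"
  have "(\<lambda>z. (X t (ext (fst z)), snd z)) \<in> measurable (PiM ?A DD \<Otimes>\<^sub>M PiM ?B DD) (borel \<Otimes>\<^sub>M PiM ?B DD)"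
    by (intro measurable_Pair measurable_compose[OF measurable_compose[OF measurable_fst ext_meas]
         borel_measurable_dnsgd_pd(1)] measurable_snd)
  from measurable_compose[OF this \<phi>]
  have \<psi>: "?\<psi> \<in> borel_measurable (PiM ?A DD \<Otimes>\<^sub>M PiM ?B DD)" .
  show "(\<integral>\<^sup>+w. \<phi> (X t w, restrict w ?B) \<partial>MM) = (\<integral>\<^sup>+w. (\<integral>\<^sup>+w'. \<phi> (X t w, restrict w' ?B) \<partial>MM) \<partial>MM)"
    using MM.nn_integral_indep_var[OF ind \<psi>] by (simp only: fst_conv snd_conv X_ext)
  have "(\<lambda>w. restrict w ?B) \<in> measurable MM (PiM ?B DD)"
    using ind by (simp add: MM.indep_var_distribution_eq)
  then show "(\<lambda>w. \<phi> (X t w, restrict w ?B)) \<in> borel_measurable MM"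
    by (intro measurable_compose[OF _ \<phi>] measurable_Pair borel_measurable_dnsgd_pd)
qed

lemma borel_measurable_grad_local: "grad (local_obj \<D> F i) \<in> borel_measurable borel"
proof (rule borel_measurable_continuous_onI)
  have "L-lipschitz_on UNIV (grad (local_obj \<D> F i))"
  proof (rule lipschitz_onI)
    show "dist (grad (local_obj \<D> F i) x) (grad (local_obj \<D> F i) y) \<le> L * dist x y" for x y
      using L_smoothD(2)[OF smooth] by (simp add: dist_norm)
    have "0 \<le> L * norm (axis undefined 1 - 0 :: real^'d)"
      by (rule order_trans[OF norm_ge_zero L_smoothD(2)[OF smooth[of i]]])
    then show "0 \<le> L" by simp
  qed
  then show "continuous_on UNIV (grad (local_obj \<D> F i))" by (rule lipschitz_on_continuous_on)
qed

private lemma oracle_error_meas: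
  assumes "Z \<in> borel_measurable M" "Y \<in> measurable M (\<D> i)"
  shows "(\<lambda>\<omega>. oracle_error i (Z \<omega>) (Y \<omega>)) \<in> borel_measurable M"
  unfolding stoch_grad_error_def
  by (intro borel_measurable_diff borel_measurable_stoch_grad[OF sp] assms
      measurable_compose[OF assms(1) borel_measurable_grad_local])

private lemma oracle_error_meas1: "oracle_error i x \<in> borel_measurable (\<D> i)"
  by (rule oracle_error_meas) auto

private lemma oracle_error_coord:
  shows "has_bochner_integral MM (\<lambda>w. oracle_error i x (w (t, i, k))) 0"
    and "(\<integral>\<^sup>+w. ennreal (norm (oracle_error i x (w (t, i, k))) powr p) \<partial>MM) \<le> ennreal (\<sigma> powr p)"
proof -
  have d: "distr MM (\<D> i) (\<lambda>w. w (t, i, k)) = \<D> i" using coord_distr[of "(t, i, k)"] by simp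
  have m: "oracle_error i x \<in> borel_measurable (\<D> i)" by (rule oracle_error_meas) auto
  interpret D: prob_space "\<D> i" by (rule prob_D)
  have "has_bochner_integral (\<D> i) (\<lambda>\<xi>. stoch_grad F i x \<xi> - grad (local_obj \<D> F i) x)
     (grad (local_obj \<D> F i) x - grad (local_obj \<D> F i) x)"
    using orc D.prob_space
    by (intro has_bochner_integral_diff) (auto simp: oracle_condition_def has_bochner_integral_iff)
  then have "has_bochner_integral (\<D> i) (oracle_error i x) 0" by (simp add: stoch_grad_error_def[abs_def])
  then have "has_bochner_integral (distr MM (\<D> i) (\<lambda>w. w (t, i, k))) (oracle_error i x) 0"
    unfolding d .
  then show "has_bochner_integral MM (\<lambda>w. oracle_error i x (w (t, i, k))) 0"
    by (simp add: has_bochner_integral_iff integrable_distr_eq[OF coord_meas m] integral_distr[OF coord_meas m])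
  have "(\<integral>\<^sup>+w. ennreal (norm (oracle_error i x (w (t, i, k))) powr p) \<partial>MM)
     = (\<integral>\<^sup>+\<xi>. ennreal (norm (oracle_error i x \<xi>) powr p) \<partial>distr MM (\<D> i) (\<lambda>w. w (t, i, k)))"
    using m coord_meas by (subst nn_integral_distr) auto
  also have "\<dots> \<le> ennreal (\<sigma> powr p)"
    unfolding d using orc by (simp add: oracle_condition_def stoch_grad_error_def)
  finally show "(\<integral>\<^sup>+w. ennreal (norm (oracle_error i x (w (t, i, k))) powr p) \<partial>MM) \<le> ennreal (\<sigma> powr p)" .
qed

lemma noise_eq: "noise t i w = (1 / real b) *\<^sub>R (\<Sum>k<b. oracle_error i (X t w $ i) (w (t, i, k)))"
  using b by (simp add: minibatch_error_def Let_def minibatch_def stoch_grad_error_def sum_subtractf scaleR_right_diff_distrib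
      sum_constant_scaleR del: sum_constant)

lemma borel_measurable_noise: "noise t i \<in> borel_measurable MM"
  unfolding noise_eq[abs_def]
  by (intro borel_measurable_scaleR borel_measurable_const borel_measurable_sum oracle_error_meas
       borel_measurable_vec_nth' borel_measurable_dnsgd_pd coord_meas)

private lemma fresh_meas:
  "(\<lambda>z. oracle_error i (fst z $ i) (snd z (t, i, k))) \<in> borel_measurable (borel \<Otimes>\<^sub>M PiM {s. fst s = t} DD)"
proof (rule oracle_error_meas)
  show "(\<lambda>z :: (real^'d^'n) \<times> (nat \<times> 'n \<times> nat \<Rightarrow> 's). fst z $ i) \<in> borel_measurable (borel \<Otimes>\<^sub>M PiM {s. fst s = t} DD)"
    by (rule borel_measurable_vec_nth') simp
  have "(\<lambda>v. v (t, i, k)) \<in> measurable (PiM {s. fst s = t} DD) (\<D> i)"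
    using measurable_component_singleton[of "(t, i, k)" "{s. fst s = t}" DD] by simp
  then show "(\<lambda>z. snd z (t, i, k)) \<in> measurable (borel \<Otimes>\<^sub>M PiM {s. fst s = t} DD) (\<D> i)"
    by (rule measurable_compose[OF measurable_snd])
qed

text \<open>All \<open>n * b\<close> fresh samples of a round count as one family of independent vectors; the networkwide average thus
  benefits from all of them, which is where the factor \<open>1 / n\<close> in the batch size comes from.\<close>
lemma noise_average_bound:
  "(\<integral>\<^sup>+w. ennreal (norm (\<Sum>i\<in>UNIV. noise t i w)) \<partial>MM)
     \<le> ennreal (3 * \<sigma> * (real CARD('n) * real b) powr (1 / p) / real b)"
proof -
  let ?I = "{t} \<times> (UNIV :: 'n set) \<times> {..<b}"
  let ?B = "{s :: nat \<times> 'n \<times> nat. fst s = t}"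
  define \<phi> where "\<phi> z = ennreal (norm (\<Sum>i\<in>UNIV. \<Sum>k<b. oracle_error i (fst z $ i) (snd z (t, i, k))))"
    for z :: "(real^'d^'n) \<times> (nat \<times> 'n \<times> nat \<Rightarrow> 's)"
  have \<phi>: "\<phi> \<in> borel_measurable (borel \<Otimes>\<^sub>M PiM ?B DD)"
    unfolding \<phi>_def[abs_def]
    by (intro measurable_compose[OF _ measurable_ennreal] measurable_compose[OF _ borel_measurable_norm] borel_measurable_sum fresh_meas)
  have inner: "(\<integral>\<^sup>+w. \<phi> (x, restrict w ?B) \<partial>MM) \<le> ennreal (3 * \<sigma> * (real CARD('n) * real b) powr (1 / p))" for x
  proof -
    define Y where "Y s w = oracle_error (fst (snd s)) (x $ fst (snd s)) (w s)" for s :: "nat \<times> 'n \<times> nat" and w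
    have "MM.indep_vars (\<lambda>_. borel) (\<lambda>s. oracle_error (fst (snd s)) (x $ fst (snd s)) \<circ> (\<lambda>w. w s)) UNIV"
      by (rule MM.indep_vars_compose[OF coord_indep]) (rule oracle_error_meas1)
    moreover have "(\<lambda>s. oracle_error (fst (snd s)) (x $ fst (snd s)) \<circ> (\<lambda>w. w s)) = Y"
      by (simp add: Y_def fun_eq_iff)
    ultimately have ind: "MM.indep_vars (\<lambda>_. borel) Y ?I"
      using MM.indep_vars_subset[of "\<lambda>_. borel" Y UNIV ?I] by simp
    have mean: "has_bochner_integral MM (Y s) 0" for s
      using oracle_error_coord(1)[of "fst (snd s)" "x $ fst (snd s)" "fst s" "snd (snd s)"]
      by (simp add: Y_def[abs_def])
    have moment: "(\<integral>\<^sup>+w. ennreal (norm (Y s w) powr p) \<partial>MM) \<le> ennreal (\<sigma> powr p)" for s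
      using oracle_error_coord(2)[of "fst (snd s)" "x $ fst (snd s)" "fst s" "snd (snd s)"]
      by (simp add: Y_def)
    have "finite ?I" "?I \<noteq> {}" using b by auto
    from MM.heavy_tailed_sum_first_moment[OF this ind mean moment p \<sigma>]
    have "(\<integral>\<^sup>+w. ennreal (norm (\<Sum>s\<in>?I. Y s w)) \<partial>MM) \<le> ennreal (3 * \<sigma> * real (card ?I) powr (1 / p))" .
    moreover have "(\<Sum>s\<in>?I. Y s w) = (\<Sum>i\<in>UNIV. \<Sum>k<b. oracle_error i (x $ i) (w (t, i, k)))" for w
      unfolding sum.cartesian_product' Y_def by simp
    ultimately show ?thesis by (simp add: \<phi>_def card_cartesian_product)
  qed
  have "(\<integral>\<^sup>+w. ennreal (norm (\<Sum>i\<in>UNIV. noise t i w)) \<partial>MM)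
      = (\<integral>\<^sup>+w. ennreal (1 / real b) * \<phi> (X t w, restrict w ?B) \<partial>MM)"
    unfolding noise_eq scaleR_sum_right[symmetric] norm_scaleR \<phi>_def
    by (intro nn_integral_cong) (simp add: ennreal_mult[symmetric])
  also have "\<dots> = ennreal (1 / real b) * (\<integral>\<^sup>+w. \<phi> (X t w, restrict w ?B) \<partial>MM)"
    by (rule nn_integral_cmult[OF fresh_samples_fubini(1)[OF \<phi>]])
  also have "\<dots> \<le> ennreal (1 / real b) * ennreal (3 * \<sigma> * (real CARD('n) * real b) powr (1 / p))"
  proof (rule mult_left_mono)
    have "(\<integral>\<^sup>+w. (\<integral>\<^sup>+w'. \<phi> (X t w, restrict w' ?B) \<partial>MM) \<partial>MM)
        \<le> (\<integral>\<^sup>+w. ennreal (3 * \<sigma> * (real CARD('n) * real b) powr (1 / p)) \<partial>MM)"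
      by (intro nn_integral_mono inner)
    then show "(\<integral>\<^sup>+w. \<phi> (X t w, restrict w ?B) \<partial>MM) \<le> ennreal (3 * \<sigma> * (real CARD('n) * real b) powr (1 / p))"
      unfolding fresh_samples_fubini(2)[OF \<phi>] by (simp add: MM.emeasure_space_1)
  qed simp
  also have "\<dots> = ennreal (1 / real b * (3 * \<sigma> * (real CARD('n) * real b) powr (1 / p)))"
    by (rule ennreal_mult[symmetric]) (use \<sigma> in simp_all)
  finally show ?thesis by simp
qed

text \<open>A bound for a single agent, without any gain from averaging. It is used only for terms that are multiplied by the tiny mixing
  error.\<close>
lemma noise_norm_bound:
  "(\<integral>\<^sup>+w. ennreal (norm (noise t i w)) \<partial>MM) \<le> ennreal (2 * \<sigma>)"
proof -
  let ?B = "{s :: nat \<times> 'n \<times> nat. fst s = t}"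
  define \<phi> where "\<phi> k z = ennreal (norm (oracle_error i (fst z $ i) (snd z (t, i, k))))"
    for k and z :: "(real^'d^'n) \<times> (nat \<times> 'n \<times> nat \<Rightarrow> 's)"
  have \<phi>: "\<phi> k \<in> borel_measurable (borel \<Otimes>\<^sub>M PiM ?B DD)" for k
    unfolding \<phi>_def[abs_def]
    by (intro measurable_compose[OF _ measurable_ennreal] measurable_compose[OF _ borel_measurable_norm] fresh_meas)
  have m: "(\<lambda>w. \<phi> k (X t w, restrict w ?B)) \<in> borel_measurable MM" for k
    by (rule fresh_samples_fubini(1)[OF \<phi>])
  have inner: "(\<integral>\<^sup>+w. \<phi> k (x, restrict w ?B) \<partial>MM) \<le> ennreal (2 * \<sigma>)" for x k
    using MM.first_moment_le[OF measurable_compose[OF coord_meas oracle_error_meas1] p \<sigma> oracle_error_coord(2),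
      of i "x $ i" t k]
    by (simp add: \<phi>_def)
  have k: "(\<integral>\<^sup>+w. \<phi> k (X t w, restrict w ?B) \<partial>MM) \<le> ennreal (2 * \<sigma>)" for k
    unfolding fresh_samples_fubini(2)[OF \<phi>]
  proof -
    have "(\<integral>\<^sup>+w. (\<integral>\<^sup>+w'. \<phi> k (X t w, restrict w' ?B) \<partial>MM) \<partial>MM) \<le> (\<integral>\<^sup>+w. ennreal (2 * \<sigma>) \<partial>MM)"
      by (intro nn_integral_mono inner)
    also have "\<dots> = ennreal (2 * \<sigma>)" by (simp add: MM.emeasure_space_1)
    finally show "(\<integral>\<^sup>+w. (\<integral>\<^sup>+w'. \<phi> k (X t w, restrict w' ?B) \<partial>MM) \<partial>MM) \<le> ennreal (2 * \<sigma>)" .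
  qed
  have "ennreal (norm (noise t i w)) \<le> ennreal (1 / real b) * (\<Sum>k<b. \<phi> k (X t w, restrict w ?B))" for w
  proof -
    have "norm (noise t i w) \<le> (1 / real b) * (\<Sum>k<b. norm (oracle_error i (X t w $ i) (w (t, i, k))))"
      unfolding noise_eq norm_scaleR by (intro mult_mono norm_sum) auto
    then have "ennreal (norm (noise t i w))
       \<le> ennreal ((1 / real b) * (\<Sum>k<b. norm (oracle_error i (X t w $ i) (w (t, i, k)))))" by (rule ennreal_leI)
    also have "\<dots> = ennreal (1 / real b) * ennreal (\<Sum>k<b. norm (oracle_error i (X t w $ i) (w (t, i, k))))"
      by (rule ennreal_mult) (simp_all add: sum_nonneg)
    also have "ennreal (\<Sum>k<b. norm (oracle_error i (X t w $ i) (w (t, i, k))))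
        = (\<Sum>k<b. \<phi> k (X t w, restrict w ?B))"
      unfolding \<phi>_def by (subst sum_ennreal) simp_all
    finally show ?thesis .
  qed
  then have "(\<integral>\<^sup>+w. ennreal (norm (noise t i w)) \<partial>MM)
      \<le> (\<integral>\<^sup>+w. ennreal (1 / real b) * (\<Sum>k<b. \<phi> k (X t w, restrict w ?B)) \<partial>MM)"
    by (intro nn_integral_mono)
  also have "\<dots> = ennreal (1 / real b) * (\<Sum>k<b. (\<integral>\<^sup>+w. \<phi> k (X t w, restrict w ?B) \<partial>MM))"
    using m by (simp add: nn_integral_cmult nn_integral_sum)
  also have "\<dots> \<le> ennreal (1 / real b) * (\<Sum>k<b. ennreal (2 * \<sigma>))"
    by (intro mult_left_mono sum_mono k) simp
  also have "\<dots> = ennreal (2 * \<sigma>)"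
  proof -
    have "(\<Sum>k<b. ennreal (2 * \<sigma>)) = ennreal (\<Sum>k<b. 2 * \<sigma>)" by (rule sum_ennreal) (use \<sigma> in simp)
    moreover have "ennreal (1 / real b) * ennreal (\<Sum>k<b. 2 * \<sigma>) = ennreal ((1 / real b) * (\<Sum>k<b. 2 * \<sigma>))"
      by (rule ennreal_mult[symmetric]) (use \<sigma> in simp_all)
    ultimately show ?thesis using b by simp
  qed
  finally show ?thesis .
qed

end

section \<open>Analysis of a single run\<close>

text \<open>An upper bound for the sum of the local gradient norms at any iterate before time \<open>T\<close>, as the iterates stay within
  \<open>\<eta> * T\<close> of the start; the noise is not included.\<close>
definition gradient_budget :: "('n::finite \<Rightarrow> 'a::euclidean_space \<Rightarrow> real) \<Rightarrow> 'a \<Rightarrow> real \<Rightarrow> real \<Rightarrow> nat \<Rightarrow> real" where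
  "gradient_budget fi x0 L \<eta> T = (\<Sum>i\<in>UNIV. norm (grad (fi i) x0)) + real CARD('n) * L * \<eta> * real T"

definition total_noise :: "(nat \<Rightarrow> 'n::finite \<Rightarrow> 'a::real_normed_vector) \<Rightarrow> nat \<Rightarrow> real" where
  "total_noise \<nu> T = (\<Sum>s<T. \<Sum>j\<in>UNIV. norm (\<nu> s j))"

context
  fixes \<pi> :: "'n::finite \<Rightarrow> real" and W :: "'n \<Rightarrow> 'n \<Rightarrow> real" and \<rho> :: real
  assumes pi_nonneg: "\<And>i. 0 \<le> \<pi> i" and pi_sum: "(\<Sum>i\<in>UNIV. \<pi> i) = 1"
    and W_left: "\<And>j. (\<Sum>i\<in>UNIV. \<pi> i * W i j) = \<pi> j" and W_row: "\<And>i. (\<Sum>j\<in>UNIV. W i j) = 1"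
    and W_dev: "\<And>i. (\<Sum>j\<in>UNIV. \<bar>W i j - \<pi> j\<bar>) \<le> \<rho>"
begin

lemma gossip_average:
  fixes y :: "'n \<Rightarrow> 'a::real_vector"
  shows "(\<Sum>i\<in>UNIV. \<pi> i *\<^sub>R (\<Sum>j\<in>UNIV. W i j *\<^sub>R y j)) = (\<Sum>j\<in>UNIV. \<pi> j *\<^sub>R y j)"
proof -
  have "(\<Sum>i\<in>UNIV. \<pi> i *\<^sub>R (\<Sum>j\<in>UNIV. W i j *\<^sub>R y j)) = (\<Sum>j\<in>UNIV. (\<Sum>i\<in>UNIV. \<pi> i * W i j) *\<^sub>R y j)"
    unfolding scaleR_sum_right scaleR_sum_left scaleR_scaleR by (rule sum.swap)
  then show ?thesis by (simp add: W_left)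
qed

text \<open>Both weight vectors sum to 1, so a common offset \<open>a\<close> cancels and only the spread of the rows around it is
  contracted.\<close>
lemma gossip_contracts:
  fixes y :: "'n \<Rightarrow> 'a::real_normed_vector"
  assumes "\<And>j. norm (y j - a) \<le> c"
  shows "norm ((\<Sum>j\<in>UNIV. W i j *\<^sub>R y j) - (\<Sum>j\<in>UNIV. \<pi> j *\<^sub>R y j)) \<le> \<rho> * c"
proof -
  have "0 \<le> c" using assms order_trans[OF norm_ge_zero] by blast
  have "(\<Sum>j\<in>UNIV. (W i j - \<pi> j) *\<^sub>R a) = 0"
    by (simp add: W_row pi_sum sum_subtractf flip: scaleR_sum_left)
  then have "(\<Sum>j\<in>UNIV. W i j *\<^sub>R y j) - (\<Sum>j\<in>UNIV. \<pi> j *\<^sub>R y j) = (\<Sum>j\<in>UNIV. (W i j - \<pi> j) *\<^sub>R (y j - a))"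
    by (simp add: scaleR_diff_right scaleR_diff_left sum_subtractf)
  also have "norm \<dots> \<le> (\<Sum>j\<in>UNIV. \<bar>W i j - \<pi> j\<bar> * c)"
    by (intro order_trans[OF norm_sum] sum_mono) (simp add: assms mult_left_mono)
  also have "\<dots> \<le> \<rho> * c"
    unfolding sum_distrib_right[symmetric] by (intro mult_right_mono W_dev \<open>0 \<le> c\<close>)
  finally show ?thesis .
qed

lemma weighted_norm_le:
  fixes y :: "'n \<Rightarrow> 'a::real_normed_vector"
  assumes "\<And>j. norm (y j) \<le> c"
  shows "norm (\<Sum>j\<in>UNIV. \<pi> j *\<^sub>R y j) \<le> c"
proof -
  have "norm (\<Sum>j\<in>UNIV. \<pi> j *\<^sub>R y j) \<le> (\<Sum>j\<in>UNIV. \<pi> j * c)"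
    by (intro order_trans[OF norm_sum] sum_mono) (simp add: assms mult_left_mono pi_nonneg)
  then show ?thesis by (simp add: pi_sum flip: sum_distrib_right)
qed

context
  fixes x v z :: "nat \<Rightarrow> 'n \<Rightarrow> 'a::euclidean_space" and x0 :: 'a and \<eta> :: real
  assumes rho: "\<rho> \<le> 1 / 2" and eta: "0 < \<eta>"
    and x_0: "\<And>i. x 0 i = x0"
    and x_Suc: "\<And>t i. x (Suc t) i = (\<Sum>j\<in>UNIV. W i j *\<^sub>R (x t j - \<eta> *\<^sub>R sgn (v t j)))"
    and v_0: "\<And>i. v 0 i = (\<Sum>j\<in>UNIV. W i j *\<^sub>R z 0 j)"
    and v_Suc: "\<And>t i. v (Suc t) i = (\<Sum>j\<in>UNIV. W i j *\<^sub>R (v t j + z (Suc t) j - z t j))"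
begin

definition xbar :: "nat \<Rightarrow> 'a" where "xbar t = (\<Sum>i\<in>UNIV. \<pi> i *\<^sub>R x t i)"
definition vbar :: "nat \<Rightarrow> 'a" where "vbar t = (\<Sum>i\<in>UNIV. \<pi> i *\<^sub>R v t i)"

lemma rho_nonneg: "0 \<le> \<rho>"
  by (rule order_trans[OF _ W_dev]) (simp add: sum_nonneg)

lemma xbar_0: "xbar 0 = x0"
  by (simp add: xbar_def x_0 pi_sum flip: scaleR_sum_left)

lemma xbar_Suc: "xbar (Suc t) = xbar t - \<eta> *\<^sub>R (\<Sum>i\<in>UNIV. \<pi> i *\<^sub>R sgn (v t i))"
  unfolding xbar_def x_Suc gossip_average
  by (simp add: scaleR_diff_right sum_subtractf scaleR_sum_right mult.commute)

text \<open>The tracking invariant: the increments telescope in the \<open>\<pi>\<close>-average, which \<open>W\<close> preserves.\<close>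
lemma vbar_eq: "vbar t = (\<Sum>i\<in>UNIV. \<pi> i *\<^sub>R z t i)"
proof (induction t)
  case 0
  show ?case unfolding vbar_def v_0 gossip_average ..
next
  case (Suc t)
  have "vbar (Suc t) = vbar t + (\<Sum>i\<in>UNIV. \<pi> i *\<^sub>R z (Suc t) i) - (\<Sum>i\<in>UNIV. \<pi> i *\<^sub>R z t i)"
    unfolding vbar_def v_Suc gossip_average by (simp add: scaleR_diff_right scaleR_add_right sum_subtractf sum.distrib)
  with Suc show ?case by simp
qed

lemma norm_xbar_step: "norm (xbar (Suc t) - xbar t) \<le> \<eta>"
proof -
  have "norm (\<Sum>i\<in>UNIV. \<pi> i *\<^sub>R sgn (v t i)) \<le> 1"
    by (rule weighted_norm_le) (simp add: norm_sgn)
  then show ?thesis using eta by (simp add: xbar_Suc)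
qed

lemma xbar_drift: "norm (xbar t - x0) \<le> \<eta> * real t"
proof (induction t)
  case (Suc t)
  have "norm (xbar (Suc t) - x0) \<le> norm (xbar (Suc t) - xbar t) + norm (xbar t - x0)"
    using norm_triangle_ineq[of "xbar (Suc t) - xbar t" "xbar t - x0"] by simp
  with Suc norm_xbar_step[of t] show ?case by (simp add: algebra_simps)
qed (simp add: xbar_0)

lemma x_consensus: "norm (x t i - xbar t) \<le> 2 * \<rho> * \<eta>"
proof (induction t arbitrary: i)
  case 0
  show ?case using rho_nonneg eta by (simp add: x_0 xbar_0)
next
  case (Suc t)
  have "norm (x t j - \<eta> *\<^sub>R sgn (v t j) - xbar t) \<le> 2 * \<eta>" for j
  proof -
    have "norm (x t j - \<eta> *\<^sub>R sgn (v t j) - xbar t) \<le> norm (x t j - xbar t) + norm (\<eta> *\<^sub>R sgn (v t j))"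
      using norm_triangle_ineq4[of "x t j - xbar t" "\<eta> *\<^sub>R sgn (v t j)"] by (simp add: algebra_simps)
    also have "\<dots> \<le> 2 * \<rho> * \<eta> + \<eta>" using Suc[of j] eta by (simp add: norm_sgn)
    also have "2 * \<rho> * \<eta> \<le> 1 * \<eta>" using rho eta by (intro mult_right_mono) auto
    finally show ?thesis by simp
  qed
  from gossip_contracts[of "\<lambda>j. x t j - \<eta> *\<^sub>R sgn (v t j)", OF this, of i]
  show ?case unfolding xbar_def[of "Suc t"] x_Suc gossip_average by simp
qed

text \<open>Past corrections are summed without decay. For the algorithm \<open>\<rho>\<close> is smaller than the inverse of
  any relevant polynomial, so geometric weights would gain nothing.\<close>
lemma v_consensus:
  assumes z: "\<And>s j. norm (z s j) \<le> q s"
  shows "norm (v t i - vbar t) \<le> 2 * \<rho> * (\<Sum>s\<le>t. q s)"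
proof (induction t arbitrary: i)
  have q0: "0 \<le> q s" for s using z order_trans[OF norm_ge_zero] by blast
  case 0
  have "norm (v 0 i - vbar 0) \<le> \<rho> * q 0"
    unfolding vbar_eq v_0 by (rule gossip_contracts[where a=0]) (simp add: z)
  also have "\<dots> \<le> 2 * \<rho> * q 0" using rho_nonneg q0[of 0] by simp
  finally show ?case by simp
next
  have q0: "0 \<le> q s" for s using z order_trans[OF norm_ge_zero] by blast
  case (Suc t)
  have "norm (v t j + z (Suc t) j - z t j - vbar t) \<le> 2 * (\<Sum>s\<le>Suc t. q s)" for j
  proof -
    have "v t j + z (Suc t) j - z t j - vbar t = (v t j - vbar t) + z (Suc t) j - z t j" by simp
    also have "norm \<dots> \<le> norm (v t j - vbar t) + norm (z (Suc t) j) + norm (z t j)"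
      by (intro order_trans[OF norm_triangle_ineq4] add_right_mono norm_triangle_ineq)
    also have "\<dots> \<le> 2 * \<rho> * (\<Sum>s\<le>t. q s) + q (Suc t) + q t"
      by (intro add_mono Suc z)
    also have "2 * \<rho> * (\<Sum>s\<le>t. q s) \<le> 1 * (\<Sum>s\<le>t. q s)"
      using rho q0 by (intro mult_right_mono sum_nonneg) auto
    also have "q t \<le> (\<Sum>s\<le>t. q s)" by (rule member_le_sum) (auto simp: q0)
    finally show ?thesis using q0[of "Suc t"] by simp
  qed
  from gossip_contracts[of "\<lambda>j. v t j + z (Suc t) j - z t j", OF this, of i]
  show ?case unfolding vbar_def[of "Suc t"] v_Suc gossip_average by (simp add: mult.assoc mult.left_commute)
qed

context
  fixes f :: "'a \<Rightarrow> real" and fi :: "'n \<Rightarrow> 'a \<Rightarrow> real" and L P \<theta> :: real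
    and d :: "nat \<Rightarrow> 'n \<Rightarrow> real" and \<nu> :: "nat \<Rightarrow> 'n \<Rightarrow> 'a" and T :: nat
  assumes smooth: "L_smooth L f" and smooth_i: "\<And>i. L_smooth L (fi i)" and L: "0 < L"
    and grad_f: "\<And>y. grad f y = (1 / real CARD('n)) *\<^sub>R (\<Sum>i\<in>UNIV. grad (fi i) y)"
    and z_eq: "\<And>t i. z t i = d t i *\<^sub>R (grad (fi i) (x t i) + \<nu> t i)"
    and d: "\<And>t i. 0 \<le> d t i" "\<And>t i. d t i \<le> P" and d_bias: "\<And>t i. \<bar>\<pi> i * d t i - 1\<bar> \<le> \<theta>"
begin

private abbreviation "budget \<equiv> gradient_budget fi x0 L \<eta> T"
private abbreviation "noise_total \<equiv> total_noise \<nu> T"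

lemma local_gradient_sum:
  assumes "t < T"
  shows "(\<Sum>j\<in>UNIV. norm (grad (fi j) (x t j) + \<nu> t j)) \<le> budget + (\<Sum>j\<in>UNIV. norm (\<nu> t j))"
proof -
  have "norm (grad (fi j) (x t j) + \<nu> t j) \<le> norm (grad (fi j) x0) + L * \<eta> * real T + norm (\<nu> t j)" for j
  proof -
    have "norm (x t j - x0) \<le> norm (x t j - xbar t) + norm (xbar t - x0)"
      using norm_triangle_ineq[of "x t j - xbar t" "xbar t - x0"] by simp
    also have "\<dots> \<le> 2 * \<rho> * \<eta> + \<eta> * real t" by (intro add_mono x_consensus xbar_drift)
    also have "2 * \<rho> * \<eta> \<le> 1 * \<eta>" using rho eta by (intro mult_right_mono) auto
    also have "1 * \<eta> + \<eta> * real t = \<eta> * (real t + 1)" by (simp add: algebra_simps)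
    also have "\<dots> \<le> \<eta> * real T" using assms eta by (intro mult_left_mono) auto
    finally have "norm (x t j - x0) \<le> \<eta> * real T" by simp
    then have "L * norm (x t j - x0) \<le> L * (\<eta> * real T)" using L by (intro mult_left_mono) auto
    then have "norm (grad (fi j) (x t j) - grad (fi j) x0) \<le> L * \<eta> * real T"
      using L_smoothD(2)[OF smooth_i, of j "x t j" x0] by simp
    moreover have "norm (grad (fi j) (x t j) + \<nu> t j)
      \<le> norm (grad (fi j) (x t j) - grad (fi j) x0) + norm (grad (fi j) x0) + norm (\<nu> t j)"
      using norm_triangle_ineq[of "grad (fi j) (x t j)" "\<nu> t j"]
        norm_triangle_ineq[of "grad (fi j) (x t j) - grad (fi j) x0" "grad (fi j) x0"] by simp
    ultimately show ?thesis by simp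
  qed
  then have "(\<Sum>j\<in>UNIV. norm (grad (fi j) (x t j) + \<nu> t j))
     \<le> (\<Sum>j\<in>UNIV. norm (grad (fi j) x0) + L * \<eta> * real T + norm (\<nu> t j))" by (rule sum_mono)
  then show ?thesis by (simp add: gradient_budget_def sum.distrib mult.assoc)
qed

lemma theta_P_nonneg: "0 \<le> \<theta>" "0 \<le> P" "0 \<le> budget" "0 \<le> noise_total"
proof -
  show "0 \<le> \<theta>" using d_bias[of undefined undefined] by simp
  show "0 \<le> P" using d[of undefined undefined] by simp
  show "0 \<le> budget" using L eta by (simp add: gradient_budget_def sum_nonneg)
  show "0 \<le> noise_total" by (simp add: total_noise_def sum_nonneg)
qed

lemma partial_noise_le: "t < T \<Longrightarrow> (\<Sum>s\<le>t. budget + (\<Sum>j\<in>UNIV. norm (\<nu> s j))) \<le> real T * budget + noise_total"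
proof -
  assume "t < T"
  have "(\<Sum>s\<le>t. budget + (\<Sum>j\<in>UNIV. norm (\<nu> s j))) \<le> (\<Sum>s<T. budget + (\<Sum>j\<in>UNIV. norm (\<nu> s j)))"
    using \<open>t < T\<close> theta_P_nonneg(3) by (intro sum_mono2) (auto intro!: add_nonneg_nonneg sum_nonneg)
  then show ?thesis by (simp add: sum.distrib total_noise_def)
qed

text \<open>The deviation of a tracker from \<open>n\<close> times the gradient splits into four parts: disagreement with the average tracker,
  bias of the diagonal correction, disagreement of the iterates at which gradients are taken, and noise. Only the last is not small with
  \<open>\<rho>\<close> and \<open>\<theta>\<close>.\<close>
lemma tracking_error:
  assumes "t < T"
  shows "norm ((1 / real CARD('n)) *\<^sub>R v t i - grad f (xbar t))
    \<le> norm (\<Sum>j\<in>UNIV. \<nu> t j) / real CARD('n) + 2 * L * \<rho> * \<eta> + (2 * \<rho> * P + \<theta>) * (real T * budget + noise_total)"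
proof -
  let ?n = "real CARD('n)" and ?g = "\<lambda>t j. grad (fi j) (x t j) + \<nu> t j"
  let ?C = "real T * budget + noise_total"
  define q where "q s = P * (\<Sum>j\<in>UNIV. norm (?g s j))" for s
  have "norm (z s j) \<le> q s" for s j
  proof -
    have "norm (z s j) = d s j * norm (?g s j)" using d by (simp add: z_eq)
    also have "\<dots> \<le> P * norm (?g s j)" by (intro mult_right_mono d) simp
    also have "\<dots> \<le> q s" unfolding q_def
      by (intro mult_left_mono theta_P_nonneg member_le_sum) auto
    finally show ?thesis .
  qed
  then have "norm (v t i - vbar t) \<le> 2 * \<rho> * (\<Sum>s\<le>t. q s)" by (rule v_consensus)
  also have "(\<Sum>s\<le>t. q s) \<le> (\<Sum>s\<le>t. P * (budget + (\<Sum>j\<in>UNIV. norm (\<nu> s j))))"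
    unfolding q_def using assms by (intro sum_mono mult_left_mono local_gradient_sum theta_P_nonneg) auto
  also have "\<dots> \<le> P * ?C"
    unfolding sum_distrib_left[symmetric] by (intro mult_left_mono partial_noise_le[OF assms] theta_P_nonneg)
  finally have h: "norm (v t i - vbar t) \<le> 2 * \<rho> * P * ?C"
    using rho_nonneg by (simp add: mult_left_mono mult.assoc)
  have bias: "norm (vbar t - (\<Sum>j\<in>UNIV. ?g t j)) \<le> \<theta> * ?C"
  proof -
    have "vbar t - (\<Sum>j\<in>UNIV. ?g t j) = (\<Sum>j\<in>UNIV. (\<pi> j * d t j - 1) *\<^sub>R ?g t j)"
      unfolding vbar_eq z_eq by (simp only: sum_subtractf[symmetric] scaleR_diff_left scaleR_scaleR scaleR_one)
    also have "norm \<dots> \<le> (\<Sum>j\<in>UNIV. \<theta> * norm (?g t j))"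
      by (intro order_trans[OF norm_sum] sum_mono) (simp add: d_bias mult_right_mono)
    also have "\<dots> \<le> \<theta> * (budget + (\<Sum>j\<in>UNIV. norm (\<nu> t j)))"
      unfolding sum_distrib_left[symmetric] by (intro mult_left_mono local_gradient_sum assms theta_P_nonneg)
    also have "\<dots> \<le> \<theta> * (\<Sum>s\<le>t. budget + (\<Sum>j\<in>UNIV. norm (\<nu> s j)))"
      using theta_P_nonneg
      by (intro mult_left_mono member_le_sum[of t "{..t}" "\<lambda>s. budget + (\<Sum>j\<in>UNIV. norm (\<nu> s j))"])
         (auto intro!: add_nonneg_nonneg sum_nonneg)
    also have "\<dots> \<le> \<theta> * ?C" by (intro mult_left_mono partial_noise_le[OF assms] theta_P_nonneg)
    finally show ?thesis .
  qed
  have drift: "norm ((\<Sum>j\<in>UNIV. grad (fi j) (x t j)) - (\<Sum>j\<in>UNIV. grad (fi j) (xbar t))) \<le> ?n * (2 * L * \<rho> * \<eta>)"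
  proof -
    have "norm (grad (fi j) (x t j) - grad (fi j) (xbar t)) \<le> 2 * L * \<rho> * \<eta>" for j
    proof -
      have "L * norm (x t j - xbar t) \<le> L * (2 * \<rho> * \<eta>)" using L by (intro mult_left_mono x_consensus) simp
      then show ?thesis using L_smoothD(2)[OF smooth_i, of j "x t j" "xbar t"] by simp
    qed
    then have "norm (\<Sum>j\<in>UNIV. grad (fi j) (x t j) - grad (fi j) (xbar t)) \<le> (\<Sum>j\<in>(UNIV::'n set). 2 * L * \<rho> * \<eta>)"
      by (intro order_trans[OF norm_sum] sum_mono)
    then show ?thesis by (simp add: sum_subtractf)
  qed
  \<comment> \<open>\<open>n * \<nabla>f\<close> is the plain sum of the local gradients, which is what the corrected average tracks.\<close>
  have "v t i - ?n *\<^sub>R grad f (xbar t) = (v t i - vbar t) + (vbar t - (\<Sum>j\<in>UNIV. ?g t j))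
      + ((\<Sum>j\<in>UNIV. grad (fi j) (x t j)) - (\<Sum>j\<in>UNIV. grad (fi j) (xbar t))) + (\<Sum>j\<in>UNIV. \<nu> t j)"
    by (simp add: grad_f sum.distrib)
  also have "norm \<dots> \<le> 2 * \<rho> * P * ?C + \<theta> * ?C + ?n * (2 * L * \<rho> * \<eta>) + norm (\<Sum>j\<in>UNIV. \<nu> t j)"
    by (intro norm_triangle_le add_mono h bias drift order_refl)
  finally have "norm (v t i - ?n *\<^sub>R grad f (xbar t)) \<le> (2 * \<rho> * P + \<theta>) * ?C + ?n * (2 * L * \<rho> * \<eta>) + norm (\<Sum>j\<in>UNIV. \<nu> t j)"
    by (simp add: algebra_simps)
  then have "norm (v t i - ?n *\<^sub>R grad f (xbar t)) / ?n
      \<le> ((2 * \<rho> * P + \<theta>) * ?C + ?n * (2 * L * \<rho> * \<eta>) + norm (\<Sum>j\<in>UNIV. \<nu> t j)) / ?n"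
    by (rule divide_right_mono) simp
  also have "\<dots> = ((2 * \<rho> * P + \<theta>) * ?C) / ?n + 2 * L * \<rho> * \<eta> + norm (\<Sum>j\<in>UNIV. \<nu> t j) / ?n"
    by (simp add: add_divide_distrib)
  also have "((2 * \<rho> * P + \<theta>) * ?C) / ?n \<le> ((2 * \<rho> * P + \<theta>) * ?C) / 1"
    using rho_nonneg theta_P_nonneg by (intro divide_left_mono) (auto simp: Suc_le_eq)
  finally have "norm (v t i - ?n *\<^sub>R grad f (xbar t)) / ?n
     \<le> norm (\<Sum>j\<in>UNIV. \<nu> t j) / ?n + 2 * L * \<rho> * \<eta> + (2 * \<rho> * P + \<theta>) * ?C" by simp
  moreover have "(1 / ?n) *\<^sub>R v t i - grad f (xbar t) = (1 / ?n) *\<^sub>R (v t i - ?n *\<^sub>R grad f (xbar t))"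
    by (simp add: scaleR_diff_right)
  ultimately show ?thesis by simp
qed

text \<open>The descent inequality at \<open>xbar t\<close>, with the step expanded into its unit directions. Each agent contributes with weight
  \<open>\<pi> i\<close> and the weights sum to 1, so the same error bound \<open>\<delta>\<close> survives averaging.\<close>
lemma descent_step:
  assumes \<delta>: "\<And>i. norm ((1 / real CARD('n)) *\<^sub>R v t i - grad f (xbar t)) \<le> \<delta>"
  shows "\<eta> * norm (grad f (xbar t)) \<le> f (xbar t) - f (xbar (Suc t)) + 2 * \<eta> * \<delta> + L * \<eta>\<^sup>2"
proof -
  let ?g = "grad f (xbar t)" and ?n = "real CARD('n)"
  \<comment> \<open>The sign of \<open>v\<close> is that of \<open>v / n\<close>, so the scale \<open>n\<close> of the tracker disappears.\<close>
  have "norm ?g - 2 * \<delta> \<le> sgn (v t i) \<bullet> ?g" for i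
    using sgn_alignment[of ?g "(1 / ?n) *\<^sub>R v t i"] \<delta>[of i] by (simp add: sgn_scaleR)
  then have "(\<Sum>i\<in>UNIV. \<pi> i * (norm ?g - 2 * \<delta>)) \<le> (\<Sum>i\<in>UNIV. \<pi> i * (sgn (v t i) \<bullet> ?g))"
    by (intro sum_mono mult_left_mono pi_nonneg)
  then have "norm ?g - 2 * \<delta> \<le> (\<Sum>i\<in>UNIV. \<pi> i *\<^sub>R sgn (v t i)) \<bullet> ?g"
    by (simp add: pi_sum inner_sum_left flip: sum_distrib_right)
  then have "\<eta> * (norm ?g - 2 * \<delta>) \<le> \<eta> * ((\<Sum>i\<in>UNIV. \<pi> i *\<^sub>R sgn (v t i)) \<bullet> ?g)"
    using eta by (intro mult_left_mono) auto
  then have 1: "(xbar (Suc t) - xbar t) \<bullet> ?g \<le> - \<eta> * (norm ?g - 2 * \<delta>)"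
    by (simp add: xbar_Suc)
  have "(norm (xbar (Suc t) - xbar t))\<^sup>2 \<le> \<eta>\<^sup>2" by (intro power_mono norm_xbar_step) simp
  then have 2: "L * (norm (xbar (Suc t) - xbar t))\<^sup>2 \<le> L * \<eta>\<^sup>2" using L by (intro mult_left_mono) auto
  from L_smooth_descent[OF smooth, of "xbar (Suc t)" "xbar t"] 1 2
  show ?thesis by (simp add: algebra_simps)
qed

text \<open>The conclusion is stated for the iterate of a single agent rather than the average, as the output is read off one agent.\<close>
lemma gradient_sum_bound:
  assumes low: "\<And>y. flow \<le> f y"
  shows "(\<Sum>t<T. norm (grad f (x t i))) \<le> (f x0 - flow) / \<eta> + real T * (L * \<eta> + 6 * L * \<rho> * \<eta>)
     + 2 / real CARD('n) * (\<Sum>t<T. norm (\<Sum>j\<in>UNIV. \<nu> t j))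
     + 2 * real T * (2 * \<rho> * P + \<theta>) * (real T * budget + noise_total)"
proof -
  let ?n = "real CARD('n)"
  define c where "c = 2 * L * \<rho> * \<eta> + (2 * \<rho> * P + \<theta>) * (real T * budget + noise_total)"
  define m where "m t = norm (\<Sum>j\<in>UNIV. \<nu> t j) / ?n" for t
  have step: "norm (grad f (xbar t)) \<le> (f (xbar t) - f (xbar (Suc t))) / \<eta> + 2 * (m t + c) + L * \<eta>" if "t < T" for t
  proof -
    have "\<eta> * norm (grad f (xbar t)) \<le> f (xbar t) - f (xbar (Suc t)) + 2 * \<eta> * (m t + c) + L * \<eta>\<^sup>2"
      using tracking_error[OF that] by (intro descent_step) (simp add: m_def c_def add.assoc)
    then have "(\<eta> * norm (grad f (xbar t))) / \<eta> \<le> (f (xbar t) - f (xbar (Suc t)) + 2 * \<eta> * (m t + c) + L * \<eta>\<^sup>2) / \<eta>"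
      using eta by (intro divide_right_mono) auto
    then show ?thesis using eta by (simp add: add_divide_distrib power2_eq_square)
  qed
  have xi: "norm (grad f (x t i)) \<le> norm (grad f (xbar t)) + 2 * L * \<rho> * \<eta>" for t
  proof -
    have "L * norm (x t i - xbar t) \<le> L * (2 * \<rho> * \<eta>)" using L by (intro mult_left_mono x_consensus) simp
    then have "norm (grad f (x t i) - grad f (xbar t)) \<le> 2 * L * \<rho> * \<eta>"
      using L_smoothD(2)[OF smooth, of "x t i" "xbar t"] by simp
    then show ?thesis using norm_triangle_ineq2[of "grad f (x t i)" "grad f (xbar t)"] by linarith
  qed
  have "(\<Sum>t<T. norm (grad f (x t i)))
     \<le> (\<Sum>t<T. (f (xbar t) - f (xbar (Suc t))) / \<eta> + (2 * m t + (2 * c + L * \<eta> + 2 * L * \<rho> * \<eta>)))"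
  proof (rule sum_mono)
    fix t assume "t \<in> {..<T}"
    then show "norm (grad f (x t i)) \<le> (f (xbar t) - f (xbar (Suc t))) / \<eta> + (2 * m t + (2 * c + L * \<eta> + 2 * L * \<rho> * \<eta>))"
      using step[of t] xi[of t] by (simp add: algebra_simps)
  qed
  also have "\<dots> = (f (xbar 0) - f (xbar T)) / \<eta> + (2 * (\<Sum>t<T. m t) + real T * (2 * c + L * \<eta> + 2 * L * \<rho> * \<eta>))"
    unfolding sum.distrib sum_divide_distrib[symmetric] sum_distrib_left[symmetric]
      sum_lessThan_telescope'[of "\<lambda>t. f (xbar t)"] by (simp add: algebra_simps)
  also have "(f (xbar 0) - f (xbar T)) / \<eta> \<le> (f x0 - flow) / \<eta>"
    using eta low[of "xbar T"] by (intro divide_right_mono) (auto simp: xbar_0)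
  also have "(f x0 - flow) / \<eta> + (2 * (\<Sum>t<T. m t) + real T * (2 * c + L * \<eta> + 2 * L * \<rho> * \<eta>))
     = (f x0 - flow) / \<eta> + real T * (L * \<eta> + 6 * L * \<rho> * \<eta>)
     + 2 / ?n * (\<Sum>t<T. norm (\<Sum>j\<in>UNIV. \<nu> t j))
     + 2 * real T * (2 * \<rho> * P + \<theta>) * (real T * budget + noise_total)"
    unfolding m_def c_def sum_divide_distrib[symmetric] by (simp add: algebra_simps)
  finally show ?thesis by simp
qed

end
end
end

section \<open>Expected gradient norm of DNSGD-PD\<close>

lemma pull_diag_inv_row:
  assumes "\<And>i. mat_pow A ((t + 1) * K) $ i $ i \<noteq> 0"
  shows "(matrix_inv (pull_diag A K t) ** (G :: real^'d^'n::finite)) $ i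
    = (1 / mat_pow A ((t + 1) * K) $ i $ i) *\<^sub>R G $ i"
proof -
  define v where "v i = mat_pow A ((t + 1) * K) $ i $ i" for i
  define D where "D = pull_diag A K t"
  define D' :: "real^'n^'n" where "D' = (\<chi> i j. if i = j then 1 / v i else 0)"
  have D: "D = (\<chi> i j. if i = j then v i else 0)"
    by (simp add: D_def pull_diag_def diag_part_def diag_mat_def v_def vec_eq_iff)
  have v: "v i \<noteq> 0" for i using assms by (simp add: v_def)
  have delta: "(\<Sum>k\<in>UNIV. (if i = k then a else 0) * (if k = j then c k else 0)) = (if i = j then a * c j else (0::real))"
    for i j :: 'n and a c
  proof -
    have "(\<Sum>k\<in>UNIV. (if i = k then a else 0) * (if k = j then c k else 0))
        = (\<Sum>k\<in>UNIV. if k = i then (if i = j then a * c j else 0) else 0)"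
      by (intro sum.cong) auto
    then show ?thesis by simp
  qed
  have inv: "D ** D' = mat 1" "D' ** D = mat 1"
    using v by (simp_all add: D D'_def vec_eq_iff matrix_matrix_mult_def mat_def delta)
  have "D ** matrix_inv D = mat 1 \<and> matrix_inv D ** D = mat 1"
    unfolding matrix_inv_def using inv by (rule_tac someI[of _ D']) simp
  then have "matrix_inv D = D'"
    using inv by (metis matrix_mul_assoc matrix_mul_lid matrix_mul_rid)
  then have "(matrix_inv (pull_diag A K t) ** G) $ i = (1 / v i) *\<^sub>R G $ i"
    unfolding D_def[symmetric] matrix_mult_row
    by (simp add: D'_def if_distrib[of "\<lambda>c. c *\<^sub>R _"] cong: if_cong)
  then show ?thesis by (simp add: v_def)
qed

text \<open>This instantiates the abstract gossip recursion: \<open>W\<close> is the power \<open>A\<^sup>K\<close> and \<open>z\<close> the gradient corrected by the inverse diagonal.\<close>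
lemma dnsgd_pd_gradient_sum_bound:
  fixes F :: "'n::finite \<Rightarrow> real^'d::finite \<Rightarrow> 's \<Rightarrow> real" and A :: "real^'n^'n"
  assumes net: "strongly_connected_graph E" "mixing_matrix E A" "perron_vector A \<pi>"
    and smooth: "\<And>i. L_smooth L (local_obj \<D> F i)" and L: "0 < L" and eta: "0 < \<eta>"
    and rho: "\<rho> \<le> 1 / 2" and dev: "\<And>i. (\<Sum>j\<in>UNIV. \<bar>mat_pow A K $ i $ j - \<pi> $ j\<bar>) \<le> \<rho>"
    and D_pos: "\<And>t i. 0 < mat_pow A ((t + 1) * K) $ i $ i"
    and D_inv: "\<And>t i. 1 / mat_pow A ((t + 1) * K) $ i $ i \<le> P"
    and D_bias: "\<And>t i. \<bar>\<pi> $ i * (1 / mat_pow A ((t + 1) * K) $ i $ i) - 1\<bar> \<le> \<theta>"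
    and low: "\<And>y. flow \<le> global_obj \<D> F y"
  shows "(\<Sum>t<T. norm (grad (global_obj \<D> F) (fst (dnsgd_pd A F x0 \<eta> K K b w t) $ i)))
    \<le> (global_obj \<D> F x0 - flow) / \<eta> + real T * (L * \<eta> + 6 * L * \<rho> * \<eta>)
     + 2 / real CARD('n) * (\<Sum>t<T. norm (\<Sum>j\<in>UNIV. minibatch_error \<D> F A x0 \<eta> K K b t j w))
     + 2 * real T * (2 * \<rho> * P + \<theta>) *
       (real T * ((\<Sum>j\<in>UNIV. norm (grad (local_obj \<D> F j) x0)) + real CARD('n) * L * \<eta> * real T)
        + (\<Sum>t<T. \<Sum>j\<in>UNIV. norm (minibatch_error \<D> F A x0 \<eta> K K b t j w)))"
proof -
  define X where "X t = fst (dnsgd_pd A F x0 \<eta> K K b w t)" for t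
  define V where "V t = snd (dnsgd_pd A F x0 \<eta> K K b w t)" for t
  define d where "d t i = 1 / mat_pow A ((t + 1) * K) $ i $ i" for t i
  define z where "z t i = d t i *\<^sub>R (minibatch F b w t (X t) $ i)" for t i
  have row: "(matrix_inv (pull_diag A K t) ** G) $ i = d t i *\<^sub>R G $ i" for t i and G :: "real^'d^'n"
    unfolding d_def using D_pos by (intro pull_diag_inv_row) (metis less_irrefl)
  note gr = grad_global_obj[OF smooth]
  have "(\<Sum>t<T. norm (grad (global_obj \<D> F) (X t $ i)))
    \<le> (global_obj \<D> F x0 - flow) / \<eta> + real T * (L * \<eta> + 6 * L * \<rho> * \<eta>)
     + 2 / real CARD('n) * (\<Sum>t<T. norm (\<Sum>j\<in>UNIV. minibatch_error \<D> F A x0 \<eta> K K b t j w))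
     + 2 * real T * (2 * \<rho> * P + \<theta>) *
       (real T * gradient_budget (local_obj \<D> F) x0 L \<eta> T + total_noise (\<lambda>t j. minibatch_error \<D> F A x0 \<eta> K K b t j w) T)"
  proof (rule gradient_sum_bound[where \<pi> = "\<lambda>i. \<pi> $ i" and W = "\<lambda>i j. mat_pow A K $ i $ j" and \<rho> = \<rho>
      and x = "\<lambda>t i. X t $ i" and v = "\<lambda>t i. V t $ i" and z = z and d = d and P = P and \<theta> = \<theta>
      and fi = "local_obj \<D> F"])
    show "0 \<le> \<pi> $ i" for i using perron_pos[OF net] less_imp_le by blast
    show "(\<Sum>i\<in>UNIV. \<pi> $ i) = 1" by (rule perron_sum[OF net])
    show "(\<Sum>i\<in>UNIV. \<pi> $ i * mat_pow A K $ i $ j) = \<pi> $ j" for j by (rule mat_pow_avg[OF net])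
    show "(\<Sum>j\<in>UNIV. mat_pow A K $ i $ j) = 1" for i by (rule mat_pow_row_sum[OF net])
    show "X 0 $ i = x0" for i by (simp add: X_def Let_def)
    show "X (Suc t) $ i = (\<Sum>j\<in>UNIV. mat_pow A K $ i $ j *\<^sub>R (X t $ j - \<eta> *\<^sub>R sgn (V t $ j)))" for t i
      unfolding X_def V_def dnsgd_pd_Suc_fst matrix_mult_row by (simp add: normalize_rows_def)
    show "V 0 $ i = (\<Sum>j\<in>UNIV. mat_pow A K $ i $ j *\<^sub>R z 0 j)" for i
      unfolding V_def z_def X_def by (simp add: Let_def matrix_mult_row[of "mat_pow A K"] row)
    show "V (Suc t) $ i = (\<Sum>j\<in>UNIV. mat_pow A K $ i $ j *\<^sub>R (V t $ j + z (Suc t) j - z t j))" for t i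
      unfolding V_def z_def X_def dnsgd_pd_Suc_snd matrix_mult_row[of "mat_pow A K"]
        vector_minus_component vector_add_component row ..
    show "z t i = d t i *\<^sub>R (grad (local_obj \<D> F i) (X t $ i) + minibatch_error \<D> F A x0 \<eta> K K b t i w)" for t i
      by (simp add: z_def minibatch_error_def Let_def X_def)
    show "0 \<le> d t i" "d t i \<le> P" "\<bar>\<pi> $ i * d t i - 1\<bar> \<le> \<theta>" for t i
      using D_pos[of t i] D_inv D_bias by (auto simp: d_def)
  qed (use rho eta L dev low gr smooth in auto)
  then show ?thesis unfolding X_def gradient_budget_def total_noise_def .
qed

lemma dnsgd_pd_expected_gradient_sum:
  fixes F :: "'n::finite \<Rightarrow> real^'d::finite \<Rightarrow> 's \<Rightarrow> real" and A :: "real^'n^'n"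
  assumes sp: "stochastic_problem \<D> F"
    and smooth: "\<And>i. L_smooth L (local_obj \<D> F i)"
    and p: "1 < p" "p \<le> 2" and \<sigma>: "0 < \<sigma>" and orc: "oracle_condition \<D> F p \<sigma>" and b: "0 < b"
    and path: "\<And>w. (\<Sum>t<T. h t w) \<le> a + c1 * (\<Sum>t<T. norm (\<Sum>j\<in>UNIV. minibatch_error \<D> F A x0 \<eta> K K b t j w))
        + c2 * (\<Sum>t<T. \<Sum>j\<in>UNIV. norm (minibatch_error \<D> F A x0 \<eta> K K b t j w))"
    and nonneg: "0 \<le> a" "0 \<le> c1" "0 \<le> c2" "\<And>t w. 0 \<le> h t w"
  shows "(\<integral>\<^sup>+w. (\<Sum>t<T. ennreal (h t w)) \<partial>sample_paths \<D>)
    \<le> ennreal (a + c1 * (real T * (3 * \<sigma> * (real CARD('n) * real b) powr (1 / p) / real b))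
        + c2 * (real T * (real CARD('n) * (2 * \<sigma>))))"
proof -
  note ctx = sp smooth p \<sigma> orc b
  interpret prob_space "sample_paths \<D>" by (rule prob_space_sample_paths[OF ctx])
  let ?\<nu> = "minibatch_error \<D> F A x0 \<eta> K K b" and ?n = "real CARD('n)"
  let ?m = "3 * \<sigma> * (?n * real b) powr (1 / p) / real b"
  have [measurable]: "?\<nu> t j \<in> borel_measurable (sample_paths \<D>)" for t j
    by (rule borel_measurable_noise[OF ctx])
  have "(\<integral>\<^sup>+w. (\<Sum>t<T. ennreal (h t w)) \<partial>sample_paths \<D>)
     \<le> (\<integral>\<^sup>+w. ennreal a + ennreal c1 * (\<Sum>t<T. ennreal (norm (\<Sum>j\<in>UNIV. ?\<nu> t j w)))
        + ennreal c2 * (\<Sum>t<T. \<Sum>j\<in>UNIV. ennreal (norm (?\<nu> t j w))) \<partial>sample_paths \<D>)"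
  proof (rule nn_integral_mono)
    fix w
    have "(\<Sum>t<T. ennreal (h t w)) = ennreal (\<Sum>t<T. h t w)" using nonneg by (intro sum_ennreal) auto
    also have "\<dots> \<le> ennreal (a + c1 * (\<Sum>t<T. norm (\<Sum>j\<in>UNIV. ?\<nu> t j w)) + c2 * (\<Sum>t<T. \<Sum>j\<in>UNIV. norm (?\<nu> t j w)))"
      by (rule ennreal_leI[OF path])
    also have "\<dots> = ennreal a + ennreal c1 * (\<Sum>t<T. ennreal (norm (\<Sum>j\<in>UNIV. ?\<nu> t j w)))
        + ennreal c2 * (\<Sum>t<T. \<Sum>j\<in>UNIV. ennreal (norm (?\<nu> t j w)))"
      using nonneg by (simp add: sum_ennreal sum_nonneg ennreal_plus ennreal_mult)
    finally show "(\<Sum>t<T. ennreal (h t w)) \<le> \<dots>" .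
  qed
  also have "\<dots> = ennreal a + ennreal c1 * (\<Sum>t<T. \<integral>\<^sup>+w. ennreal (norm (\<Sum>j\<in>UNIV. ?\<nu> t j w)) \<partial>sample_paths \<D>)
        + ennreal c2 * (\<Sum>t<T. \<Sum>j\<in>UNIV. \<integral>\<^sup>+w. ennreal (norm (?\<nu> t j w)) \<partial>sample_paths \<D>)"
    by (simp add: nn_integral_add nn_integral_cmult nn_integral_sum emeasure_space_1 del: sum_ennreal)
  also have "\<dots> \<le> ennreal a + ennreal c1 * (\<Sum>t<T. ennreal ?m) + ennreal c2 * (\<Sum>t<T. \<Sum>j\<in>(UNIV::'n set). ennreal (2 * \<sigma>))"
    by (intro add_mono mult_left_mono sum_mono order_refl noise_average_bound[OF ctx] noise_norm_bound[OF ctx]) auto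
  also have "\<dots> = ennreal a + ennreal c1 * ennreal (\<Sum>t<T. ?m) + ennreal c2 * ennreal (\<Sum>t<T. \<Sum>j\<in>(UNIV::'n set). 2 * \<sigma>)"
    using \<sigma> by (simp only: sum_ennreal sum_nonneg mult_nonneg_nonneg divide_nonneg_nonneg powr_ge_zero of_nat_0_le_iff
        less_imp_le zero_le_numeral)
  also have "\<dots> = ennreal (a + c1 * (\<Sum>t<T. ?m) + c2 * (\<Sum>t<T. \<Sum>j\<in>(UNIV::'n set). 2 * \<sigma>))"
  proof -
    have "ennreal a + ennreal c1 * ennreal m + ennreal c2 * ennreal k = ennreal (a + c1 * m + c2 * k)"
      if "0 \<le> m" "0 \<le> k" for m k
      using nonneg that by (simp add: ennreal_plus ennreal_mult)
    then show ?thesis using \<sigma> by (simp del: sum_constant add: sum_nonneg)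
  qed
  finally show ?thesis by simp
qed

text \<open>The uniform output index turns the expectation into the time average of the iterates.\<close>
lemma uniform_index_expectation:
  assumes "prob_space M" and "0 < T"
    and meas: "\<And>t. h t \<in> borel_measurable M" and nonneg: "\<And>t w. 0 \<le> h t w" and "0 \<le> e"
    and bound: "(\<integral>\<^sup>+w. (\<Sum>t<T. ennreal (h t w)) \<partial>M) \<le> ennreal (real T * e)"
  shows "integrable (M \<Otimes>\<^sub>M measure_pmf (pmf_of_set {..<T})) (\<lambda>(w, t). h t w)"
    and "(\<integral>(w, t). h t w \<partial>(M \<Otimes>\<^sub>M measure_pmf (pmf_of_set {..<T}))) \<le> e"
proof -
  let ?U = "measure_pmf (pmf_of_set {..<T})" and ?h = "\<lambda>(w, t). h t w"
  \<comment> \<open>The index space is discrete, so measurability in \<open>w\<close> for each fixed \<open>t\<close> suffices.\<close>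
  have "(\<lambda>(t, w). h t w) \<in> borel_measurable (count_space UNIV \<Otimes>\<^sub>M M)"
    by (rule measurable_pair_measure_countable1) (simp_all add: meas)
  from measurable_compose[OF measurable_pair_swap' this]
  have "(\<lambda>(w, t). h t w) \<in> borel_measurable (M \<Otimes>\<^sub>M count_space UNIV)"
    by (simp add: case_prod_beta')
  moreover have "sets (M \<Otimes>\<^sub>M ?U) = sets (M \<Otimes>\<^sub>M count_space UNIV)"
    by (rule sets_pair_measure_cong) simp_all
  ultimately have m: "?h \<in> borel_measurable (M \<Otimes>\<^sub>M ?U)"
    by (simp cong: measurable_cong_sets)
  have "(\<integral>\<^sup>+z. ennreal (?h z) \<partial>(M \<Otimes>\<^sub>M ?U)) = (\<integral>\<^sup>+w. \<integral>\<^sup>+t. ennreal (?h (w, t)) \<partial>?U \<partial>M)"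
    using m by (subst measure_pmf.nn_integral_fst[symmetric]) auto
  also have "\<dots> = (\<integral>\<^sup>+w. (\<Sum>t<T. ennreal (h t w)) * inverse (ennreal (real T)) \<partial>M)"
    using \<open>0 < T\<close> by (intro nn_integral_cong) (simp add: nn_integral_pmf_of_set divide_ennreal_def lessThan_empty_iff
       ennreal_of_nat_eq_real_of_nat)
  also have "\<dots> = (\<integral>\<^sup>+w. (\<Sum>t<T. ennreal (h t w)) \<partial>M) * inverse (ennreal (real T))"
    using meas by (intro nn_integral_multc) auto
  also have "\<dots> \<le> ennreal (real T * e) * inverse (ennreal (real T))"
    by (intro mult_right_mono bound) simp
  also have "\<dots> = ennreal e"
    using \<open>0 < T\<close> \<open>0 \<le> e\<close> by (simp add: inverse_ennreal ennreal_mult[symmetric])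
  finally have le: "(\<integral>\<^sup>+z. ennreal (?h z) \<partial>(M \<Otimes>\<^sub>M ?U)) \<le> ennreal e" .
  show "integrable (M \<Otimes>\<^sub>M ?U) ?h"
    using m le nonneg by (intro integrableI_nonneg) (auto intro: le_less_trans)
  show "(\<integral>z. ?h z \<partial>(M \<Otimes>\<^sub>M ?U)) \<le> e"
    by (rule integral_real_bounded[OF \<open>0 \<le> e\<close> le])
qed

lemma round_up_pos_ge: "x \<le> real (round_up_pos x)"
  and round_up_pos_pos: "0 < round_up_pos x"
  and round_up_pos_le: "0 \<le> x \<Longrightarrow> real (round_up_pos x) \<le> x + 1"
proof -
  show "x \<le> real (round_up_pos x)" unfolding round_up_pos_def by linarith
  show "0 < round_up_pos x" by (simp add: round_up_pos_def)
  show "0 \<le> x \<Longrightarrow> real (round_up_pos x) \<le> x + 1" unfolding round_up_pos_def by (simp add: max_def)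
qed

text \<open>From \<open>\<beta> \<le> exp (\<beta> - 1)\<close>: about \<open>1 / (1 - \<beta>)\<close> rounds gain a constant factor.\<close>
lemma gossip_power_bound:
  fixes \<beta> S :: real
  assumes "0 \<le> \<beta>" "\<beta> < 1" "1 < S" and K: "real c * ln S * (1 / (1 - \<beta>)) \<le> real K"
  shows "\<beta> ^ K \<le> 1 / S ^ c"
proof -
  have "\<beta> ^ K \<le> exp (\<beta> - 1) ^ K"
    using assms exp_ge_add_one_self[of "\<beta> - 1"] by (intro power_mono) auto
  also have "\<dots> = exp (- ((1 - \<beta>) * real K))" by (simp add: exp_of_nat_mult[symmetric] algebra_simps)
  also have "\<dots> \<le> exp (- (real c * ln S))"
    using K \<open>\<beta> < 1\<close> by (simp add: field_simps)
  also have "\<dots> = 1 / S ^ c"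
    using \<open>1 < S\<close> by (simp add: exp_minus exp_of_nat_mult inverse_eq_divide)
  finally show ?thesis .
qed

text \<open>Here \<open>1 / p - 1 = - (p - 1) / p\<close> is minus the inverse of the exponent in the
  batch size, so the constant \<open>100 powr (p / (p - 1))\<close> there becomes the factor \<open>1 / 100\<close> in the noise level for every \<open>p\<close>.\<close>
lemma minibatch_noise_level:
  fixes N B p \<sigma> \<epsilon> :: real
  assumes p: "1 < p" and \<sigma>: "0 < \<sigma>" and \<epsilon>: "0 < \<epsilon>" and N: "0 < N"
    and b: "100 powr (p / (p - 1)) * (1 / N * \<sigma> powr (p / (p - 1)) * \<epsilon> powr (- (p / (p - 1)))) \<le> B"
  shows "\<sigma> * (N * B) powr (1 / p) / (N * B) \<le> \<epsilon> / 100"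
proof -
  define q where "q = p / (p - 1)"
  note b = b[folded q_def]
  have "(100 * \<sigma> / \<epsilon>) powr q = 100 powr q * \<sigma> powr q * \<epsilon> powr (- q)"
    using \<sigma> \<epsilon> by (simp add: powr_mult powr_divide powr_minus_divide)
  also have "\<dots> = N * (100 powr q * (1 / N * \<sigma> powr q * \<epsilon> powr (- q)))"
    using N by simp
  also have "\<dots> \<le> N * B" using N b by (intro mult_left_mono) auto
  finally have le: "(100 * \<sigma> / \<epsilon>) powr q \<le> N * B" .
  have pos: "0 < (100 * \<sigma> / \<epsilon>) powr q" using \<sigma> \<epsilon> by simp
  have "(N * B) powr (1 / p) / (N * B) = (N * B) powr (1 / p - 1)"
    using less_le_trans[OF pos le] by (simp only: powr_diff powr_one less_imp_le)
  also have "\<dots> \<le> ((100 * \<sigma> / \<epsilon>) powr q) powr (1 / p - 1)"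
    using le pos p by (intro powr_mono2') auto
  also have "\<dots> = (100 * \<sigma> / \<epsilon>) powr (- 1)"
  proof -
    have "q * (1 / p - 1) = - 1" using p by (simp add: q_def field_simps)
    then show ?thesis by (simp only: powr_powr)
  qed
  also have "\<dots> = \<epsilon> / (100 * \<sigma>)" using \<sigma> \<epsilon> by (simp add: powr_minus_divide)
  finally have "\<sigma> * ((N * B) powr (1 / p) / (N * B)) \<le> \<sigma> * (\<epsilon> / (100 * \<sigma>))"
    using \<sigma> by (intro mult_left_mono) auto
  then show ?thesis using \<sigma> by simp
qed

section \<open>Parameter choice and complexity\<close>

text \<open>The exponents count the powers of \<open>S\<close> lost from \<open>30\<close>: one for the square root of \<open>\<kappa>\<close>, one more for summing a
  row, and three for dividing by a diagonal entry, which is at least half of \<open>\<pi> i \<ge> 1 / S\<^sup>2\<close>.\<close>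
lemma gossip_accuracy:
  fixes A :: "real^'n::finite^'n"
  assumes net: "strongly_connected_graph E" "mixing_matrix E A" "perron_vector A \<pi>"
    and S: "5 \<le> S" "real CARD('n) \<le> S" "net_kappa \<pi> \<le> S"
    and K: "0 < K" "net_beta A \<pi> ^ K \<le> 1 / S ^ 30"
  shows "(\<Sum>j\<in>UNIV. \<bar>mat_pow A K $ i $ j - \<pi> $ j\<bar>) \<le> 1 / S ^ 28"
    and "0 < mat_pow A ((t + 1) * K) $ i $ i"
    and "1 / mat_pow A ((t + 1) * K) $ i $ i \<le> 2 * S\<^sup>2"
    and "\<bar>\<pi> $ i * (1 / mat_pow A ((t + 1) * K) $ i $ i) - 1\<bar> \<le> 1 / S ^ 26"
proof -
  have S0: "0 < S" using S by simp
  have entry: "\<bar>mat_pow A m $ i $ j - \<pi> $ j\<bar> \<le> 1 / S ^ 29" if "K \<le> m" for m i j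
  proof -
    have "sqrt (\<pi> $ j / \<pi> $ i) \<le> sqrt (net_kappa \<pi>)" by (intro real_sqrt_le_mono perron_ratio[OF net])
    also have "\<dots> \<le> net_kappa \<pi>"
    proof (rule real_le_lsqrt)
      have "1 * net_kappa \<pi> \<le> net_kappa \<pi> * net_kappa \<pi>"
        using net_kappa_ge_1[OF net] by (intro mult_right_mono) auto
      then show "net_kappa \<pi> \<le> (net_kappa \<pi>)\<^sup>2" by (simp add: power2_eq_square)
    qed (use net_kappa_ge_1[OF net] in auto)
    finally have sq: "sqrt (\<pi> $ j / \<pi> $ i) \<le> S" using S(3) by simp
    have "net_beta A \<pi> ^ m \<le> net_beta A \<pi> ^ K"
      using net_beta_nonneg[OF net] net_beta_less_1[OF net] that by (intro power_decreasing) auto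
    then have "net_beta A \<pi> ^ m \<le> 1 / S ^ 30" using K by simp
    then have "sqrt (\<pi> $ j / \<pi> $ i) * net_beta A \<pi> ^ m \<le> S * (1 / S ^ 30)"
      using sq S0 net_beta_nonneg[OF net] by (intro mult_mono) auto
    also have "\<dots> = 1 / S ^ 29" using S0 by (simp add: power_Suc[of S 29, simplified])
    finally show ?thesis using mat_pow_entry_bound[OF net, of m i j] K that by simp
  qed
  have "(\<Sum>j\<in>UNIV. \<bar>mat_pow A K $ i $ j - \<pi> $ j\<bar>) \<le> (\<Sum>j\<in>(UNIV::'n set). 1 / S ^ 29)"
    by (intro sum_mono entry) simp
  also have "\<dots> \<le> S * (1 / S ^ 29)" using S(2) S0 by (simp add: divide_right_mono)
  also have "\<dots> = 1 / S ^ 28" using S0 by (simp add: power_Suc[of S 28, simplified])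
  finally show "(\<Sum>j\<in>UNIV. \<bar>mat_pow A K $ i $ j - \<pi> $ j\<bar>) \<le> 1 / S ^ 28" .
  define D where "D = mat_pow A ((t + 1) * K) $ i $ i"
  have dev: "\<bar>D - \<pi> $ i\<bar> \<le> 1 / S ^ 29" unfolding D_def by (rule entry) simp
  have pi: "1 / S\<^sup>2 \<le> \<pi> $ i"
  proof -
    have "1 / \<pi> $ i \<le> real CARD('n) * net_kappa \<pi>" by (rule perron_lower[OF net])
    also have "\<dots> \<le> S * S" using S net_kappa_ge_1[OF net] S0 by (intro mult_mono) auto
    finally show ?thesis using perron_pos[OF net, of i] S0 by (simp add: field_simps power2_eq_square)
  qed
  have small: "1 / S ^ 29 \<le> 1 / (2 * S\<^sup>2)"
  proof -
    have "2 * S\<^sup>2 \<le> S ^ 27 * S\<^sup>2"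
      using order_trans[OF S(1) self_le_power[of S 27]] S by (intro mult_right_mono) auto
    then show ?thesis using S0 by (intro divide_left_mono) (auto simp flip: power_add)
  qed
  have half: "1 / (2 * S\<^sup>2) \<le> D"
  proof -
    have "1 / S\<^sup>2 = 1 / (2 * S\<^sup>2) + 1 / (2 * S\<^sup>2)" by simp
    then show ?thesis using dev pi small by linarith
  qed
  have D0: "0 < D" by (rule less_le_trans[OF _ half]) (use S0 in simp)
  then show "0 < mat_pow A ((t + 1) * K) $ i $ i" by (simp add: D_def)
  have inv: "1 / D \<le> 2 * S\<^sup>2" using half D0 S0 by (simp add: field_simps)
  then show "1 / mat_pow A ((t + 1) * K) $ i $ i \<le> 2 * S\<^sup>2" by (simp add: D_def)
  have "\<bar>\<pi> $ i * (1 / D) - 1\<bar> = \<bar>D - \<pi> $ i\<bar> * (1 / D)"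
    using D0 by (simp add: field_simps abs_if)
  also have "\<dots> \<le> (1 / S ^ 29) * (2 * S\<^sup>2)" using dev inv D0 S0 by (intro mult_mono) auto
  also have "\<dots> \<le> (1 / S ^ 29) * S ^ 3"
    using S S0 by (intro mult_left_mono) (auto simp: power2_eq_square power3_eq_cube)
  also have "\<dots> = 1 / S ^ 26" using S0 by (simp add: field_simps flip: power_add)
  finally show "\<bar>\<pi> $ i * (1 / mat_pow A ((t + 1) * K) $ i $ i) - 1\<bar> \<le> 1 / S ^ 26" by (simp add: D_def)
qed

text \<open>The shares of the budget \<open>T * \<epsilon>\<close> are \<open>1 / 16\<close> for the initial gap, \<open>3 / 8\<close> for curvature, \<open>1 / 16\<close> for noise and
  \<open>1 / 2\<close> for mixing. The first three are matched to the constants of \<open>T\<close>, \<open>\<eta>\<close> and \<open>b\<close>. For the last, the quantities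
  to be suppressed are polynomial in \<open>S\<close> of degree below \<open>25\<close>; as \<open>\<epsilon>\<close> may be large, they are compared with \<open>\<epsilon>\<close>
  through \<open>S * \<epsilon> \<ge> 1\<close>.\<close>
lemma error_budget:
  fixes S n L \<Delta> \<sigma> \<epsilon> G T \<eta> u \<rho> m :: real
  assumes S: "5 \<le> S" and n: "1 \<le> n" "n \<le> S" and \<Delta>: "0 \<le> \<Delta>" "\<Delta> \<le> S" and L: "0 < L" "L \<le> S"
    and \<sigma>: "0 < \<sigma>" "\<sigma> \<le> S" and \<epsilon>: "0 < \<epsilon>" "1 / \<epsilon> \<le> S" and G: "0 \<le> G" "G \<le> S"
    and T: "64 * (L * \<Delta> * \<epsilon> powr (- 2)) \<le> T" "T \<le> 64 * (L * \<Delta> * \<epsilon> powr (- 2)) + 1" "0 < T"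
    and \<eta>: "\<eta> = 1 / 4 * (\<epsilon> / L)" and \<rho>: "\<rho> = 1 / S ^ 28" and u: "u = 2 * \<rho> * (2 * S\<^sup>2) + 1 / S ^ 26"
    and m: "m \<le> \<epsilon> / 100"
  shows "\<Delta> / \<eta> + T * (L * \<eta> + 6 * L * \<rho> * \<eta>) + 2 * T * u * (T * (G + n * L * \<eta> * T))
     + 2 * (T * (3 * m)) + 2 * T * u * (T * (n * (2 * \<sigma>))) \<le> T * \<epsilon>"
proof -
  have S0: "0 < S" using S by simp
  have Spow: "5 \<le> S ^ k" if "0 < k" for k using order_trans[OF S self_le_power[of S k]] S that by auto
  have Se: "1 \<le> S * \<epsilon>" using \<epsilon> by (simp add: field_simps)
  have e2: "\<epsilon> powr (- 2) = (1 / \<epsilon>)\<^sup>2"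
    using \<epsilon> by (simp add: powr_minus powr_numeral power_one_over inverse_eq_divide)
  have L\<eta>: "L * \<eta> = \<epsilon> / 4" using L by (simp add: \<eta>)
  have t1: "\<Delta> / \<eta> \<le> T * (\<epsilon> / 16)"
  proof -
    have "\<Delta> / \<eta> = (64 * (L * \<Delta> * \<epsilon> powr (- 2))) * (\<epsilon> / 16)"
      using \<epsilon> L by (simp add: \<eta> e2 field_simps power2_eq_square)
    also have "\<dots> \<le> T * (\<epsilon> / 16)" using T \<epsilon> by (intro mult_right_mono) auto
    finally show ?thesis .
  qed
  have t2: "T * (L * \<eta> + 6 * L * \<rho> * \<eta>) \<le> T * (3 * \<epsilon> / 8)"
  proof (intro mult_left_mono)
    have "25 \<le> S ^ 28"
    proof -
      have "5 * 5 \<le> S ^ 14 * S ^ 14" using Spow[of 14] by (intro mult_mono) auto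
      then show ?thesis by (simp flip: power_add)
    qed
    then have "\<rho> \<le> 1 / 25" unfolding \<rho> by (intro divide_left_mono) auto
    then have "6 * (\<epsilon> / 4) * \<rho> \<le> 6 * (\<epsilon> / 4) * (1 / 25)" using \<epsilon> by (intro mult_left_mono) auto
    moreover have "6 * L * \<rho> * \<eta> = 6 * (\<epsilon> / 4) * \<rho>" using L\<eta> by (simp add: mult_ac)
    ultimately have "L * \<eta> + 6 * L * \<rho> * \<eta> \<le> \<epsilon> / 4 + 6 * (\<epsilon> / 4) * (1 / 25)" using L\<eta> by linarith
    also have "\<dots> \<le> 3 * \<epsilon> / 8" using \<epsilon> by simp
    finally show "L * \<eta> + 6 * L * \<rho> * \<eta> \<le> 3 * \<epsilon> / 8" .
  qed (use T in simp)
  have t3: "2 * (T * (3 * m)) \<le> T * (\<epsilon> / 16)"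
  proof -
    have "T * (6 * m) \<le> T * (\<epsilon> / 16)" using m \<epsilon> T by (intro mult_left_mono) auto
    then show ?thesis by simp
  qed
  have u0: "0 \<le> u" unfolding u \<rho> using S0 by simp
  have u1: "u \<le> 1 / S ^ 25"
  proof -
    have "u = 5 / S ^ 26" unfolding u \<rho> using S0 power_add[of S 26 2] by (simp add: field_simps)
    also have "\<dots> \<le> S / S ^ 26" using S S0 by (intro divide_right_mono) auto
    also have "\<dots> = 1 / S ^ 25" using S0 by (simp add: power_Suc[of S 25, simplified])
    finally show ?thesis .
  qed
  have TS: "T \<le> S ^ 7"
  proof -
    have "L * \<Delta> * (1 / \<epsilon>)\<^sup>2 \<le> S * S * S\<^sup>2"
      using L \<Delta> \<epsilon> S0 by (intro mult_mono power_mono) auto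
    also have "\<dots> = S ^ 4" by (simp add: power2_eq_square power4_eq_xxxx)
    finally have "T \<le> 64 * S ^ 4 + 1" using T(2) e2 by simp
    also have "\<dots> \<le> 125 * S ^ 4" using Spow[of 4] by simp
    also have "\<dots> \<le> S ^ 3 * S ^ 4"
    proof (intro mult_right_mono)
      have "5 ^ 3 \<le> S ^ 3" using S by (intro power_mono) auto
      then show "125 \<le> S ^ 3" by simp
    qed (use S0 in simp)
    also have "\<dots> = S ^ 7" by (simp flip: power_add)
    finally show ?thesis .
  qed
  have up: "x \<le> S * \<epsilon> * x" if "0 \<le> x" for x using mult_right_mono[OF Se that] by simp
  \<comment> \<open>The total gradient and noise that mixing has to suppress, per agent and iteration.\<close>
  have Q: "G + n * L * \<eta> * T + n * (2 * \<sigma>) \<le> S ^ 9 * \<epsilon>"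
  proof -
    have "S ^ 2 \<le> S ^ 8" and "S ^ 3 \<le> S ^ 8" using S by (auto intro!: power_increasing)
    have "G \<le> S ^ 8 * \<epsilon>"
    proof -
      have "S * \<epsilon> * S = S ^ 2 * \<epsilon>" by (simp add: power2_eq_square)
      then have "G \<le> S ^ 2 * \<epsilon>" using up[of S] S0 G by linarith
      also have "\<dots> \<le> S ^ 8 * \<epsilon>" using \<open>S ^ 2 \<le> S ^ 8\<close> \<epsilon> by (intro mult_right_mono) auto
      finally show ?thesis .
    qed
    moreover have "n * L * \<eta> * T \<le> S ^ 8 * \<epsilon>"
    proof -
      have "n * T \<le> S * S ^ 7" using n TS T S0 by (intro mult_mono) auto
      then have "(n * T) * \<epsilon> \<le> S ^ 8 * \<epsilon>" using \<epsilon> by (intro mult_right_mono) (auto simp: power_Suc[of S 7, simplified])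
      moreover have "n * L * \<eta> * T = (n * T) * \<epsilon> / 4" using L\<eta> by (simp add: mult.assoc mult.left_commute)
      moreover have "0 \<le> (n * T) * \<epsilon>" using n T \<epsilon> by simp
      ultimately show ?thesis by linarith
    qed
    moreover have "n * (2 * \<sigma>) \<le> 2 * (S ^ 8 * \<epsilon>)"
    proof -
      have "n * \<sigma> \<le> S * S" using n \<sigma> S0 by (intro mult_mono) auto
      also have "S * S \<le> S * \<epsilon> * (S * S)" using S0 by (intro up) simp
      also have "\<dots> = S ^ 3 * \<epsilon>" by (simp add: power3_eq_cube)
      also have "\<dots> \<le> S ^ 8 * \<epsilon>" using \<open>S ^ 3 \<le> S ^ 8\<close> \<epsilon> by (intro mult_right_mono) auto
      finally show ?thesis by simp
    qed
    ultimately have "G + n * L * \<eta> * T + n * (2 * \<sigma>) \<le> 4 * (S ^ 8 * \<epsilon>)" by linarith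
    also have "\<dots> \<le> S * (S ^ 8 * \<epsilon>)" using S \<epsilon> S0 by (intro mult_right_mono) auto
    also have "\<dots> = S ^ 9 * \<epsilon>" by (simp add: power_Suc[of S 8, simplified])
    finally show ?thesis .
  qed
  have t4: "2 * T * u * (T * (G + n * L * \<eta> * T)) + 2 * T * u * (T * (n * (2 * \<sigma>))) \<le> T * (\<epsilon> / 2)"
  proof -
    have Q0: "0 \<le> G + n * L * \<eta> * T + n * (2 * \<sigma>)"
      using G n L \<epsilon> T \<sigma> unfolding \<eta> by (intro add_nonneg_nonneg mult_nonneg_nonneg) auto
    have "u * (T * (G + n * L * \<eta> * T + n * (2 * \<sigma>))) \<le> (1 / S ^ 25) * (S ^ 7 * (S ^ 9 * \<epsilon>))"
      using u0 u1 TS Q T S0 Q0 by (intro mult_mono mult_nonneg_nonneg) auto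
    also have "S ^ 25 = S ^ 7 * (S ^ 9 * S ^ 9)" by (simp flip: power_add)
    also have "(1 / (S ^ 7 * (S ^ 9 * S ^ 9))) * (S ^ 7 * (S ^ 9 * \<epsilon>)) = \<epsilon> / S ^ 9"
      using S0 by (simp add: field_simps)
    also have "\<dots> \<le> \<epsilon> / 5" using \<epsilon> S0 Spow[of 9] by (intro divide_left_mono) auto
    finally have "2 * T * (u * (T * (G + n * L * \<eta> * T + n * (2 * \<sigma>)))) \<le> 2 * T * (\<epsilon> / 5)"
      using T by (intro mult_left_mono) auto
    also have "\<dots> \<le> T * (\<epsilon> / 2)" using T \<epsilon> by simp
    finally show ?thesis by (simp add: algebra_simps)
  qed
  have "T * (\<epsilon> / 16) + T * (3 * \<epsilon> / 8) + T * (\<epsilon> / 16) + T * (\<epsilon> / 2) = T * \<epsilon>" by (simp add: field_simps)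
  then show ?thesis using t1 t2 t3 t4 by linarith
qed

lemma sample_cost_eq: "sample_cost n b T = n * b * (T + 1)"
  by (induction T) auto

lemma comm_cost_eq: "comm_cost Khat K T = Khat + K + 3 * K * T"
  by (induction T) auto

text \<open>With both unrounded quantities at least 1, rounding costs constant factors only. These are absorbed by the gap between
  \<open>100 powr (p / (p - 1))\<close> and \<open>hidden_bound_p p\<close>, which is at least \<open>10\<^sup>7\<close> because the exponent is at least 1.\<close>
lemma sample_complexity:
  fixes n :: nat and L \<Delta> \<sigma> \<epsilon> p :: real
  assumes p: "1 < p" and pos: "0 < \<sigma>" "0 < \<epsilon>" "0 < n"
    and y: "1 \<le> L * \<Delta> * \<epsilon> powr (- 2)"
    and zz: "1 \<le> 1 / real n * \<sigma> powr (p / (p - 1)) * \<epsilon> powr (- (p / (p - 1)))"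
    and T: "real T \<le> 64 * (L * \<Delta> * \<epsilon> powr (- 2)) + 1"
    and b: "real b \<le> 100 powr (p / (p - 1)) * (1 / real n * \<sigma> powr (p / (p - 1)) * \<epsilon> powr (- (p / (p - 1)))) + 1"
  shows "real (sample_cost n b T) \<le> hidden_bound_p p *
       (L * \<sigma> powr (p / (p - 1)) * \<epsilon> powr (- ((3 * p - 2) / (p - 1))) * \<Delta>)"
proof -
  define q where "q = p / (p - 1)"
  have q1: "1 \<le> q" using p by (simp add: q_def)
  define Y where "Y = L * \<Delta> * \<epsilon> powr (- 2)"
  define Z where "Z = 1 / real n * \<sigma> powr q * \<epsilon> powr (- q)"
  have YZ: "1 \<le> Y" "1 \<le> Z" using y zz by (simp_all add: Y_def Z_def q_def)
  have h1: "1 \<le> (100::real) powr q" using q1 by (intro ge_one_powr_ge_zero) auto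
  have b': "real b \<le> 2 * (100 powr q * Z)"
  proof -
    have "1 * 1 \<le> 100 powr q * Z" using h1 YZ by (intro mult_mono) auto
    then show ?thesis using b by (simp add: Z_def q_def)
  qed
  have T': "real T + 1 \<le> 66 * Y" using T YZ by (simp add: Y_def)
  have "real (sample_cost n b T) = real n * real b * (real T + 1)" by (simp add: sample_cost_eq algebra_simps)
  also have "\<dots> \<le> real n * (2 * (100 powr q * Z)) * (66 * Y)"
    using b' T' YZ by (intro mult_mono) auto
  also have "\<dots> = (132 * 100 powr q) * (real n * Z * Y)" by simp
  also have "\<dots> \<le> hidden_bound_p p * (real n * Z * Y)"
  proof (rule mult_right_mono)
    have "132 \<le> (10 ^ 7 :: real) powr 1" by simp
    also have "\<dots> \<le> (10 ^ 7) powr q" using q1 by (intro powr_mono) auto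
    finally have "132 * 100 powr q \<le> (10 ^ 7) powr q * 100 powr q" by (intro mult_right_mono) auto
    also have "\<dots> = (10 ^ 9) powr q" by (simp flip: powr_mult)
    finally show "132 * 100 powr q \<le> hidden_bound_p p" by (simp add: hidden_bound_p_def hidden_bound_def q_def)
  qed (use YZ in simp)
  also have "real n * Z * Y = L * \<sigma> powr q * \<epsilon> powr (- ((3 * p - 2) / (p - 1))) * \<Delta>"
  proof -
    have "- ((3 * p - 2) / (p - 1)) = - q + - 2" using p by (simp add: q_def field_simps)
    then have "\<epsilon> powr (- ((3 * p - 2) / (p - 1))) = \<epsilon> powr (- q) * \<epsilon> powr (- 2)" by (simp only: powr_add)
    then show ?thesis using pos by (simp add: Y_def Z_def)
  qed
  finally show ?thesis by (simp add: q_def)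
qed

lemma comm_complexity:
  fixes L \<Delta> \<epsilon> l g :: real
  assumes y: "1 \<le> L * \<Delta> * \<epsilon> powr (- 2)" and l: "1 \<le> l" and g: "1 \<le> g"
    and T: "real T \<le> 64 * (L * \<Delta> * \<epsilon> powr (- 2)) + 1"
    and K: "real K \<le> 30 * l * g + 1"
  shows "real (comm_cost K K T) \<le> hidden_bound * l * (L * g * \<epsilon> powr (- 2) * \<Delta>)"
proof -
  define Y where "Y = L * \<Delta> * \<epsilon> powr (- 2)"
  have "1 * 1 \<le> l * g" using l g by (intro mult_mono) auto
  then have K': "real K \<le> 31 * (l * g)" using K by simp
  have T': "2 + 3 * real T \<le> 197 * Y" using T y by (simp add: Y_def)
  have "real (comm_cost K K T) = real K * (2 + 3 * real T)" by (simp add: comm_cost_eq algebra_simps)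
  also have "\<dots> \<le> (31 * (l * g)) * (197 * Y)" using K' T' l g by (intro mult_mono) auto
  also have "\<dots> = 6107 * (l * g * Y)" by simp
  also have "\<dots> \<le> hidden_bound * (l * g * Y)"
    using l g y by (intro mult_right_mono) (auto simp: hidden_bound_def Y_def)
  finally show ?thesis by (simp add: Y_def mult_ac)
qed

lemma dnsgd_pd_accuracy:
  fixes F :: "'n::finite \<Rightarrow> real^'d::finite \<Rightarrow> 's \<Rightarrow> real" and A :: "real^'n^'n"
  assumes net: "strongly_connected_graph E" "mixing_matrix E A" "perron_vector A \<pi>"
    and sp: "stochastic_problem \<D> F" and L: "0 < L" and smooth: "\<And>i. L_smooth L (local_obj \<D> F i)"
    and bdd: "bdd_below (range (global_obj \<D> F))"
    and p: "1 < p" "p \<le> 2" and \<sigma>: "0 < \<sigma>" and orc: "oracle_condition \<D> F p \<sigma>" and \<epsilon>: "0 < \<epsilon>"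
    and \<Delta>: "\<Delta> = global_obj \<D> F x0 - (INF x. global_obj \<D> F x)"
    and S: "5 \<le> S" "real CARD('n) \<le> S" "net_kappa \<pi> \<le> S" "L \<le> S" "\<Delta> \<le> S" "\<sigma> \<le> S" "1 / \<epsilon> \<le> S"
      "(\<Sum>i\<in>UNIV. norm (grad (local_obj \<D> F i) x0)) \<le> S"
    and T: "64 * (L * \<Delta> * \<epsilon> powr (- 2)) \<le> real T" "real T \<le> 64 * (L * \<Delta> * \<epsilon> powr (- 2)) + 1" "0 < T"
    and b: "100 powr (p / (p - 1)) * (1 / real CARD('n) * \<sigma> powr (p / (p - 1)) * \<epsilon> powr (- (p / (p - 1)))) \<le> real b" "0 < b"
    and K: "30 * ln S * (1 / (1 - net_beta A \<pi>)) \<le> real K" "0 < K"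
    and \<eta>: "\<eta> = 1 / 4 * (\<epsilon> / L)"
  shows "integrable (dnsgd_pd_space \<D> T)
            (\<lambda>\<omega>. norm (grad (global_obj \<D> F) (dnsgd_pd_output A F x0 \<eta> K K b i \<omega>)))"
    and "(\<integral>\<omega>. norm (grad (global_obj \<D> F) (dnsgd_pd_output A F x0 \<eta> K K b i \<omega>)) \<partial>dnsgd_pd_space \<D> T) \<le> \<epsilon>"
proof -
  let ?n = "real CARD('n)" and ?\<nu> = "minibatch_error \<D> F A x0 \<eta> K K b" and ?f = "global_obj \<D> F"
  note ctx = sp smooth p \<sigma> orc b(2)
  define h where "h t w = norm (grad ?f (fst (dnsgd_pd A F x0 \<eta> K K b w t) $ i))" for t w
  define G where "G = (\<Sum>j\<in>UNIV. norm (grad (local_obj \<D> F j) x0))"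
  define \<rho> where "\<rho> = 1 / S ^ 28"
  define u where "u = 2 * \<rho> * (2 * S\<^sup>2) + 1 / S ^ 26"
  define m where "m = \<sigma> * (?n * real b) powr (1 / p) / (?n * real b)"
  have eta: "0 < \<eta>" using \<epsilon> L by (simp add: \<eta>)
  have beta: "net_beta A \<pi> ^ K \<le> 1 / S ^ 30"
    using net_beta_nonneg[OF net] net_beta_less_1[OF net] S(1) K by (intro gossip_power_bound) auto
  note gossip = gossip_accuracy[OF net S(1-3) K(2) beta]
  have low: "(INF x. ?f x) \<le> ?f y" for y by (rule cINF_lower[OF bdd]) simp
  have \<Delta>0: "0 \<le> \<Delta>" using low[of x0] by (simp add: \<Delta>)
  have S0: "0 < S" using S by simp
  have \<rho>: "0 \<le> \<rho>" "\<rho> \<le> 1 / 2"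
  proof -
    have "2 \<le> S ^ 28" using order_trans[OF S(1) self_le_power[of S 28]] S by auto
    then show "\<rho> \<le> 1 / 2" unfolding \<rho>_def by (intro divide_left_mono) auto
    show "0 \<le> \<rho>" using S0 by (simp add: \<rho>_def)
  qed
  have u0: "0 \<le> u" using S0 \<rho> by (simp add: u_def)
  have path: "(\<Sum>t<T. h t w) \<le> (\<Delta> / \<eta> + real T * (L * \<eta> + 6 * L * \<rho> * \<eta>) + 2 * real T * u * (real T * (G + ?n * L * \<eta> * real T)))
      + 2 / ?n * (\<Sum>t<T. norm (\<Sum>j\<in>UNIV. ?\<nu> t j w)) + 2 * real T * u * (\<Sum>t<T. \<Sum>j\<in>UNIV. norm (?\<nu> t j w))" for w
    using dnsgd_pd_gradient_sum_bound[OF net smooth L eta \<rho>(2) gossip(1)[folded \<rho>_def] gossip(2-4) low,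
        where T = T and ?x0.0 = x0 and b = b and w = w and i = i]
    unfolding h_def[symmetric] \<Delta>[symmetric] G_def[symmetric] u_def[symmetric]
    by (simp add: distrib_left)
  have G0: "0 \<le> G" by (simp add: G_def sum_nonneg)
  have "(\<integral>\<^sup>+w. (\<Sum>t<T. ennreal (h t w)) \<partial>sample_paths \<D>)
     \<le> ennreal ((\<Delta> / \<eta> + real T * (L * \<eta> + 6 * L * \<rho> * \<eta>) + 2 * real T * u * (real T * (G + ?n * L * \<eta> * real T)))
      + 2 / ?n * (real T * (3 * \<sigma> * (?n * real b) powr (1 / p) / real b)) + 2 * real T * u * (real T * (?n * (2 * \<sigma>))))"
    by (rule dnsgd_pd_expected_gradient_sum[OF ctx path])
       (use \<Delta>0 eta L \<rho> u0 G0 in \<open>auto simp: h_def intro!: add_nonneg_nonneg mult_nonneg_nonneg divide_nonneg_nonneg\<close>)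
  also have "\<dots> \<le> ennreal (real T * \<epsilon>)"
  proof (rule ennreal_leI)
    have "2 / ?n * (real T * (3 * \<sigma> * (?n * real b) powr (1 / p) / real b)) = 2 * (real T * (3 * m))"
      by (simp add: m_def)
    moreover have "m \<le> \<epsilon> / 100"
      unfolding m_def by (rule minibatch_noise_level[OF p(1) \<sigma> \<epsilon> _ b(1)]) simp
    then have "\<Delta> / \<eta> + real T * (L * \<eta> + 6 * L * \<rho> * \<eta>) + 2 * real T * u * (real T * (G + ?n * L * \<eta> * real T))
      + 2 * (real T * (3 * m)) + 2 * real T * u * (real T * (?n * (2 * \<sigma>))) \<le> real T * \<epsilon>"
      using S T L \<sigma> \<epsilon> \<Delta>0 G0 by (intro error_budget[OF S(1) _ S(2) \<Delta>0 S(5) L S(4) \<sigma> S(6) \<epsilon> S(7) G0 _ T(1,2) _ \<eta> \<rho>_def u_def])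
        (auto simp: G_def Suc_le_eq)
    ultimately show "(\<Delta> / \<eta> + real T * (L * \<eta> + 6 * L * \<rho> * \<eta>) + 2 * real T * u * (real T * (G + ?n * L * \<eta> * real T)))
      + 2 / ?n * (real T * (3 * \<sigma> * (?n * real b) powr (1 / p) / real b)) + 2 * real T * u * (real T * (?n * (2 * \<sigma>))) \<le> real T * \<epsilon>"
      by simp
  qed
  finally have bound: "(\<integral>\<^sup>+w. (\<Sum>t<T. ennreal (h t w)) \<partial>sample_paths \<D>) \<le> ennreal (real T * \<epsilon>)" .
  have grad_meas: "grad ?f \<in> borel_measurable borel"
  proof -
    have eq: "grad ?f = (\<lambda>x. (1 / ?n) *\<^sub>R (\<Sum>i\<in>UNIV. grad (local_obj \<D> F i) x))"
      by (rule ext) (rule grad_global_obj(1)[OF smooth])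
    show ?thesis unfolding eq
    by (intro borel_measurable_scaleR borel_measurable_sum borel_measurable_const borel_measurable_grad_local[OF ctx])
  qed
  have meas: "h t \<in> borel_measurable (sample_paths \<D>)" for t
    unfolding h_def[abs_def]
    by (intro measurable_compose[OF _ borel_measurable_norm] measurable_compose[OF _ grad_meas]
        borel_measurable_vec_nth' borel_measurable_dnsgd_pd(1)[OF ctx])
  have out: "(\<lambda>\<omega>. norm (grad ?f (dnsgd_pd_output A F x0 \<eta> K K b i \<omega>))) = (\<lambda>(w, t). h t w)"
    by (auto simp: dnsgd_pd_output_def h_def fun_eq_iff)
  note fin = uniform_index_expectation[OF prob_space_sample_paths[OF ctx] T(3), of h \<epsilon>, OF meas _ _ bound]
  show "integrable (dnsgd_pd_space \<D> T) (\<lambda>\<omega>. norm (grad ?f (dnsgd_pd_output A F x0 \<eta> K K b i \<omega>)))"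
    unfolding out dnsgd_pd_space_def using \<epsilon> by (intro fin(1)) (auto simp: h_def)
  show "(\<integral>\<omega>. norm (grad ?f (dnsgd_pd_output A F x0 \<eta> K K b i \<omega>)) \<partial>dnsgd_pd_space \<D> T) \<le> \<epsilon>"
    unfolding out dnsgd_pd_space_def using \<epsilon> by (intro fin(2)) (auto simp: h_def)
qed

theorem theorem1:
  "\<exists>c\<^sub>T c\<^sub>\<eta> c\<^sub>K :: real. \<exists>c\<^sub>b :: real \<Rightarrow> real.
     universal_const c\<^sub>T \<and> universal_const c\<^sub>\<eta> \<and> universal_const c\<^sub>K \<and> universal_const_p c\<^sub>b \<and>
     (\<forall>(E :: ('n::finite \<times> 'n) set) (A :: real^'n^'n) (\<pi> :: real^'n)
        (\<D> :: 'n \<Rightarrow> 's measure) (F :: 'n \<Rightarrow> real^('d::finite) \<Rightarrow> 's \<Rightarrow> real)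
        (L :: real) (p :: real) (\<sigma> :: real) (x\<^sub>0 :: real^'d) (\<epsilon> :: real).
        strongly_connected_graph E \<longrightarrow> mixing_matrix E A \<longrightarrow> perron_vector A \<pi> \<longrightarrow>
        stochastic_problem \<D> F \<longrightarrow>
        L > 0 \<longrightarrow> (\<forall>i. L_smooth L (local_obj \<D> F i)) \<longrightarrow>
        bdd_below (range (global_obj \<D> F)) \<longrightarrow>
        1 < p \<longrightarrow> p \<le> 2 \<longrightarrow> \<sigma> > 0 \<longrightarrow> oracle_condition \<D> F p \<sigma> \<longrightarrow>
        \<epsilon> > 0 \<longrightarrow>
        (let n = CARD('n);
             f = global_obj \<D> F;
             \<Delta> = f x\<^sub>0 - (INF x. f x);
             \<beta> = net_beta A \<pi>;
             \<l> = log_factor (net_kappa \<pi>) L \<Delta> \<sigma> \<epsilon> (\<lambda>i. norm (grad (local_obj \<D> F i) x\<^sub>0));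
             T = round_up_pos (c\<^sub>T * (L * \<Delta> * \<epsilon> powr (- 2)));
             \<eta> = c\<^sub>\<eta> * (\<epsilon> / L);
             b = round_up_pos (c\<^sub>b p *
                   (1 / real n * \<sigma> powr (p / (p - 1)) * \<epsilon> powr (- (p / (p - 1)))));
             K = round_up_pos (c\<^sub>K * \<l> * (1 / (1 - \<beta>)));
             Khat = K
         in (\<forall>i. integrable (dnsgd_pd_space \<D> T)
                   (\<lambda>\<omega>. norm (grad f (dnsgd_pd_output A F x\<^sub>0 \<eta> Khat K b i \<omega>))) \<and>
                 (\<integral>\<omega>. norm (grad f (dnsgd_pd_output A F x\<^sub>0 \<eta> Khat K b i \<omega>))
                    \<partial>dnsgd_pd_space \<D> T) \<le> \<epsilon>) \<and>
            (L * \<Delta> * \<epsilon> powr (- 2) \<ge> 1 \<longrightarrow>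
             1 / real n * \<sigma> powr (p / (p - 1)) * \<epsilon> powr (- (p / (p - 1))) \<ge> 1 \<longrightarrow>
               real (sample_cost n b T) \<le> hidden_bound_p p *
                 (L * \<sigma> powr (p / (p - 1)) * \<epsilon> powr (- ((3 * p - 2) / (p - 1))) * \<Delta>)) \<and>
            (L * \<Delta> * \<epsilon> powr (- 2) \<ge> 1 \<longrightarrow>
               real (comm_cost Khat K T) \<le> hidden_bound * \<l> *
                 (L * (1 / (1 - \<beta>)) * \<epsilon> powr (- 2) * \<Delta>))))"
proof (intro exI conjI allI impI)
  \<comment> \<open>\<open>64\<close> and \<open>1 / 4\<close> leave a large share of \<open>T * \<epsilon>\<close> to the errors; \<open>30\<close> exceeds all exponents of \<open>S\<close> in \<open>error_budget\<close>.\<close>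
  show "universal_const 64" "universal_const (1 / 4)" "universal_const 30"
    by (simp_all add: universal_const_def hidden_bound_def)
  show "universal_const_p (\<lambda>p. 100 powr (p / (p - 1)))"
    unfolding universal_const_p_def
  proof (intro allI impI)
    fix p :: real assume p: "1 < p \<and> p \<le> 2"
    then have q: "0 \<le> p / (p - 1)" by simp
    have "1 \<le> (100::real) powr (p / (p - 1))" "1 \<le> hidden_bound_p p"
      unfolding hidden_bound_p_def hidden_bound_def using q by (auto intro: ge_one_powr_ge_zero)
    then have "1 / hidden_bound_p p \<le> 1 \<and> 1 \<le> (100::real) powr (p / (p - 1))" by simp
    moreover have "100 powr (p / (p - 1)) \<le> hidden_bound_p p"
      unfolding hidden_bound_p_def hidden_bound_def using q by (intro powr_mono2) auto
    ultimately show "1 / hidden_bound_p p \<le> 100 powr (p / (p - 1)) \<and> 100 powr (p / (p - 1)) \<le> hidden_bound_p p"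
      by linarith
  qed
next
  fix E :: "('n \<times> 'n) set" and A :: "real^'n^'n" and \<pi> :: "real^'n"
    and \<D> :: "'n \<Rightarrow> 's measure" and F :: "'n \<Rightarrow> real^'d \<Rightarrow> 's \<Rightarrow> real"
    and L p \<sigma> :: real and x\<^sub>0 :: "real^'d" and \<epsilon> :: real
  assume net: "strongly_connected_graph E" "mixing_matrix E A" "perron_vector A \<pi>"
    and sp: "stochastic_problem \<D> F" and L: "L > 0" and smooth: "\<forall>i. L_smooth L (local_obj \<D> F i)"
    and bdd: "bdd_below (range (global_obj \<D> F))"
    and p: "1 < p" "p \<le> 2" and \<sigma>: "\<sigma> > 0" and orc: "oracle_condition \<D> F p \<sigma>" and \<epsilon>: "\<epsilon> > 0"
  define \<Delta> where "\<Delta> = global_obj \<D> F x\<^sub>0 - (INF x. global_obj \<D> F x)"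
  define \<beta> where "\<beta> = net_beta A \<pi>"
  define G where "G = (\<Sum>i\<in>UNIV. norm (grad (local_obj \<D> F i) x\<^sub>0))"
  define S where "S = 3 + real CARD('n) + net_kappa \<pi> + L + \<Delta> + \<sigma> + 1 / \<epsilon> + G"
  define l where "l = log_factor (net_kappa \<pi>) L \<Delta> \<sigma> \<epsilon> (\<lambda>i. norm (grad (local_obj \<D> F i) x\<^sub>0))"
  have l: "l = ln S" by (simp add: l_def log_factor_def S_def G_def)
  define T where "T = round_up_pos (64 * (L * \<Delta> * \<epsilon> powr (- 2)))"
  define b where "b = round_up_pos (100 powr (p / (p - 1)) *
      (1 / real CARD('n) * \<sigma> powr (p / (p - 1)) * \<epsilon> powr (- (p / (p - 1)))))"
  define K where "K = round_up_pos (30 * l * (1 / (1 - \<beta>)))"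
  have beta: "0 \<le> \<beta>" "\<beta> < 1"
    unfolding \<beta>_def by (rule net_beta_nonneg[OF net], rule net_beta_less_1[OF net])
  have \<Delta>0: "0 \<le> \<Delta>" unfolding \<Delta>_def using cINF_lower[OF bdd, of x\<^sub>0] by simp
  have G0: "0 \<le> G" by (simp add: G_def sum_nonneg)
  have n1: "1 \<le> real CARD('n)" by (simp add: Suc_le_eq)
  have k1: "1 \<le> net_kappa \<pi>" by (rule net_kappa_ge_1[OF net])
  have e0: "0 < 1 / \<epsilon>" using \<epsilon> by simp
  \<comment> \<open>\<open>5 \<le> S\<close> since \<open>n\<close> and \<open>\<kappa>\<close> are at least 1.\<close>
  have S: "5 \<le> S" "real CARD('n) \<le> S" "net_kappa \<pi> \<le> S" "L \<le> S" "\<Delta> \<le> S" "\<sigma> \<le> S" "1 / \<epsilon> \<le> S" "G \<le> S"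
    unfolding S_def using n1 k1 L \<Delta>0 \<sigma> e0 G0 by linarith+
  have l1: "1 \<le> l"
  proof -
    have "exp 1 \<le> S" using exp_le S(1) by linarith
    then have "ln (exp 1) \<le> ln S" by (subst ln_le_cancel_iff) (use S in auto)
    then show ?thesis by (simp add: l)
  qed
  have g1: "1 \<le> 1 / (1 - \<beta>)" using beta by simp
  have arg0: "0 \<le> 64 * (L * \<Delta> * \<epsilon> powr (- 2))" using L \<Delta>0 by simp
  have T: "64 * (L * \<Delta> * \<epsilon> powr (- 2)) \<le> real T" "real T \<le> 64 * (L * \<Delta> * \<epsilon> powr (- 2)) + 1" "0 < T"
    unfolding T_def by (rule round_up_pos_ge, rule round_up_pos_le[OF arg0], rule round_up_pos_pos)
  have b: "100 powr (p / (p - 1)) * (1 / real CARD('n) * \<sigma> powr (p / (p - 1)) * \<epsilon> powr (- (p / (p - 1)))) \<le> real b"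
    "real b \<le> 100 powr (p / (p - 1)) * (1 / real CARD('n) * \<sigma> powr (p / (p - 1)) * \<epsilon> powr (- (p / (p - 1)))) + 1" "0 < b"
    unfolding b_def by (rule round_up_pos_ge, rule round_up_pos_le, simp, rule round_up_pos_pos)
  have kap0: "0 \<le> 30 * l * (1 / (1 - \<beta>))" using l1 beta by (intro mult_nonneg_nonneg) auto
  have K: "30 * l * (1 / (1 - \<beta>)) \<le> real K" "real K \<le> 30 * l * (1 / (1 - \<beta>)) + 1" "0 < K"
    unfolding K_def by (rule round_up_pos_ge, rule round_up_pos_le[OF kap0], rule round_up_pos_pos)
  note acc = dnsgd_pd_accuracy[OF net sp L smooth[rule_format] bdd p \<sigma> orc \<epsilon> \<Delta>_def S(1-7) S(8)[unfolded G_def]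
      T b(1,3) K(1)[unfolded l \<beta>_def] K(3) refl]
  have n0: "0 < CARD('n)" by simp
  show "let n = CARD('n); f = global_obj \<D> F; \<Delta> = f x\<^sub>0 - (INF x. f x); \<beta> = net_beta A \<pi>;
             \<l> = log_factor (net_kappa \<pi>) L \<Delta> \<sigma> \<epsilon> (\<lambda>i. norm (grad (local_obj \<D> F i) x\<^sub>0));
             T = round_up_pos (64 * (L * \<Delta> * \<epsilon> powr (- 2)));
             \<eta> = 1 / 4 * (\<epsilon> / L);
             b = round_up_pos (100 powr (p / (p - 1)) *
                   (1 / real n * \<sigma> powr (p / (p - 1)) * \<epsilon> powr (- (p / (p - 1)))));
             K = round_up_pos (30 * \<l> * (1 / (1 - \<beta>)));
             Khat = K
         in (\<forall>i. integrable (dnsgd_pd_space \<D> T)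
                   (\<lambda>\<omega>. norm (grad f (dnsgd_pd_output A F x\<^sub>0 \<eta> Khat K b i \<omega>))) \<and>
                 (\<integral>\<omega>. norm (grad f (dnsgd_pd_output A F x\<^sub>0 \<eta> Khat K b i \<omega>))
                    \<partial>dnsgd_pd_space \<D> T) \<le> \<epsilon>) \<and>
            (L * \<Delta> * \<epsilon> powr (- 2) \<ge> 1 \<longrightarrow>
             1 / real n * \<sigma> powr (p / (p - 1)) * \<epsilon> powr (- (p / (p - 1))) \<ge> 1 \<longrightarrow>
               real (sample_cost n b T) \<le> hidden_bound_p p *
                 (L * \<sigma> powr (p / (p - 1)) * \<epsilon> powr (- ((3 * p - 2) / (p - 1))) * \<Delta>)) \<and>
            (L * \<Delta> * \<epsilon> powr (- 2) \<ge> 1 \<longrightarrow>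
               real (comm_cost Khat K T) \<le> hidden_bound * \<l> *
                 (L * (1 / (1 - \<beta>)) * \<epsilon> powr (- 2) * \<Delta>))"
    unfolding Let_def \<Delta>_def[symmetric] \<beta>_def[symmetric] l_def[symmetric]
      T_def[symmetric] b_def[symmetric] K_def[symmetric]
  proof (intro conjI allI impI)
    show "real (sample_cost CARD('n) b T) \<le> hidden_bound_p p *
        (L * \<sigma> powr (p / (p - 1)) * \<epsilon> powr (- ((3 * p - 2) / (p - 1))) * \<Delta>)"
      if "L * \<Delta> * \<epsilon> powr (- 2) \<ge> 1" "1 / real CARD('n) * \<sigma> powr (p / (p - 1)) * \<epsilon> powr (- (p / (p - 1))) \<ge> 1"
      by (rule sample_complexity[OF p(1) \<sigma> \<epsilon> n0 that T(2) b(2)])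
    show "real (comm_cost K K T) \<le> hidden_bound * l * (L * (1 / (1 - \<beta>)) * \<epsilon> powr (- 2) * \<Delta>)"
      if "L * \<Delta> * \<epsilon> powr (- 2) \<ge> 1"
      by (rule comm_complexity[OF that l1 g1 T(2) K(2)])
  qed (rule acc)+
qed

end
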